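(* Let $\mathcal{Q}$ be a linear differential operator of first order on $\mathbb{T}^2$ with smooth bounded (real) coefficients. Then there is a constant $C$, independent of $f$, such that for every $f\in H^2(\mathbb{T}^2,\mathbb{R})$, $$\langle\mathcal{Q}^2f,f\rangle_{L^2}+\langle\mathcal{Q}f,\mathcal{Q}f\rangle_{L^2}\le C\|f\|_{L^2}^2 .$$ Moreover, for every $k\in[1,\infty)$ and every pseudodifferential operator $\mathcal{P}$ of order $k$ on $\mathbb{T}^2$, there is a constant $C$, independent of $f$, such that for every $f\in H^{2+k}(\mathbb{T}^2,\mathbb{R})$, $$\langle\mathcal{P}\mathcal{Q}^2f,\mathcal{P}f\rangle_{L^2}+\langle\mathcal{P}\mathcal{Q}f,\mathcal{P}\mathcal{Q}f\rangle_{L^2}\le C\|f\|_{H^k}^2 .$$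
   Context: $\mathbb{T}^2=\mathbb{R}^2/(2\pi\mathbb{Z}^2)$. $H^s$ is the $L^2$-based Sobolev space with norm $\|f\|_{H^s}=\|(I-\Delta)^{s/2}f\|_{L^2}$. $\langle\cdot,\cdot\rangle_{L^2}$ is the real $L^2(\mathbb{T}^2)$ inner product; all functions are real-valued and the operators $\mathcal{Q}$ and $\mathcal{P}$ act on real-valued functions (sending real-valued functions to real-valued functions). Pseudodifferential operators are those of the classical (Hörmander) calculus. The constants $C$ may depend on $\mathcal{Q}$, $\mathcal{P}$, $k$ and the domain. *)

theory Defs
  imports "HOL-Analysis.Analysis"
begin

text \<open>
  Functions on the torus \<open>\<T>\<^sup>2 = \<real>\<^sup>2 / (2\<pi>\<int>\<^sup>2)\<close> are rendered as functions on the plane that are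
  \<open>2\<pi>\<close>-periodic in both variables.  Elements of \<open>L\<^sup>2\<close> are represented by such functions;
  the operators below that are only determined almost everywhere choose a representative, and
  none of the norms and inner products depends on that choice.
\<close>

type_synonym plane = "real^2"

definition periodic :: "(plane \<Rightarrow> 'b) \<Rightarrow> bool" where
  "periodic f \<longleftrightarrow> (\<forall>x i. f (x + axis i (2 * pi)) = f x)"

definition torus_cell :: "plane set" where
  "torus_cell = cbox 0 (\<chi> i. 2 * pi)"

abbreviation torus_measure :: "plane measure" where
  "torus_measure \<equiv> lebesgue_on torus_cell"


subsection \<open>Smooth functions\<close>

definition dir_deriv ::
  "'a::real_normed_vector \<Rightarrow> ('a \<Rightarrow> 'b::real_normed_vector) \<Rightarrow> 'a \<Rightarrow> 'b" where
  "dir_deriv v f = (\<lambda>x. frechet_derivative f (at x) v)"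

definition smooth :: "('a::real_normed_vector \<Rightarrow> 'b::real_normed_vector) \<Rightarrow> bool" where
  "smooth f \<longleftrightarrow> (\<forall>vs x. foldr dir_deriv vs f differentiable (at x))"

definition smooth_torus :: "(plane \<Rightarrow> real) set" where
  "smooth_torus = {f. smooth f \<and> periodic f}"


subsection \<open>The spaces \<open>L\<^sup>2\<close> and \<open>H\<^sup>s\<close>\<close>

definition L2_torus :: "(plane \<Rightarrow> real) set" where
  "L2_torus = {f. periodic f \<and> f \<in> borel_measurable lebesgue \<and>
                  integrable torus_measure (\<lambda>x. (f x)\<^sup>2)}"

definition L2_inner :: "(plane \<Rightarrow> real) \<Rightarrow> (plane \<Rightarrow> real) \<Rightarrow> real" where
  "L2_inner f g = (LINT x|torus_measure. f x * g x)"

definition L2_norm :: "(plane \<Rightarrow> real) \<Rightarrow> real" where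
  "L2_norm f = sqrt (L2_inner f f)"

definition freq :: "int^2 \<Rightarrow> plane" where
  "freq n = (\<chi> i. real_of_int (n $ i))"

definition fourier_coeff :: "(plane \<Rightarrow> real) \<Rightarrow> int^2 \<Rightarrow> complex" where
  "fourier_coeff f n =
     (LINT x|torus_measure. cis (- (freq n \<bullet> x)) * complex_of_real (f x)) / (2 * pi)\<^sup>2"

text \<open>
  \<open>is_bessel s f g\<close> says that \<open>g = (I - \<Delta>)\<^bsup>s/2\<^esup> f\<close> in \<open>L\<^sup>2\<close>: the operator \<open>I - \<Delta>\<close> acts on
  \<open>exp (i n \<cdot> x)\<close> as multiplication by \<open>1 + \<bar>n\<bar>\<^sup>2\<close>.
\<close>

definition is_bessel :: "real \<Rightarrow> (plane \<Rightarrow> real) \<Rightarrow> (plane \<Rightarrow> real) \<Rightarrow> bool" where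
  "is_bessel s f g \<longleftrightarrow> g \<in> L2_torus \<and>
     (\<forall>n. fourier_coeff g n =
        complex_of_real ((1 + (norm (freq n))\<^sup>2) powr (s / 2)) * fourier_coeff f n)"

definition bessel :: "real \<Rightarrow> (plane \<Rightarrow> real) \<Rightarrow> plane \<Rightarrow> real" where
  "bessel s f = (SOME g. is_bessel s f g)"

text \<open>Only meant for \<open>s \<ge> 0\<close>, where \<open>H\<^sup>s \<subseteq> L\<^sup>2\<close>.\<close>

definition sobolev :: "real \<Rightarrow> (plane \<Rightarrow> real) set" where
  "sobolev s = {f \<in> L2_torus. \<exists>g. is_bessel s f g}"

definition sobolev_norm :: "real \<Rightarrow> (plane \<Rightarrow> real) \<Rightarrow> real" where
  "sobolev_norm s f = L2_norm (bessel s f)"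


subsection \<open>First-order differential operators\<close>

definition is_weak_partial :: "2 \<Rightarrow> (plane \<Rightarrow> real) \<Rightarrow> (plane \<Rightarrow> real) \<Rightarrow> bool" where
  "is_weak_partial i f g \<longleftrightarrow> g \<in> L2_torus \<and>
     (\<forall>\<phi>\<in>smooth_torus. L2_inner g \<phi> = - L2_inner f (dir_deriv (axis i 1) \<phi>))"

definition weak_partial :: "2 \<Rightarrow> (plane \<Rightarrow> real) \<Rightarrow> plane \<Rightarrow> real" where
  "weak_partial i f = (SOME g. is_weak_partial i f g)"

text \<open>
  The coefficients are smooth functions on the compact torus, hence bounded together with all
  their derivatives.  A term of order zero is allowed.
\<close>

definition first_order_diff_op :: "((plane \<Rightarrow> real) \<Rightarrow> plane \<Rightarrow> real) \<Rightarrow> bool" where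
  "first_order_diff_op Q \<longleftrightarrow>
     (\<exists>b c. (\<forall>i. b i \<in> smooth_torus) \<and> c \<in> smooth_torus \<and>
        (\<forall>f x. Q f x = (\<Sum>i\<in>UNIV. b i x * weak_partial i f x) + c x * f x))"


subsection \<open>Pseudodifferential operators\<close>

text \<open>
  Hoermander's class \<open>S\<^sup>k = S\<^sup>k\<^sub>1\<^sub>,\<^sub>0\<close> on \<open>\<T>\<^sup>2 \<times> \<real>\<^sup>2\<close>.  The lists \<open>is\<close> and \<open>js\<close> enumerate the
  coordinate directions of an \<open>x\<close>- and a \<open>\<xi>\<close>-derivative; their lengths are the orders.
\<close>

definition symbol_class :: "real \<Rightarrow> (plane \<times> plane \<Rightarrow> complex) set" where
  "symbol_class k = {a. smooth a \<and> (\<forall>\<xi>. periodic (\<lambda>x. a (x, \<xi>))) \<and>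
     (\<forall>is js. \<exists>C. \<forall>x \<xi>.
        norm (foldr (\<lambda>i. dir_deriv (axis i 1, 0)) is
               (foldr (\<lambda>j. dir_deriv (0, axis j 1)) js a) (x, \<xi>))
        \<le> C * (1 + norm \<xi>) powr (k - real (length js)))}"

text \<open>
  The Kohn-Nirenberg quantization \<open>a(x,D)\<close> maps \<open>exp (i n \<cdot> x)\<close> to \<open>a(x,n) exp (i n \<cdot> x)\<close>, so on a
  smooth periodic function, whose Fourier transform is carried by \<open>\<int>\<^sup>2\<close>, it is the
  following absolutely convergent series.  Every operator with smooth kernel on the torus is of
  this form, with a symbol in all the classes \<open>S\<^sup>m\<close>.  The symbol is complex-valued; that the
  operator preserves real-valuedness is expressed by the type of \<open>P\<close>.
\<close>

definition pseudodiff_op :: "real \<Rightarrow> ((plane \<Rightarrow> real) \<Rightarrow> plane \<Rightarrow> real) \<Rightarrow> bool" where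
  "pseudodiff_op k P \<longleftrightarrow> (\<exists>a\<in>symbol_class k. \<forall>u\<in>smooth_torus. \<forall>x.
     ((\<lambda>n. a (x, freq n) * fourier_coeff u n * cis (freq n \<bullet> x))
        has_sum complex_of_real (P u x)) UNIV)"

text \<open>
  The action of an operator \<open>P\<close> of order \<open>k\<close>, given on smooth functions, on all of \<open>H\<^sup>k\<close>: its
  continuous extension \<open>H\<^sup>k \<rightarrow> L\<^sup>2\<close>.
\<close>

definition is_extension_value ::
  "real \<Rightarrow> ((plane \<Rightarrow> real) \<Rightarrow> plane \<Rightarrow> real) \<Rightarrow> (plane \<Rightarrow> real) \<Rightarrow> (plane \<Rightarrow> real) \<Rightarrow> bool" where
  "is_extension_value k P f g \<longleftrightarrow> g \<in> L2_torus \<and>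
     (\<exists>u. (\<forall>j::nat. u j \<in> smooth_torus) \<and>
          (\<lambda>j. sobolev_norm k (\<lambda>x. u j x - f x)) \<longlonglongrightarrow> 0 \<and>
          (\<lambda>j. L2_norm (\<lambda>x. P (u j) x - g x)) \<longlonglongrightarrow> 0)"

definition sobolev_ext ::
  "real \<Rightarrow> ((plane \<Rightarrow> real) \<Rightarrow> plane \<Rightarrow> real) \<Rightarrow> (plane \<Rightarrow> real) \<Rightarrow> plane \<Rightarrow> real" where
  "sobolev_ext k P f = (SOME g. is_extension_value k P f g)"

end

theory Submission
  imports Defs
begin

text \<open>
  Write \<open>Q\<^sup>* = -Q + m\<close>, where \<open>m\<close> is multiplication by a function, and let \<open>R = [P, Q]\<close> and
  \<open>S = [R, Q]\<close>, which are again of order \<open>k\<close>.  Moving every \<open>Q\<close> across the inner product, one sees that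
  in the symmetric part of the form \<open>\<langle>P Q\<^sup>2 f, P f\<rangle> + \<langle>P Q f, P Q f\<rangle>\<close> all uncommuted factors \<open>Q\<close>
  cancel: it is a sum of terms like \<open>\<langle>S f, P f\<rangle>\<close>, \<open>\<langle>R f, R f\<rangle>\<close> and \<open>\<langle>m R f, P f\<rangle>\<close>,
  each bounded by \<open>\<parallel>f\<parallel>\<^sup>2\<close> in \<open>H\<^sup>k\<close>.  The first claim is the case \<open>P = I\<close>, \<open>k = 0\<close>.

  On the torus the calculus reduces to infinite matrices: by Parseval's identity functions become their
  Fourier coefficients, and \<open>a(x, D)\<close> becomes the matrix with entry \<open>A(l - n, n)\<close> at \<open>(l, n)\<close>,
  where \<open>A(m, \<xi>)\<close> is the \<open>m\<close>-th Fourier coefficient of \<open>a(\<cdot>, \<xi>)\<close>.  Smoothness in \<open>x\<close> gives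
  rapid decay away from the diagonal, hence boundedness between weighted \<open>\<ell>\<^sup>2\<close> spaces, while
  the symbol estimates in \<open>\<xi>\<close> bound differences along the diagonal, which is what
  commutators with \<open>Q\<close> consist of.
\<close>

subsection \<open>Weights on the frequency lattice\<close>

text \<open>Both terms of the form have order 2k + 2. Replacing \<open>adj Q\<close> by
  \<open>- Q + m\<close> in the second one leaves the commutator of \<open>adj P * P\<close> with
  \<open>Q\<close>, times \<open>Q\<close>, plus \<open>m * adj P * P * Q\<close>: still one order
  too high. The second order is gained only in the real part: the factors in front of the last
  \<open>Q\<close> are self-adjoint up to lower order, so symmetrizing produces a further commutator
  with \<open>Q\<close>. Hence the double commutator, and hence the real coefficients, without which
  \<open>m\<close> would have order 1.

  The obstacle is uniformity. Estimating [R, Q] takes the diagonal differences of the matrix of R =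
  [P, Q] for all shifts at once, and these are again commutators, of matrices that depend on the
  shift. The commutator estimate is therefore proved for families, with polynomial loss in the
  parameter; no asymptotic expansion of symbols occurs.

  The operators are given through chosen representatives and limits. Fourier coefficients do not see
  these choices, so the analytic half of the proof consists in computing the coefficients of every
  function involved and in Parseval's identity.\<close>

lemma peetre_inequality:
  fixes x y :: "'a::real_normed_vector"
  shows "(1 + norm (x + y)) powr s \<le> (1 + norm y) powr \<bar>s\<bar> * (1 + norm x) powr s"
proof -
  define u v z where "u = 1 + norm x" and "v = 1 + norm y" and "z = 1 + norm (x + y)"
  have pos: "0 < u" "0 < v" "0 < z"
    by (simp_all add: u_def v_def z_def add_pos_nonneg)
  have "0 \<le> norm x * norm y" "0 \<le> norm (x + y) * norm y" by simp_all
  moreover have "norm (x + y) \<le> norm x + norm y" by (rule norm_triangle_ineq)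
  moreover have "norm x \<le> norm (x + y) + norm y" using norm_triangle_ineq4[of "x + y" y] by simp
  ultimately have le: "z \<le> v * u" "u \<le> z * v"
    unfolding u_def v_def z_def distrib_left distrib_right mult_1_left mult_1_right
      mult.commute[of "norm y" "norm x"] by linarith+
  \<comment> \<open>The sign of \<open>s\<close> decides which of the two inequalities in
    \<open>le\<close> is raised to a power.\<close>
  have "z powr s \<le> v powr \<bar>s\<bar> * u powr s"
  proof (cases "s \<ge> 0")
    case True
    hence "z powr s \<le> (v * u) powr s" using pos le by (intro powr_mono2) auto
    thus ?thesis using True pos by (simp add: powr_mult)
  next
    case False
    hence "(z * v) powr s \<le> u powr s" using pos le by (intro powr_mono2') auto
    hence "z powr s * v powr s * v powr - s \<le> u powr s * v powr - s"
      using pos by (simp add: powr_mult mult_right_mono)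
    moreover have "z powr s * v powr s * v powr - s = z powr s"
      using pos by (simp add: mult.assoc flip: powr_add)
    ultimately have "z powr s \<le> u powr s * v powr - s" by (simp only:)
    thus ?thesis using False by (simp add: mult.commute)
  qed
  thus ?thesis by (simp only: u_def v_def z_def)
qed

text \<open>This is the weight of the symbol estimates. Unlike the Bessel weight it is
  submultiplicative without a constant (\<open>wt_add\<close>); \<open>jb_le_wt\<close> and
  \<open>wt_le_jb\<close> compare the two.\<close>

definition wt :: "int^2 \<Rightarrow> real" where
  "wt n = 1 + norm (freq n)"

lemma freq_add: "freq (m + n) = freq m + freq n"
  by (simp add: freq_def vec_eq_iff)

lemma freq_minus: "freq (- n) = - freq n"
  by (simp add: freq_def vec_eq_iff)

lemma freq_zero [simp]: "freq 0 = 0"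
  by (simp add: freq_def vec_eq_iff)

lemma freq_nth [simp]: "freq n $ i = real_of_int (n $ i)"
  by (simp add: freq_def)

lemma wt_ge_1: "1 \<le> wt n"
  by (simp add: wt_def)

lemma wt_pos [simp]: "0 < wt n"
  using wt_ge_1[of n] by linarith

lemma wt_nonneg [simp]: "0 \<le> wt n"
  using wt_ge_1[of n] by linarith

lemma wt_nz [simp]: "wt n \<noteq> 0"
  using wt_pos[of n] by linarith

lemma wt_minus [simp]: "wt (- n) = wt n"
  by (simp add: wt_def freq_minus)

lemma wt_diff_commute: "wt (m - n) = wt (n - m)"
  using wt_minus[of "m - n"] by simp

lemma wt_zero [simp]: "wt 0 = 1"
  by (simp add: wt_def)

lemma wt_add: "wt (m + n) \<le> wt m * wt n"
proof -
  have "norm (freq m + freq n) \<le> norm (freq m) + norm (freq n)"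
    by (rule norm_triangle_ineq)
  moreover have "0 \<le> norm (freq m) * norm (freq n)" by simp
  ultimately show ?thesis
    unfolding wt_def freq_add distrib_left distrib_right by linarith
qed

lemma wt_powr_peetre: "wt (n + p) powr s \<le> wt p powr \<bar>s\<bar> * wt n powr s"
  unfolding wt_def freq_add by (rule peetre_inequality)

text \<open>Peetre's inequality with an integer power of the distance to the diagonal, so that the
  off-diagonal decay, which is indexed by naturals, can absorb it.\<close>

lemma wt_powr_le_power:
  assumes "\<bar>s\<bar> \<le> real J"
  shows "wt m powr s \<le> wt (m - n) ^ J * wt n powr s"
proof -
  have "wt m powr s \<le> wt (m - n) powr \<bar>s\<bar> * wt n powr s"
    using wt_powr_peetre[of n "m - n" s] by simp
  also have "wt (m - n) powr \<bar>s\<bar> \<le> wt (m - n) powr real J"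
    using assms wt_ge_1 by (intro powr_mono) auto
  finally show ?thesis by (simp add: powr_realpow)
qed

lemma wt_power_mono: "M \<le> N \<Longrightarrow> wt n ^ M \<le> wt n ^ N"
  by (rule power_increasing) (auto simp: wt_ge_1)

lemma wt_power_ge_1: "1 \<le> wt n ^ N"
  by (simp add: wt_ge_1)

lemma bij_vec2: "bij_betw (\<lambda>n :: int^2. (n $ 1, n $ 2)) UNIV UNIV"
proof (rule bij_betwI[where g = "\<lambda>(a, b). vector [a, b]"])
qed (auto simp: vec_eq_iff forall_2)

lemma summable_inverse_square_int:
  "(\<lambda>j::int. 1 / (1 + \<bar>real_of_int j\<bar>)\<^sup>2) summable_on UNIV"
proof -
  have 1: "summable (\<lambda>n. 1 / (real (Suc n))\<^sup>2)"
    using inverse_squares_sums[THEN sums_summable] by (simp add: add.commute)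
  have 2: "(\<lambda>n::nat. 1 / (1 + real n)\<^sup>2) summable_on UNIV"
    by (rule summable_nonneg_imp_summable_on) (use 1 in \<open>auto simp: add.commute\<close>)
  have "(\<lambda>j::int. 1 / (1 + \<bar>real_of_int j\<bar>)\<^sup>2) summable_on (int ` UNIV)"
    by (subst summable_on_reindex) (use 2 in \<open>auto simp: o_def\<close>)
  moreover have "(\<lambda>j::int. 1 / (1 + \<bar>real_of_int j\<bar>)\<^sup>2) summable_on ((\<lambda>n. - int n) ` UNIV)"
    by (subst summable_on_reindex) (use 2 in \<open>auto simp: o_def inj_def\<close>)
  moreover have "UNIV = (int ` UNIV) \<union> ((\<lambda>n. - int n) ` UNIV)"
    by (auto simp: image_iff) (metis int_cases2)
  ultimately show ?thesis by (metis summable_on_union)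
qed

text \<open>The exponent 4 is 2 + 2: \<open>wt n\<close> dominates
  \<open>1 + \<bar>n $ i\<bar>\<close> for both coordinates, so the series is bounded by a product
  of two one-dimensional ones.\<close>

lemma summable_wt: "(\<lambda>n. 1 / wt n ^ 4) summable_on UNIV"
proof -
  define g where "g = (\<lambda>j::int. 1 / (1 + \<bar>real_of_int j\<bar>)\<^sup>2)"

  have s: "((\<lambda>j. g j) has_sum infsum g UNIV) UNIV"
    using summable_inverse_square_int by (simp add: g_def)
  have "(\<lambda>(i, j). g i * g j) summable_on UNIV \<times> UNIV"
  proof (rule summable_on_SigmaI)
    show "((\<lambda>y. case (x, y) of (i, j) \<Rightarrow> g i * g j) has_sum g x * infsum g UNIV) UNIV" for x
      using has_sum_cmult_right[OF s] by simp
    show "(\<lambda>x. g x * infsum g UNIV) summable_on UNIV"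
      using s by (intro summable_on_cmult_left) (auto simp: summable_on_def)
  qed (auto simp: g_def)
  hence "(\<lambda>n::int^2. g (n $ 1) * g (n $ 2)) summable_on UNIV"
    using summable_on_reindex_bij_betw[OF bij_vec2, of "\<lambda>(i, j). g i * g j"] by simp
  moreover have "1 / wt n ^ 4 \<le> g (n $ 1) * g (n $ 2)" for n :: "int^2"
  proof -
    have "(1 + \<bar>real_of_int (n $ i)\<bar>)\<^sup>2 \<le> wt n ^ 2" for i
      using component_le_norm_cart[of "freq n" i] by (intro power_mono) (auto simp: wt_def)
    from mult_mono[OF this[of 1] this[of 2]]
    have "(1 + \<bar>real_of_int (n $ 1)\<bar>)\<^sup>2 * (1 + \<bar>real_of_int (n $ 2)\<bar>)\<^sup>2 \<le> wt n ^ 4"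
      by (simp flip: power_add)
    thus ?thesis unfolding g_def
      by (simp add: divide_simps)
  qed
  ultimately show ?thesis
    by (rule summable_on_comparison_test) (auto simp: g_def)
qed

definition wsum :: real where
  "wsum = (\<Sum>\<^sub>\<infinity>n. 1 / wt n ^ 4)"

lemma has_sum_wt: "((\<lambda>n. 1 / wt n ^ 4) has_sum wsum) UNIV"
  unfolding wsum_def using summable_wt by simp

lemma bij_minus_left: "bij_betw (\<lambda>r. l - r :: int^2) UNIV UNIV"
  by (rule bij_betwI[where g = "\<lambda>r. l - r"]) auto

lemma has_sum_wt_shift: "((\<lambda>r. 1 / wt (l - r) ^ 4) has_sum wsum) UNIV"
  using has_sum_reindex_bij_betw[OF bij_minus_left[of l], where f = "\<lambda>n. 1 / wt n ^ 4"] has_sum_wt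
  by simp

lemma has_sum_wt_shift': "((\<lambda>r. 1 / wt (r - l) ^ 4) has_sum wsum) UNIV"
  using has_sum_wt_shift[of l] by (simp only: wt_diff_commute[of _ l])

lemma wsum_pos: "0 < wsum"
proof -
  have "sum (\<lambda>n. 1 / wt n ^ 4) {0} \<le> wsum"
    by (rule finite_sum_le_has_sum[OF has_sum_wt]) auto
  thus ?thesis by simp
qed

subsection \<open>Matrices with rapid off-diagonal decay\<close>

text \<open>The decay is spent in three portions: 4 powers of \<open>wt (l - r)\<close> make the sum
  over \<open>r\<close> converge, \<open>J\<close> powers of \<open>wt (r - n)\<close> move the
  weight from \<open>r\<close> to \<open>n\<close> by Peetre's inequality, and the \<open>N\<close>
  powers left on either side combine to \<open>wt (l - n) ^ N\<close>. The summand is left abstract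
  because it is a product of entries in \<open>mmul_bnd\<close>, but an entry times a difference in
  \<open>mcomm_ordf\<close>.\<close>

lemma kernel_sum:
  fixes F :: "int^2 \<Rightarrow> complex"
  assumes F: "\<And>r. cmod (F r) * wt (l - r) ^ (N + 4) * wt (r - n) ^ (N + J) \<le> D * wt r powr s"
    and J: "\<bar>s\<bar> \<le> real J"
  shows "F summable_on UNIV"
    and "cmod (\<Sum>\<^sub>\<infinity>r. F r) * wt (l - n) ^ N \<le> D * wsum * wt n powr s"
proof -
  have "0 \<le> D * wt 0 powr s"
    using F[of 0] by (rule order_trans[rotated]) simp
  hence D: "0 \<le> D" by simp
  have bnd: "cmod (F r) * wt (l - n) ^ N \<le> D * wt n powr s * (1 / wt (l - r) ^ 4)" for r
  proof -
    have "cmod (F r) * wt (l - r) ^ (N + 4) * wt (r - n) ^ (N + J)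
        \<le> D * (wt (r - n) ^ J * wt n powr s)"
      using F[of r] wt_powr_le_power[OF J, of r n] D
      by (meson mult_left_mono order_trans)
    hence "(cmod (F r) * wt (l - r) ^ N * wt (r - n) ^ N * wt (l - r) ^ 4) * wt (r - n) ^ J
        \<le> (D * wt n powr s) * wt (r - n) ^ J"
      by (simp add: power_add algebra_simps)
    hence "cmod (F r) * wt (l - r) ^ N * wt (r - n) ^ N * wt (l - r) ^ 4 \<le> D * wt n powr s"
      by (rule mult_right_le_imp_le) simp
    moreover have "wt (l - n) ^ N \<le> wt (l - r) ^ N * wt (r - n) ^ N"
      using wt_add[of "l - r" "r - n"] by (simp flip: power_mult_distrib add: power_mono)
    hence "cmod (F r) * wt (l - n) ^ N * wt (l - r) ^ 4
        \<le> cmod (F r) * (wt (l - r) ^ N * wt (r - n) ^ N) * wt (l - r) ^ 4"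
      by (intro mult_right_mono mult_left_mono) auto
    ultimately have "cmod (F r) * wt (l - n) ^ N * wt (l - r) ^ 4 \<le> D * wt n powr s"
      by (simp add: mult.assoc)
    thus ?thesis by (simp add: pos_le_divide_eq)
  qed
  have s1: "((\<lambda>r. D * wt n powr s * (1 / wt (l - r) ^ 4)) has_sum D * wt n powr s * wsum) UNIV"
    by (intro has_sum_cmult_right has_sum_wt_shift)
  have "(\<lambda>r. cmod (F r)) summable_on UNIV"
  proof (rule summable_on_comparison_test)
    show "(\<lambda>r. D * wt n powr s * (1 / wt (l - r) ^ 4)) summable_on UNIV"
      using s1 by (rule has_sum_imp_summable)
    show "cmod (F r) \<le> D * wt n powr s * (1 / wt (l - r) ^ 4)" for r
      using bnd[of r] mult_left_mono[OF wt_power_ge_1[of "l - n" N], of "cmod (F r)"] by simp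
  qed auto
  hence s2: "(\<lambda>r. norm (F r)) summable_on UNIV" by simp
  show "F summable_on UNIV" by (rule abs_summable_summable[OF s2])
  have "cmod (\<Sum>\<^sub>\<infinity>r. F r) * wt (l - n) ^ N \<le> (\<Sum>\<^sub>\<infinity>r. cmod (F r)) * wt (l - n) ^ N"
    by (intro mult_right_mono norm_infsum_bound s2) simp
  also have "\<dots> \<le> D * wt n powr s * wsum"
  proof (rule has_sum_mono[OF _ s1])
    show "((\<lambda>r. cmod (F r) * wt (l - n) ^ N) has_sum (\<Sum>\<^sub>\<infinity>r. cmod (F r)) * wt (l - n) ^ N) UNIV"
      using s2 by (intro has_sum_cmult_left) simp
  qed (use bnd in auto)
  finally show "cmod (\<Sum>\<^sub>\<infinity>r. F r) * wt (l - n) ^ N \<le> D * wsum * wt n powr s"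
    by (simp add: mult_ac)
qed

section \<open>Operators as matrices: order and composition\<close>

type_synonym matrix = "int^2 \<Rightarrow> int^2 \<Rightarrow> complex"

text \<open>
  An operator that maps \<open>exp (i n \<cdot> x)\<close> to the function with Fourier coefficients \<open>K l n\<close> is encoded
  by its matrix \<open>K\<close>.  It has order \<open>k\<close> if for every \<open>N\<close> there is an \<open>A\<close> with \<open>bnd N k A K\<close>.
\<close>

definition bnd :: "nat \<Rightarrow> real \<Rightarrow> real \<Rightarrow> matrix \<Rightarrow> bool" where
  "bnd N k A K \<longleftrightarrow> (\<forall>l n. cmod (K l n) * wt (l - n) ^ N \<le> A * wt n powr k)"

lemma bndD: "bnd N k A K \<Longrightarrow> cmod (K l n) * wt (l - n) ^ N \<le> A * wt n powr k"
  by (simp add: bnd_def)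

lemma bnd_nonneg: assumes "bnd N k A K" shows "0 \<le> A"
proof -
  have "0 \<le> A * wt 0 powr k"
    using bndD[OF assms, of 0 0] by (rule order_trans[rotated]) simp
  thus ?thesis by simp
qed

lemma bnd_mono:
  assumes "bnd N k A K" "N' \<le> N" "k \<le> k'" "A \<le> A'"
  shows "bnd N' k' A' K"
  unfolding bnd_def
proof (intro allI)
  fix l n
  have "cmod (K l n) * wt (l - n) ^ N' \<le> cmod (K l n) * wt (l - n) ^ N"
    using assms by (intro mult_left_mono wt_power_mono) auto
  also have "\<dots> \<le> A * wt n powr k" by (rule bndD[OF assms(1)])
  also have "\<dots> \<le> A' * wt n powr k'"
    using assms bnd_nonneg[OF assms(1)] wt_ge_1 by (intro mult_mono powr_mono) auto
  finally show "cmod (K l n) * wt (l - n) ^ N' \<le> A' * wt n powr k'" .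
qed

lemma bnd_add:
  assumes "bnd N k A K" "bnd N k B L"
  shows "bnd N k (A + B) (\<lambda>l n. K l n + L l n)"
  unfolding bnd_def
proof (intro allI)
  fix l n
  have "cmod (K l n + L l n) * wt (l - n) ^ N \<le> (cmod (K l n) + cmod (L l n)) * wt (l - n) ^ N"
    by (intro mult_right_mono norm_triangle_ineq) simp
  thus "cmod (K l n + L l n) * wt (l - n) ^ N \<le> (A + B) * wt n powr k"
    using bndD[OF assms(1), of l n] bndD[OF assms(2), of l n] by (simp add: distrib_right)
qed

lemma bnd_uminus [simp]: "bnd N k A (\<lambda>l n. - K l n) = bnd N k A K"
  by (simp add: bnd_def)

definition mmul :: "matrix \<Rightarrow> matrix \<Rightarrow> matrix" where
  "mmul K L = (\<lambda>l n. \<Sum>\<^sub>\<infinity>r. K l r * L r n)"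

lemma mmul_bnd:
  assumes K: "bnd (N + 4) j A K" and L: "bnd (N + J) k B L" and J: "\<bar>j\<bar> \<le> real J"
  shows "(\<lambda>r. K l r * L r n) summable_on UNIV"
    and "bnd N (j + k) (A * B * wsum) (mmul K L)"
proof -
  have F: "cmod (K l r * L r n) * wt (l - r) ^ (N + 4) * wt (r - n) ^ (N + J)
      \<le> (A * B * wt n powr k) * wt r powr j" for l n r
    using mult_mono[OF bndD[OF K, of l r] bndD[OF L, of r n]] bnd_nonneg[OF K]
    by (simp add: norm_mult mult_ac)
  show "(\<lambda>r. K l r * L r n) summable_on UNIV"
    by (rule kernel_sum(1)[OF F J])
  show "bnd N (j + k) (A * B * wsum) (mmul K L)"
    unfolding bnd_def mmul_def
    using kernel_sum(2)[OF F J] by (simp add: powr_add mult_ac)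
qed

section \<open>Parametrized families and the commutator estimate\<close>

text \<open>
  Polynomial growth in the parameter \<open>v\<close> is harmless: in the commutator formula below, \<open>v\<close> is the
  distance to the diagonal in one factor and is absorbed by the rapid decay of the other.
\<close>

definition ordf :: "('i \<Rightarrow> real) \<Rightarrow> real \<Rightarrow> ('i \<Rightarrow> matrix) \<Rightarrow> bool" where
  "ordf v k K \<longleftrightarrow> (\<forall>N. \<exists>A M. \<forall>i. bnd N k (A * v i ^ M) (K i))"

lemma ordfD: "ordf v k K \<Longrightarrow> \<exists>A M. \<forall>i. bnd N k (A * v i ^ M) (K i)"
  by (simp add: ordf_def)

lemma ordfE:
  assumes "ordf v k K" "\<And>i. 1 \<le> v i"
  obtains A M where "0 \<le> A" "\<And>i. bnd N k (A * v i ^ M) (K i)"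
proof -
  obtain A M where AM: "bnd N k (A * v i ^ M) (K i)" for i
    using ordfD[OF assms(1), of N] by auto
  have "bnd N k (\<bar>A\<bar> * v i ^ M) (K i)" for i
    by (rule bnd_mono[OF AM]) (use assms(2)[of i] in \<open>auto intro!: mult_right_mono\<close>)
  thus ?thesis by (intro that[of "\<bar>A\<bar>" M]) auto
qed

text \<open>The shift keeps \<open>l - n\<close> fixed. For the matrix of a symbol it therefore
  moves only the frequency variable, and \<open>dif p\<close> is the discrete counterpart of a
  derivative in \<xi>.\<close>

definition dif :: "int^2 \<Rightarrow> matrix \<Rightarrow> matrix" where
  "dif p K = (\<lambda>l n. K (l + p) (n + p) - K l n)"

text \<open>The counterpart of the symbol estimate for first \<xi>-derivatives: one order less, with
  polynomial loss in the shift. Making the shift part of the index turns it into another instance of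
  \<open>ordf\<close>, so that it can be iterated.\<close>

definition lipf :: "('i \<Rightarrow> real) \<Rightarrow> real \<Rightarrow> ('i \<Rightarrow> matrix) \<Rightarrow> bool" where
  "lipf v k K \<longleftrightarrow> ordf (\<lambda>(i, p). v i * wt p) (k - 1) (\<lambda>(i, p). dif p (K i))"

lemma lipfE:
  assumes "lipf v k K" "\<And>i. 1 \<le> v i"
  obtains A M where "0 \<le> A" "\<And>i p. bnd N (k - 1) (A * (v i * wt p) ^ M) (dif p (K i))"
proof -
  have 1: "1 \<le> (case ip of (i, p) \<Rightarrow> v i * wt p)" for ip :: "'a \<times> (int^2)"
    using assms(2) wt_ge_1 by (auto split: prod.splits simp: mult_ge1_I)
  show ?thesis
    using ordfE[OF assms(1)[unfolded lipf_def] 1, of N] that by (auto simp: split_paired_all)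
qed

lemma infsum_diff:
  fixes f g :: "'a \<Rightarrow> complex"
  assumes "f summable_on A" "g summable_on A"
  shows "infsum (\<lambda>x. f x - g x) A = infsum f A - infsum g A"
  using infsum_add[OF assms(1), of "\<lambda>x. - g x"] assms(2)
  by (simp add: infsum_uminus summable_on_uminus)

definition mcomm :: "matrix \<Rightarrow> matrix \<Rightarrow> matrix" where
  "mcomm K L = (\<lambda>l n. mmul K L l n - mmul L K l n)"

text \<open>
  Substituting \<open>r \<mapsto> l + n - r\<close> in the second product turns the commutator into a sum of
  differences along the diagonal, which is where one order is gained.
\<close>

lemma mcomm_eq:
  assumes "(\<lambda>r. K l r * L r n) summable_on UNIV" "(\<lambda>r. L l r * K r n) summable_on UNIV"
    and F: "(\<lambda>r. dif (n - r) K l r * L r n) summable_on UNIV"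
    and G: "(\<lambda>r. K (l + n - r) n * dif (l - r) L r n) summable_on UNIV"
  shows "mcomm K L l n = - (\<Sum>\<^sub>\<infinity>r. dif (n - r) K l r * L r n)
      - (\<Sum>\<^sub>\<infinity>r. K (l + n - r) n * dif (l - r) L r n)"
proof -
  have "mmul L K l n = (\<Sum>\<^sub>\<infinity>r. L l (l + n - r) * K (l + n - r) n)"
    unfolding mmul_def
    by (rule infsum_reindex_bij_betw[OF bij_minus_left[of "l + n"], symmetric])
  moreover have "(\<lambda>r. L l (l + n - r) * K (l + n - r) n) summable_on UNIV"
    using assms(2) summable_on_reindex_bij_betw[OF bij_minus_left[of "l + n"],
        of "\<lambda>r. L l r * K r n"] by simp
  ultimately have "mcomm K L l n
      = (\<Sum>\<^sub>\<infinity>r. K l r * L r n - L l (l + n - r) * K (l + n - r) n)"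
    unfolding mcomm_def mmul_def using assms(1)
    by (simp add: infsum_diff)
  also have "\<dots> = (\<Sum>\<^sub>\<infinity>r. - (dif (n - r) K l r * L r n) - K (l + n - r) n * dif (l - r) L r n)"
    by (intro infsum_cong) (simp add: dif_def algebra_simps)
  also have "\<dots> = (\<Sum>\<^sub>\<infinity>r. - (dif (n - r) K l r * L r n))
      - (\<Sum>\<^sub>\<infinity>r. K (l + n - r) n * dif (l - r) L r n)"
    by (rule infsum_diff) (use F G in \<open>auto simp: summable_on_uminus\<close>)
  finally show ?thesis by (simp add: infsum_uminus)
qed

text \<open>Each sum in \<open>mcomm_eq\<close> contains one difference, which supplies the gain.
  Its shift is the distance of the other factor to the diagonal, so the loss
  \<open>wt (n - r) ^ M\<close> or \<open>wt (l - r) ^ E\<close> is paid by asking the other factor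
  for \<open>M\<close> or \<open>E\<close> more powers of decay.\<close>

lemma mcomm_ordf:
  assumes v: "\<And>i. 1 \<le> v i"
    and K: "ordf v k K" "lipf v k K" and L: "ordf v j L" "lipf v j L"
  shows "ordf v (k + j - 1) (\<lambda>i. mcomm (K i) (L i))"
  unfolding ordf_def
proof
  fix N
  define J where "J = nat \<lceil>\<bar>k\<bar> + \<bar>j\<bar> + 1\<rceil>"
  have J: "\<bar>k - 1\<bar> \<le> real J" "\<bar>k\<bar> \<le> real J" "\<bar>j\<bar> \<le> real J" "\<bar>0::real\<bar> \<le> real J"
    unfolding J_def by linarith+
  obtain A M where A: "0 \<le> A" "\<And>i p. bnd (N + 4) (k - 1) (A * (v i * wt p) ^ M) (dif p (K i))"
    using lipfE[OF K(2) v] by metis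
  obtain B M' where B: "0 \<le> B" "\<And>i. bnd (N + J + M + 4) j (B * v i ^ M') (L i)"
    using ordfE[OF L(1) v] by metis
  obtain D E where D: "0 \<le> D" "\<And>i p. bnd (N + J) (j - 1) (D * (v i * wt p) ^ E) (dif p (L i))"
    using lipfE[OF L(2) v] by metis
  obtain G H where G: "0 \<le> G" "\<And>i. bnd (N + J + E + 4) k (G * v i ^ H) (K i)"
    using ordfE[OF K(1) v] by metis
  have s1: "(\<lambda>r. K i l r * L i r n) summable_on UNIV" for i l n
    by (rule mmul_bnd(1)[where N = N, OF bnd_mono[OF G(2)[of i]] bnd_mono[OF B(2)[of i]] J(2)]) auto
  have s2: "(\<lambda>r. L i l r * K i r n) summable_on UNIV" for i l n
    by (rule mmul_bnd(1)[where N = N, OF bnd_mono[OF B(2)[of i]] bnd_mono[OF G(2)[of i]] J(3)]) auto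
  have b1: "cmod (dif (n - r) (K i) l r * L i r n) * wt (l - r) ^ (N + 4) * wt (r - n) ^ (N + J)
      \<le> (A * B * v i ^ (M + M') * wt n powr j) * wt r powr (k - 1)" for i l n r
  proof -
    have "(cmod (dif (n - r) (K i) l r) * wt (l - r) ^ (N + 4)) *
        (cmod (L i r n) * wt (r - n) ^ (N + J + M))
        \<le> (A * (v i * wt (n - r)) ^ M * wt r powr (k - 1)) * (B * v i ^ M' * wt n powr j)"
      by (rule mult_mono[OF bndD[OF A(2)] bndD[OF bnd_mono[OF B(2)[of i]]]])
        (use v[of i] A(1) in auto)
    hence "(cmod (dif (n - r) (K i) l r * L i r n) * wt (l - r) ^ (N + 4) * wt (r - n) ^ (N + J))
        * wt (r - n) ^ M \<le> ((A * B * v i ^ (M + M') * wt n powr j) * wt r powr (k - 1)) * wt (r - n) ^ M"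
      by (simp add: norm_mult power_mult_distrib power_add wt_diff_commute[of n] mult_ac)
    thus ?thesis by (rule mult_right_le_imp_le) simp
  qed
  \<comment> \<open>The entry of \<open>K i\<close> lies at distance \<open>l - r\<close> from the
    diagonal and in column \<open>n\<close>, as does the difference of \<open>L i\<close>. All
    weights already sit at \<open>n\<close>, so \<open>kernel_sum\<close> is used with exponent
    0.\<close>
  have b2: "cmod (K i (l + n - r) n * dif (l - r) (L i) r n) * wt (l - r) ^ (N + 4) * wt (r - n) ^ (N + J)
      \<le> (G * D * v i ^ (H + E) * wt n powr (k + j - 1)) * wt r powr 0" for i l n r
  proof -
    have "(cmod (K i (l + n - r) n) * wt (l - r) ^ (N + E + 4)) *
        (cmod (dif (l - r) (L i) r n) * wt (r - n) ^ (N + J))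
        \<le> (G * v i ^ H * wt n powr k) * (D * (v i * wt (l - r)) ^ E * wt n powr (j - 1))"
      using bndD[OF bnd_mono[OF G(2)[of i], of "N + E + 4" k "G * v i ^ H"], of "l + n - r" n]
      by (intro mult_mono[OF _ bndD[OF D(2)]]) (use v[of i] G(1) in auto)
    hence "(cmod (K i (l + n - r) n * dif (l - r) (L i) r n) * wt (l - r) ^ (N + 4) * wt (r - n) ^ (N + J))
        * wt (l - r) ^ E
        \<le> (G * D * v i ^ (H + E) * (wt n powr k * wt n powr (j - 1))) * wt (l - r) ^ E"
      by (simp add: norm_mult power_mult_distrib power_add mult_ac)
    hence "(cmod (K i (l + n - r) n * dif (l - r) (L i) r n) * wt (l - r) ^ (N + 4) * wt (r - n) ^ (N + J))
        \<le> G * D * v i ^ (H + E) * (wt n powr k * wt n powr (j - 1))"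
      by (rule mult_right_le_imp_le) simp
    thus ?thesis by (simp flip: powr_add add: add_diff_eq)
  qed
  have "bnd N (k + j - 1) ((A * B + G * D) * wsum * v i ^ (M + M' + H + E)) (mcomm (K i) (L i))" for i
    unfolding bnd_def
  proof (intro allI)
    fix l n
    have "cmod (mcomm (K i) (L i) l n) * wt (l - n) ^ N
        \<le> (cmod (\<Sum>\<^sub>\<infinity>r. dif (n - r) (K i) l r * L i r n)
          + cmod (\<Sum>\<^sub>\<infinity>r. K i (l + n - r) n * dif (l - r) (L i) r n)) * wt (l - n) ^ N"
      unfolding mcomm_eq[OF s1 s2 kernel_sum(1)[OF b1 J(1)] kernel_sum(1)[OF b2 J(4)]]
      by (intro mult_right_mono) (auto simp: norm_minus_commute intro: order_trans[OF norm_triangle_ineq4])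
    also have "\<dots> \<le> A * B * v i ^ (M + M') * wt n powr j * wsum * wt n powr (k - 1)
        + G * D * v i ^ (H + E) * wt n powr (k + j - 1) * wsum * wt n powr 0"
      unfolding distrib_right
      by (intro add_mono kernel_sum(2)[OF b1 J(1)] kernel_sum(2)[OF b2 J(4)])
    also have "\<dots> = (A * B * v i ^ (M + M') + G * D * v i ^ (H + E)) * (wsum * wt n powr (k + j - 1))"
      by (simp add: algebra_simps flip: powr_add)
    also have "\<dots> \<le> (A * B * v i ^ (M + M' + H + E) + G * D * v i ^ (M + M' + H + E))
        * (wsum * wt n powr (k + j - 1))"
    proof (intro mult_right_mono add_mono mult_left_mono)
      show "v i ^ (M + M') \<le> v i ^ (M + M' + H + E)" "v i ^ (H + E) \<le> v i ^ (M + M' + H + E)"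
        using v[of i] by (auto intro!: power_increasing)
    qed (use A(1) B(1) D(1) G(1) wsum_pos in auto)
    finally show "cmod (mcomm (K i) (L i) l n) * wt (l - n) ^ N
        \<le> (A * B + G * D) * wsum * v i ^ (M + M' + H + E) * wt n powr (k + j - 1)"
      by (simp add: algebra_simps)
  qed
  thus "\<exists>A M. \<forall>i. bnd N (k + j - 1) (A * v i ^ M) (mcomm (K i) (L i))" by blast
qed

section \<open>Matrices of a fixed order, their products and adjoints\<close>

definition ordm :: "real \<Rightarrow> matrix \<Rightarrow> bool" where
  "ordm k K \<longleftrightarrow> (\<forall>N. \<exists>A. bnd N k A K)"

lemma ordmE: assumes "ordm k K" obtains A where "bnd N k A K"
  using assms unfolding ordm_def by blast

lemma ordm_mono: "ordm k K \<Longrightarrow> k \<le> k' \<Longrightarrow> ordm k' K"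
  unfolding ordm_def using bnd_mono by blast

lemma ordm_uminus: "ordm k K \<Longrightarrow> ordm k (\<lambda>l n. - K l n)"
  by (simp add: ordm_def)

lemma ordm_add: "ordm k K \<Longrightarrow> ordm k L \<Longrightarrow> ordm k (\<lambda>l n. K l n + L l n)"
  unfolding ordm_def using bnd_add by blast

lemma ordm_mmul_aux:
  assumes "ordm j K" "ordm k L"
  shows "(\<lambda>r. K l r * L r n) summable_on UNIV" and "ordm (j + k) (mmul K L)"
proof -
  define J where "J = nat \<lceil>\<bar>j\<bar>\<rceil>"
  have J: "\<bar>j\<bar> \<le> real J" unfolding J_def by linarith
  show "(\<lambda>r. K l r * L r n) summable_on UNIV"
    using ordmE[OF assms(1), of "0 + 4"] ordmE[OF assms(2), of "0 + J"] mmul_bnd(1)[OF _ _ J] by metis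
  show "ordm (j + k) (mmul K L)"
    unfolding ordm_def using ordmE[OF assms(1)] ordmE[OF assms(2)] mmul_bnd(2)[OF _ _ J] by metis
qed

lemmas ordm_mmul = ordm_mmul_aux(2)

definition adjm :: "matrix \<Rightarrow> matrix" where
  "adjm K = (\<lambda>l n. cnj (K n l))"

text \<open>Transposition puts the weight at the row index; \<open>J\<close> powers of decay bring
  it back to the column index.\<close>

lemma ordm_adjm:
  assumes "ordm k K"
  shows "ordm k (adjm K)"
  unfolding ordm_def
proof
  fix N
  define J where "J = nat \<lceil>\<bar>k\<bar>\<rceil>"
  have J: "\<bar>k\<bar> \<le> real J" unfolding J_def by linarith
  obtain A where A: "bnd (N + J) k A K" using ordmE[OF assms] .
  have "bnd N k A (adjm K)"
    unfolding bnd_def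
  proof (intro allI)
    fix l n
    have "cmod (K n l) * wt (n - l) ^ (N + J) \<le> A * wt l powr k"
      by (rule bndD[OF A])
    also have "\<dots> \<le> A * (wt (l - n) ^ J * wt n powr k)"
      using wt_powr_le_power[OF J, of l n] bnd_nonneg[OF A] by (rule mult_left_mono)
    finally have "(cmod (K n l) * wt (l - n) ^ N) * wt (l - n) ^ J \<le> (A * wt n powr k) * wt (l - n) ^ J"
      by (simp add: power_add wt_diff_commute[of n l] mult_ac)
    hence "cmod (K n l) * wt (l - n) ^ N \<le> A * wt n powr k"
      by (rule mult_right_le_imp_le) simp
    thus "cmod (adjm K l n) * wt (l - n) ^ N \<le> A * wt n powr k"
      by (simp add: adjm_def)
  qed
  thus "\<exists>A. bnd N k A (adjm K)" by blast
qed


subsection \<open>Weighted \<open>\<ell>\<^sup>2\<close> spaces\<close>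

definition hs :: "real \<Rightarrow> (int^2 \<Rightarrow> complex) \<Rightarrow> bool" where
  "hs s x \<longleftrightarrow> (\<lambda>n. (wt n powr s * cmod (x n))\<^sup>2) summable_on UNIV"

definition nrm2 :: "real \<Rightarrow> (int^2 \<Rightarrow> complex) \<Rightarrow> real" where
  "nrm2 s x = (\<Sum>\<^sub>\<infinity>n. (wt n powr s * cmod (x n))\<^sup>2)"

lemma nrm2_nonneg: "0 \<le> nrm2 s x"
  unfolding nrm2_def by (rule infsum_nonneg) simp

lemma has_sum_nrm2: "hs s x \<Longrightarrow> ((\<lambda>n. (wt n powr s * cmod (x n))\<^sup>2) has_sum nrm2 s x) UNIV"
  by (simp add: hs_def nrm2_def)

lemma le_nrm2: assumes "hs s x" shows "(wt n powr s * cmod (x n))\<^sup>2 \<le> nrm2 s x"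
  using finite_sum_le_has_sum[OF has_sum_nrm2[OF assms], of "{n}"] by simp

lemma hs_mono_bound:
  assumes "hs s x" "\<And>n. cmod (y n) \<le> cmod (x n)" "t \<le> s"
  shows "hs t y" "nrm2 t y \<le> nrm2 s x"
proof -
  have le: "(wt n powr t * cmod (y n))\<^sup>2 \<le> (wt n powr s * cmod (x n))\<^sup>2" for n
    using assms(2,3) wt_ge_1 by (intro power_mono mult_mono powr_mono) auto
  show "hs t y"
    using assms(1) le unfolding hs_def by (auto intro: summable_on_comparison_test)
  with assms(1) show "nrm2 t y \<le> nrm2 s x"
    unfolding hs_def nrm2_def using le by (intro infsum_mono) auto
qed

text \<open>Young's inequality for a summable kernel: Cauchy-Schwarz with respect to the weights
  \<open>h (l - n)\<close> for each fixed \<open>l\<close>, then interchange of the two nonnegative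
  sums.\<close>

lemma convolution_l2:
  fixes y :: "int^2 \<Rightarrow> real"
  assumes y0: "\<And>n. 0 \<le> y n" and ysum: "(\<lambda>n. (y n)\<^sup>2) summable_on UNIV"
  shows "(\<lambda>n. 1 / wt (l - n) ^ 4 * y n) summable_on UNIV"
    and "(\<lambda>l. (\<Sum>\<^sub>\<infinity>n. 1 / wt (l - n) ^ 4 * y n)\<^sup>2) summable_on UNIV"
    and "(\<Sum>\<^sub>\<infinity>l. (\<Sum>\<^sub>\<infinity>n. 1 / wt (l - n) ^ 4 * y n)\<^sup>2) \<le> wsum\<^sup>2 * (\<Sum>\<^sub>\<infinity>n. (y n)\<^sup>2)"
proof -
  define h where "h = (\<lambda>n. 1 / wt n ^ 4)"
  have h0: "0 \<le> h n" "h n \<le> 1" for n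
    using wt_power_ge_1[of n 4] by (auto simp: h_def)
  have hsum: "((\<lambda>n. h (l - n)) has_sum wsum) UNIV" "((\<lambda>n. h (n - l)) has_sum wsum) UNIV" for l
    unfolding h_def using has_sum_wt_shift has_sum_wt_shift' by auto
  have s2: "(\<lambda>n. h (l - n) * (y n)\<^sup>2) summable_on UNIV" for l
    using h0 by (intro summable_on_comparison_test[OF ysum]) (auto intro: mult_left_le_one_le)
  have s1: "(\<lambda>n. h (l - n) * y n) summable_on UNIV" for l
  proof (rule summable_on_comparison_test)
    show "(\<lambda>n. h (l - n) + h (l - n) * (y n)\<^sup>2) summable_on UNIV"
      using hsum(1) s2 by (intro summable_on_add) (auto simp: summable_on_def)
    fix n
    have "y n \<le> 1 + (y n)\<^sup>2"
      using zero_le_power2[of "y n - 1"] zero_le_power2[of "y n"] y0[of n]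
      by (simp add: power2_eq_square algebra_simps)
    hence "h (l - n) * y n \<le> h (l - n) * (1 + (y n)\<^sup>2)"
      by (intro mult_left_mono h0)
    thus "h (l - n) * y n \<le> h (l - n) + h (l - n) * (y n)\<^sup>2" by (simp add: distrib_left)
  qed (use y0 h0 in auto)
  thus "(\<lambda>n. 1 / wt (l - n) ^ 4 * y n) summable_on UNIV" by (simp add: h_def)
  define Y where "Y l = (\<Sum>\<^sub>\<infinity>n. h (l - n) * y n)" for l
  define Z where "Z l = (\<Sum>\<^sub>\<infinity>n. h (l - n) * (y n)\<^sup>2)" for l
  have Y: "((\<lambda>n. h (l - n) * y n) has_sum Y l) UNIV" for l
    unfolding Y_def using s1 by simp
  have Z: "((\<lambda>n. h (l - n) * (y n)\<^sup>2) has_sum Z l) UNIV" for l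
    unfolding Z_def using s2 by simp
  have CS: "(Y l)\<^sup>2 \<le> wsum * Z l" for l
  proof -
    \<comment> \<open>\<open>t\<close> is a multiple of the weighted sum chosen to minimize the
      expanded square: nonnegativity of the sum of \<open>h (l - n) * (y n - t)\<^sup>2\<close> is
      then exactly Cauchy-Schwarz.\<close>
    define t where "t = Y l / wsum"
    have "((\<lambda>n. h (l - n) * (y n)\<^sup>2 + (- (2 * t) * (h (l - n) * y n) + t\<^sup>2 * h (l - n)))
        has_sum (Z l + (- (2 * t) * Y l + t\<^sup>2 * wsum))) UNIV"
      by (intro has_sum_add has_sum_cmult_right Y Z hsum)
    moreover have "h (l - n) * (y n)\<^sup>2 + (- (2 * t) * (h (l - n) * y n) + t\<^sup>2 * h (l - n))
        = h (l - n) * (y n - t)\<^sup>2" for n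
      by (simp add: power2_eq_square algebra_simps)
    ultimately have "((\<lambda>n. h (l - n) * (y n - t)\<^sup>2) has_sum (Z l + (- (2 * t) * Y l + t\<^sup>2 * wsum))) UNIV"
      by simp
    hence "0 \<le> Z l + (- (2 * t) * Y l + t\<^sup>2 * wsum)"
      by (rule has_sum_nonneg) (simp add: h0)
    also have "\<dots> = Z l - (Y l)\<^sup>2 / wsum"
      using wsum_pos by (simp add: t_def power2_eq_square field_simps)
    finally show ?thesis
      using wsum_pos by (simp add: field_simps)
  qed
  define y2 where "y2 = (\<Sum>\<^sub>\<infinity>n. (y n)\<^sup>2)"
  have y2: "((\<lambda>n. (y n)\<^sup>2) has_sum y2) UNIV" unfolding y2_def using ysum by simp
  have col: "((\<lambda>l. h (l - n) * (y n)\<^sup>2) has_sum wsum * (y n)\<^sup>2) UNIV" for n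
    by (intro has_sum_cmult_left hsum)
  have tot: "((\<lambda>n. wsum * (y n)\<^sup>2) has_sum wsum * y2) UNIV"
    by (intro has_sum_cmult_right y2)
  have "(\<lambda>(n, l). h (l - n) * (y n)\<^sup>2) summable_on UNIV \<times> UNIV"
    using col tot by (intro summable_on_SigmaI[where g = "\<lambda>n. wsum * (y n)\<^sup>2"])
      (auto simp: h0 summable_on_def)
  hence "((\<lambda>(n, l). h (l - n) * (y n)\<^sup>2) has_sum wsum * y2) (UNIV \<times> UNIV)"
    using col tot by (intro has_sum_SigmaI[where g = "\<lambda>n. wsum * (y n)\<^sup>2"]) auto
  hence "((\<lambda>(l, n). h (l - n) * (y n)\<^sup>2) has_sum wsum * y2) (UNIV \<times> UNIV)"
    by (subst has_sum_swap) simp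
  hence Zs: "(Z has_sum wsum * y2) UNIV"
    by (rule has_sum_Sigma') (simp add: Z)
  hence Ys: "((\<lambda>l. wsum * Z l) has_sum wsum * (wsum * y2)) UNIV"
    by (rule has_sum_cmult_right)
  have "(\<lambda>l. (Y l)\<^sup>2) summable_on UNIV"
    by (rule summable_on_comparison_test[OF has_sum_imp_summable[OF Ys]]) (auto simp: CS)
  moreover from this have "(\<Sum>\<^sub>\<infinity>l. (Y l)\<^sup>2) \<le> wsum * (wsum * y2)"
    by (intro has_sum_mono[OF has_sum_infsum Ys] CS)
  ultimately show "(\<lambda>l. (\<Sum>\<^sub>\<infinity>n. 1 / wt (l - n) ^ 4 * y n)\<^sup>2) summable_on UNIV"
    "(\<Sum>\<^sub>\<infinity>l. (\<Sum>\<^sub>\<infinity>n. 1 / wt (l - n) ^ 4 * y n)\<^sup>2) \<le> wsum\<^sup>2 * (\<Sum>\<^sub>\<infinity>n. (y n)\<^sup>2)"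
    by (simp_all add: Y_def h_def y2_def power2_eq_square mult.assoc)
qed

definition act :: "matrix \<Rightarrow> (int^2 \<Rightarrow> complex) \<Rightarrow> int^2 \<Rightarrow> complex" where
  "act K x = (\<lambda>l. \<Sum>\<^sub>\<infinity>n. K l n * x n)"

text \<open>Conjugating \<open>K\<close> with the weights costs \<open>J\<close> powers of decay;
  the remaining 4 leave entries bounded by \<open>A / wt (l - n) ^ 4\<close>, to which
  \<open>convolution_l2\<close> applies.\<close>

lemma act_bnd:
  assumes K: "bnd (J + 4) j A K" and J: "\<bar>s\<bar> \<le> real J" and x: "hs (s + j) x"
  shows "(\<lambda>n. cmod (K l n * x n)) summable_on UNIV"
    and "hs s (act K x)" and "nrm2 s (act K x) \<le> (A * wsum)\<^sup>2 * nrm2 (s + j) x"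
proof -
  define y where "y n = wt n powr (s + j) * cmod (x n)" for n
  have y0: "0 \<le> y n" for n by (simp add: y_def)
  have ysum: "(\<lambda>n. (y n)\<^sup>2) summable_on UNIV" and y2: "(\<Sum>\<^sub>\<infinity>n. (y n)\<^sup>2) = nrm2 (s + j) x"
    using x by (simp_all add: hs_def y_def nrm2_def)
  note conv = convolution_l2[OF y0 ysum]
  have A: "0 \<le> A" by (rule bnd_nonneg[OF K])
  have le: "wt l powr s * cmod (K l n * x n) \<le> A * (1 / wt (l - n) ^ 4 * y n)" for l n
  proof -
    have "wt l powr s * cmod (K l n) * wt (l - n) ^ 4 \<le> (wt (l - n) ^ J * wt n powr s) * cmod (K l n) * wt (l - n) ^ 4"
      by (intro mult_right_mono wt_powr_le_power J) auto
    also have "\<dots> = wt n powr s * (cmod (K l n) * wt (l - n) ^ (J + 4))"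
      by (simp add: power_add mult_ac)
    also have "\<dots> \<le> wt n powr s * (A * wt n powr j)"
      by (intro mult_left_mono bndD[OF K]) simp
    also have "\<dots> = A * wt n powr (s + j)" by (simp add: powr_add mult_ac)
    finally have "wt l powr s * cmod (K l n) \<le> A * wt n powr (s + j) / wt (l - n) ^ 4"
      by (simp add: pos_le_divide_eq)
    from mult_right_mono[OF this, of "cmod (x n)"] show ?thesis
      by (simp add: norm_mult y_def mult_ac)
  qed
  have s1: "(\<lambda>n. wt l powr s * cmod (K l n * x n)) summable_on UNIV" for l
    by (rule summable_on_comparison_test[OF summable_on_cmult_right[OF conv(1)[of l], of A]])
      (use le in auto)
  show s2: "(\<lambda>n. cmod (K l n * x n)) summable_on UNIV" for l
  proof -
    have "wt l powr - s * (wt l powr s * c) = c" for c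
      by (simp add: powr_minus)
    thus ?thesis
      using summable_on_cmult_right[OF s1[of l], of "wt l powr - s"] by (simp only:)
  qed
  have ale: "wt l powr s * cmod (act K x l) \<le> A * (\<Sum>\<^sub>\<infinity>n. 1 / wt (l - n) ^ 4 * y n)" for l
  proof -
    have "wt l powr s * cmod (act K x l) \<le> wt l powr s * (\<Sum>\<^sub>\<infinity>n. cmod (K l n * x n))"
      unfolding act_def using s2 by (intro mult_left_mono norm_infsum_bound) auto
    also have "\<dots> = (\<Sum>\<^sub>\<infinity>n. wt l powr s * cmod (K l n * x n))"
      by (simp only: infsum_cmult_right')
    also have "\<dots> \<le> (\<Sum>\<^sub>\<infinity>n. A * (1 / wt (l - n) ^ 4 * y n))"
      by (intro infsum_mono s1 summable_on_cmult_right conv(1) le)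
    finally show ?thesis by (simp only: infsum_cmult_right')
  qed
  have sq: "(wt l powr s * cmod (act K x l))\<^sup>2 \<le> A\<^sup>2 * (\<Sum>\<^sub>\<infinity>n. 1 / wt (l - n) ^ 4 * y n)\<^sup>2" for l
    using power_mono[OF ale[of l], of 2] by (simp add: power_mult_distrib)
  show h: "hs s (act K x)"
    unfolding hs_def
    by (rule summable_on_comparison_test[OF summable_on_cmult_right[OF conv(2), of "A\<^sup>2"]])
      (use sq in auto)
  have "nrm2 s (act K x) \<le> (\<Sum>\<^sub>\<infinity>l. A\<^sup>2 * (\<Sum>\<^sub>\<infinity>n. 1 / wt (l - n) ^ 4 * y n)\<^sup>2)"
    unfolding nrm2_def using h conv(2) sq
    by (intro infsum_mono summable_on_cmult_right) (auto simp: hs_def)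
  also have "\<dots> = A\<^sup>2 * (\<Sum>\<^sub>\<infinity>l. (\<Sum>\<^sub>\<infinity>n. 1 / wt (l - n) ^ 4 * y n)\<^sup>2)"
    by (simp only: infsum_cmult_right')
  also have "\<dots> \<le> A\<^sup>2 * (wsum\<^sup>2 * nrm2 (s + j) x)"
    using conv(3) y2 by (intro mult_left_mono) auto
  finally show "nrm2 s (act K x) \<le> (A * wsum)\<^sup>2 * nrm2 (s + j) x"
    by (simp add: power_mult_distrib mult.assoc)
qed

lemma ordm_bnd_J:
  assumes "ordm j K"
  obtains J A where "\<bar>s\<bar> \<le> real J" "bnd (J + 4) j A K"
proof -
  define J where "J = nat \<lceil>\<bar>s\<bar>\<rceil>"
  have "\<bar>s\<bar> \<le> real J" unfolding J_def by linarith
  thus ?thesis using that ordmE[OF assms] by metis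
qed

lemma act_abs_summable: "ordm j K \<Longrightarrow> hs (s + j) x \<Longrightarrow> (\<lambda>n. cmod (K l n * x n)) summable_on UNIV"
  by (metis ordm_bnd_J act_bnd(1))

lemma act_summable: "ordm j K \<Longrightarrow> hs (s + j) x \<Longrightarrow> (\<lambda>n. K l n * x n) summable_on UNIV"
  by (rule abs_summable_summable) (rule act_abs_summable)

lemma hs_act: "ordm j K \<Longrightarrow> hs (s + j) x \<Longrightarrow> hs s (act K x)"
  by (metis ordm_bnd_J act_bnd(2))

lemma nrm2_act:
  assumes "ordm j K"
  obtains C where "0 \<le> C" "\<And>x. hs (s + j) x \<Longrightarrow> nrm2 s (act K x) \<le> C * nrm2 (s + j) x"
proof -
  obtain J A where "\<bar>s\<bar> \<le> real J" "bnd (J + 4) j A K" using ordm_bnd_J[OF assms] .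
  from act_bnd(3)[OF this(2,1)] that[of "(A * wsum)\<^sup>2"] show ?thesis by auto
qed

lemma ordm_abs: "ordm j K \<Longrightarrow> ordm j (\<lambda>l n. complex_of_real (cmod (K l n)))"
  by (simp add: ordm_def bnd_def)

lemma hs_abs: "hs s (\<lambda>n. complex_of_real (cmod (x n))) = hs s x"
  by (simp add: hs_def)

text \<open>Boundedness applied to the absolute values of matrix and vector. This supplies the
  absolute convergence behind the interchanges of sums in \<open>act_mmul\<close> and
  \<open>ip_act_adjm\<close>.\<close>

lemma hs_act_abs:
  assumes "ordm j K" "hs (s + j) x"
  shows "hs s (\<lambda>l. complex_of_real (\<Sum>\<^sub>\<infinity>n. cmod (K l n * x n)))"
proof -
  have "act (\<lambda>l n. complex_of_real (cmod (K l n))) (\<lambda>n. complex_of_real (cmod (x n))) l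
      = complex_of_real (\<Sum>\<^sub>\<infinity>n. cmod (K l n * x n))" for l
  proof -
    have "((\<lambda>n. complex_of_real (cmod (K l n * x n)))
        has_sum complex_of_real (\<Sum>\<^sub>\<infinity>n. cmod (K l n * x n))) UNIV"
      by (intro has_sum_of_real has_sum_infsum act_abs_summable[OF assms])
    thus ?thesis unfolding act_def by (intro infsumI) (simp add: norm_mult)
  qed
  hence "act (\<lambda>l n. complex_of_real (cmod (K l n))) (\<lambda>n. complex_of_real (cmod (x n)))
      = (\<lambda>l. complex_of_real (\<Sum>\<^sub>\<infinity>n. cmod (K l n * x n)))"
    by (rule ext)
  thus ?thesis
    using hs_act[OF ordm_abs[OF assms(1)], of s "\<lambda>n. complex_of_real (cmod (x n))"] assms(2)
    by (simp only: hs_abs)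
qed

lemma summable_on_prodI:
  fixes f :: "'a \<Rightarrow> 'b \<Rightarrow> complex"
  assumes "\<And>a. (\<lambda>b. cmod (f a b)) summable_on UNIV"
    and "(\<lambda>a. \<Sum>\<^sub>\<infinity>b. cmod (f a b)) summable_on UNIV"
  shows "(\<lambda>(a, b). f a b) summable_on UNIV \<times> UNIV"
proof (rule abs_summable_summable)
  have "(\<lambda>(a, b). cmod (f a b)) summable_on UNIV \<times> UNIV"
  proof (rule summable_on_SigmaI)
    show "((\<lambda>b. case (a, b) of (a, b) \<Rightarrow> cmod (f a b)) has_sum (\<Sum>\<^sub>\<infinity>b. cmod (f a b))) UNIV" for a
      using assms(1)[of a] by (simp only: prod.case has_sum_infsum)
  qed (use assms(2) in auto)
  thus "(\<lambda>p. norm (case p of (a, b) \<Rightarrow> f a b)) summable_on UNIV \<times> UNIV"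
    by (simp only: case_prod_unfold)
qed

lemma act_mmul:
  assumes K: "ordm j K" and L: "ordm k L" and x: "hs (s + j + k) x"
  shows "act (mmul K L) x = act K (act L x)"
proof
  fix l
  have hL: "hs (s + j) (\<lambda>r. complex_of_real (\<Sum>\<^sub>\<infinity>n. cmod (L r n * x n)))"
    by (rule hs_act_abs[OF L x])
  have S: "(\<lambda>(r, n). K l r * (L r n * x n)) summable_on UNIV \<times> UNIV"
  proof (rule summable_on_prodI)
    show "(\<lambda>n. cmod (K l r * (L r n * x n))) summable_on UNIV" for r
      unfolding norm_mult[of "K l r"] by (rule summable_on_cmult_right) (rule act_abs_summable[OF L x])
    show "(\<lambda>r. \<Sum>\<^sub>\<infinity>n. cmod (K l r * (L r n * x n))) summable_on UNIV"
    proof -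
      have "(\<Sum>\<^sub>\<infinity>n. cmod (K l r * (L r n * x n)))
          = cmod (K l r * complex_of_real (\<Sum>\<^sub>\<infinity>n. cmod (L r n * x n)))" for r
        by (simp only: norm_mult[of "K l r"] infsum_cmult_right' norm_of_real abs_of_nonneg
            infsum_nonneg norm_ge_zero)
      thus ?thesis using act_abs_summable[OF K hL, of l] by (simp only:)
    qed
  qed
  have "act K (act L x) l = (\<Sum>\<^sub>\<infinity>r. \<Sum>\<^sub>\<infinity>n. K l r * (L r n * x n))"
    by (simp add: act_def infsum_cmult_right')
  also have "\<dots> = (\<Sum>\<^sub>\<infinity>n. \<Sum>\<^sub>\<infinity>r. K l r * (L r n * x n))"
    by (rule infsum_swap_banach[OF S])
  also have "\<dots> = act (mmul K L) x l"
    by (simp add: act_def mmul_def infsum_cmult_left' mult.assoc[symmetric])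
  finally show "act (mmul K L) x l = act K (act L x) l" ..
qed

definition ip :: "(int^2 \<Rightarrow> complex) \<Rightarrow> (int^2 \<Rightarrow> complex) \<Rightarrow> complex" where
  "ip x y = (\<Sum>\<^sub>\<infinity>n. x n * cnj (y n))"

text \<open>The weights cancel between the dual spaces of orders \<open>s\<close> and
  \<open>- s\<close>. The arithmetic-geometric mean inequality replaces Cauchy-Schwarz, as only a
  sum of squared norms is wanted in the end.\<close>

lemma ip_bound:
  assumes x: "hs s x" and y: "hs (- s) y"
  shows "(\<lambda>n. cmod (x n * cnj (y n))) summable_on UNIV"
    and "cmod (ip x y) \<le> (nrm2 s x + nrm2 (- s) y) / 2"
proof -
  have le: "cmod (x n * cnj (y n)) \<le> ((wt n powr s * cmod (x n))\<^sup>2 + (wt n powr - s * cmod (y n))\<^sup>2) / 2" for n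
  proof -
    have "cmod (x n * cnj (y n)) = (wt n powr s * cmod (x n)) * (wt n powr - s * cmod (y n))"
      by (simp add: norm_mult powr_minus)
    thus ?thesis
      using sum_squares_bound[of "wt n powr s * cmod (x n)" "wt n powr - s * cmod (y n)"] by simp
  qed
  have S: "((\<lambda>n. ((wt n powr s * cmod (x n))\<^sup>2 + (wt n powr - s * cmod (y n))\<^sup>2) / 2)
      has_sum (nrm2 s x + nrm2 (- s) y) / 2) UNIV"
    by (intro has_sum_divide_const has_sum_add has_sum_nrm2 x y)
  show a: "(\<lambda>n. cmod (x n * cnj (y n))) summable_on UNIV"
    by (rule summable_on_comparison_test[OF has_sum_imp_summable[OF S]]) (use le in auto)
  have "cmod (ip x y) \<le> (\<Sum>\<^sub>\<infinity>n. cmod (x n * cnj (y n)))"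
    unfolding ip_def using a by (intro norm_infsum_bound) simp
  also have "\<dots> \<le> (nrm2 s x + nrm2 (- s) y) / 2"
    by (rule has_sum_mono[OF has_sum_infsum[OF a] S]) (rule le)
  finally show "cmod (ip x y) \<le> (nrm2 s x + nrm2 (- s) y) / 2" .
qed

lemma ip_summable: "hs s x \<Longrightarrow> hs (- s) y \<Longrightarrow> (\<lambda>n. x n * cnj (y n)) summable_on UNIV"
  by (rule abs_summable_summable) (rule ip_bound)

lemma ip_cnj: "ip y x = cnj (ip x y)"
  by (simp add: ip_def mult.commute flip: infsum_cnj)

text \<open>An interchange of sums, stated for a dual pair of spaces: the image of a vector may lie
  only in a space of negative order, like \<open>act (ent E) x\<close> in
  \<open>frequency_estimate\<close>.\<close>

lemma ip_act_adjm:
  assumes K: "ordm j K" and x: "hs (s + j) x" and y: "hs (- s) y"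
  shows "ip (act K x) y = ip x (act (adjm K) y)"
proof -
  have S: "(\<lambda>(l, n). K l n * x n * cnj (y l)) summable_on UNIV \<times> UNIV"
  proof (rule summable_on_prodI)
    show "(\<lambda>n. cmod (K l n * x n * cnj (y l))) summable_on UNIV" for l
      unfolding norm_mult[of _ "cnj (y l)"]
      by (rule summable_on_cmult_left) (rule act_abs_summable[OF K x])
    show "(\<lambda>l. \<Sum>\<^sub>\<infinity>n. cmod (K l n * x n * cnj (y l))) summable_on UNIV"
    proof -
      have "(\<Sum>\<^sub>\<infinity>n. cmod (K l n * x n * cnj (y l)))
          = cmod (complex_of_real (\<Sum>\<^sub>\<infinity>n. cmod (K l n * x n)) * cnj (y l))" for l
        by (simp only: norm_mult[of _ "cnj (y l)"] infsum_cmult_left' norm_of_real abs_of_nonneg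
            infsum_nonneg norm_ge_zero)
      thus ?thesis using ip_bound(1)[OF hs_act_abs[OF K x] y] by (simp only:)
    qed
  qed
  have "ip (act K x) y = (\<Sum>\<^sub>\<infinity>l. \<Sum>\<^sub>\<infinity>n. K l n * x n * cnj (y l))"
    by (simp add: ip_def act_def infsum_cmult_left')
  also have "\<dots> = (\<Sum>\<^sub>\<infinity>n. \<Sum>\<^sub>\<infinity>l. K l n * x n * cnj (y l))"
    by (rule infsum_swap_banach[OF S])
  also have "\<dots> = (\<Sum>\<^sub>\<infinity>n. \<Sum>\<^sub>\<infinity>l. x n * cnj (adjm K n l * y l))"
    by (simp add: adjm_def mult_ac)
  also have "\<dots> = ip x (act (adjm K) y)"
    unfolding ip_def act_def infsum_cmult_right' by (simp only: infsum_cnj)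
  finally show ?thesis .
qed

section \<open>The ring of matrices of finite order\<close>

typedef rmat = "{K. \<exists>k. ordm k K}"
  morphisms ent Rmat
proof -
  have "ordm 0 (\<lambda>l n. 0)" by (auto simp: ordm_def bnd_def intro!: exI[of _ 0])
  thus ?thesis by blast
qed

setup_lifting type_definition_rmat

lemma ordm_plus:
  assumes "ordm j K" "ordm k L"
  shows "ordm (max j k) (\<lambda>l n. K l n + L l n)"
  by (intro ordm_add ordm_mono[OF assms(1)] ordm_mono[OF assms(2)]) auto

text \<open>Off-diagonal decay makes columns rapidly decreasing. Two powers beyond those for the
  weight suffice, since squaring turns them into \<open>wt (l - n) ^ 4\<close>. It lets
  \<open>act_mmul\<close>, applied to the columns of the last factor, prove associativity.\<close>

lemma hs_column:
  assumes "ordm k K"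
  shows "hs s (\<lambda>l. K l n)"
proof -
  define N where "N = nat \<lceil>\<bar>s\<bar>\<rceil> + 2"
  have N: "\<bar>s\<bar> \<le> real (nat \<lceil>\<bar>s\<bar>\<rceil>)" by linarith
  obtain A where A: "bnd N k A K" using ordmE[OF assms] .
  define D where "D = wt n powr s * (A * wt n powr k)"
  have D: "(wt l powr s * cmod (K l n))\<^sup>2 \<le> D\<^sup>2 * (1 / wt (l - n) ^ 4)" for l
  proof -
    have "(wt l powr s * cmod (K l n)) * wt (l - n) ^ 2
        \<le> wt (l - n) ^ nat \<lceil>\<bar>s\<bar>\<rceil> * wt n powr s * cmod (K l n) * wt (l - n) ^ 2"
      by (intro mult_right_mono wt_powr_le_power N) auto
    also have "\<dots> = wt n powr s * (cmod (K l n) * wt (l - n) ^ N)"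
      by (simp add: N_def power_add mult_ac power2_eq_square)
    also have "\<dots> \<le> D"
      unfolding D_def by (intro mult_left_mono bndD[OF A]) simp
    finally have "wt l powr s * cmod (K l n) \<le> D / wt (l - n) ^ 2"
      by (simp add: pos_le_divide_eq)
    from power_mono[OF this, of 2] show ?thesis
      by (simp add: power_divide flip: power_mult)
  qed
  show ?thesis unfolding hs_def
    by (rule summable_on_comparison_test[OF summable_on_cmult_right[OF has_sum_imp_summable[OF has_sum_wt_shift'], of "D\<^sup>2"]])
      (use D in auto)
qed

lemma mmul_eq_act: "mmul K L l n = act K (\<lambda>r. L r n) l"
  by (simp add: mmul_def act_def)

lemma mmul_assoc:
  assumes "ordm i K" "ordm j L" "ordm k H"
  shows "mmul (mmul K L) H = mmul K (mmul L H)"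
proof (intro ext)
  fix l n
  show "mmul (mmul K L) H l n = mmul K (mmul L H) l n"
    unfolding mmul_eq_act[of _ H] mmul_eq_act[of K "mmul L H"]
    using act_mmul[OF assms(1,2) hs_column[OF assms(3), of "0 + i + j" n]]
    by (simp add: mmul_eq_act[of L H] cong: if_cong)
qed

lemma mmul_add_left:
  assumes "ordm i K" "ordm j L" "ordm k H"
  shows "mmul (\<lambda>l n. K l n + L l n) H = (\<lambda>l n. mmul K H l n + mmul L H l n)"
  unfolding mmul_def distrib_right
  by (intro ext infsum_add ordm_mmul_aux(1)[OF assms(1,3)] ordm_mmul_aux(1)[OF assms(2,3)])

lemma mmul_add_right:
  assumes "ordm i K" "ordm j L" "ordm k H"
  shows "mmul H (\<lambda>l n. K l n + L l n) = (\<lambda>l n. mmul H K l n + mmul H L l n)"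
  unfolding mmul_def distrib_left
  by (intro ext infsum_add ordm_mmul_aux(1)[OF assms(3,1)] ordm_mmul_aux(1)[OF assms(3,2)])

lemma adjm_mmul: "adjm (mmul K L) = mmul (adjm L) (adjm K)"
  by (simp add: adjm_def mmul_def fun_eq_iff mult.commute flip: infsum_cnj)

text \<open>Once convergence is hidden in the type, noncommutative identities such as
  \<open>symmetrized_form\<close> and \<open>diff_comm\<close> become a matter of
  \<open>algebra_simps\<close>.\<close>

instantiation rmat :: ring
begin

lift_definition zero_rmat :: rmat is "\<lambda>l n. 0"
  by (auto simp: ordm_def bnd_def intro!: exI[of _ 0])

lift_definition plus_rmat :: "rmat \<Rightarrow> rmat \<Rightarrow> rmat" is "\<lambda>K L l n. K l n + L l n"
  using ordm_plus by blast

lift_definition uminus_rmat :: "rmat \<Rightarrow> rmat" is "\<lambda>K l n. - K l n"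
  using ordm_uminus by blast

definition minus_rmat :: "rmat \<Rightarrow> rmat \<Rightarrow> rmat" where
  "minus_rmat X Y = X + (- Y)"

lift_definition times_rmat :: "rmat \<Rightarrow> rmat \<Rightarrow> rmat" is mmul
  using ordm_mmul by blast

instance
proof
  fix a b c :: rmat
  show "a + b + c = a + (b + c)" by transfer (simp add: add.assoc)
  show "a + b = b + a" by transfer (simp add: add.commute)
  show "0 + a = a" by transfer simp
  show "- a + a = 0" by transfer simp
  show "a - b = a + - b" by (rule minus_rmat_def)
  show "a * b * c = a * (b * c)" by transfer (elim exE, rule mmul_assoc)
  show "(a + b) * c = a * c + b * c" by transfer (elim exE, rule mmul_add_left)
  show "a * (b + c) = a * b + a * c" by transfer (elim exE, rule mmul_add_right)
qed

end

lift_definition adj :: "rmat \<Rightarrow> rmat" is adjm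
  using ordm_adjm by blast

text \<open>This is conjugation by multiplication with \<open>exp (i p \<cdot> x)\<close>, hence
  multiplicative (\<open>shft_mult\<close>).\<close>

lift_definition shft :: "int^2 \<Rightarrow> rmat \<Rightarrow> rmat" is "\<lambda>p K l n. K (l + p) (n + p)"
proof -
  fix p and K :: matrix
  assume "\<exists>k. ordm k K"
  then obtain k where k: "ordm k K" by blast
  have "\<exists>B. bnd N k B (\<lambda>l n. K (l + p) (n + p))" for N
  proof -
    obtain A where A: "bnd N k A K" using ordmE[OF k] .
    have "bnd N k (A * wt p powr \<bar>k\<bar>) (\<lambda>l n. K (l + p) (n + p))"
      unfolding bnd_def
    proof (intro allI)
      fix l n
      have "cmod (K (l + p) (n + p)) * wt (l - n) ^ N \<le> A * wt (n + p) powr k"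
        using bndD[OF A, of "l + p" "n + p"] by simp
      also have "\<dots> \<le> A * (wt p powr \<bar>k\<bar> * wt n powr k)"
        by (intro mult_left_mono wt_powr_peetre bnd_nonneg[OF A])
      finally show "cmod (K (l + p) (n + p)) * wt (l - n) ^ N \<le> A * wt p powr \<bar>k\<bar> * wt n powr k"
        by (simp add: mult.assoc)
    qed
    thus ?thesis ..
  qed
  hence "ordm k (\<lambda>l n. K (l + p) (n + p))" by (simp add: ordm_def)
  thus "\<exists>k. ordm k (\<lambda>l n. K (l + p) (n + p))" ..
qed

lemma ent_add: "ent (X + Y) = (\<lambda>l n. ent X l n + ent Y l n)" by transfer simp
lemma ent_uminus: "ent (- X) = (\<lambda>l n. - ent X l n)" by transfer simp
lemma ent_diff: "ent (X - Y) = (\<lambda>l n. ent X l n - ent Y l n)"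
  by (simp only: minus_rmat_def ent_add ent_uminus diff_conv_add_uminus)
lemma ent_mult: "ent (X * Y) = mmul (ent X) (ent Y)" by transfer simp
lemma ent_adj: "ent (adj X) = adjm (ent X)" by transfer simp
lemma ent_shft: "ent (shft p X) = (\<lambda>l n. ent X (l + p) (n + p))" by transfer simp

lemma ent_comm: "ent (X * Y - Y * X) = mcomm (ent X) (ent Y)"
  by (simp add: ent_diff ent_mult mcomm_def)

lemma adj_add [simp]: "adj (X + Y) = adj X + adj Y" by transfer (simp add: adjm_def)
lemma adj_mult [simp]: "adj (X * Y) = adj Y * adj X" by transfer (rule adjm_mmul)
lemma adj_adj [simp]: "adj (adj X) = X" by transfer (simp add: adjm_def)
lemma adj_uminus [simp]: "adj (- X) = - adj X" by transfer (simp add: adjm_def)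
lemma adj_diff [simp]: "adj (X - Y) = adj X - adj Y"
  by (simp only: minus_rmat_def adj_add adj_uminus)

lemma shft_mult: "shft p (X * Y) = shft p X * shft p Y"
proof (transfer, intro ext)
  fix p l n and K L :: matrix
  have "bij_betw (\<lambda>r :: int^2. r + p) UNIV UNIV"
    by (rule bij_betwI[where g = "\<lambda>r. r - p"]) auto
  from infsum_reindex_bij_betw[OF this, of "\<lambda>r. K (l + p) r * L r (n + p)"]
  show "mmul K L (l + p) (n + p) = mmul (\<lambda>l n. K (l + p) (n + p)) (\<lambda>l n. L (l + p) (n + p)) l n"
    by (simp add: mmul_def)
qed

lemma shft_diff: "shft p (X - Y) = shft p X - shft p Y"
  unfolding minus_rmat_def by transfer simp

definition diff :: "int^2 \<Rightarrow> rmat \<Rightarrow> rmat" where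
  "diff p X = shft p X - X"

lemma ent_diffm: "ent (diff p X) = dif p (ent X)"
  by (simp add: diff_def ent_diff ent_shft dif_def)

text \<open>The Leibniz rule for \<open>diff p\<close>, with one factor shifted because
  \<open>shft p\<close> is multiplicative. It yields differences of a commutator without computing
  its entries.\<close>

lemma diff_comm:
  "diff p (X * Y - Y * X)
    = (diff p X * Y - Y * diff p X) + (shft p X * diff p Y - diff p Y * shft p X)"
  by (simp add: diff_def shft_diff shft_mult algebra_simps)

text \<open>
  With \<open>R = [P, Q]\<close>, \<open>S = [R, Q]\<close> and \<open>m = Q + Q\<^sup>*\<close>, the symmetrization of
  \<open>P\<^sup>*PQ\<^sup>2 + Q\<^sup>*P\<^sup>*PQ\<close> is a sum of products in which \<open>Q\<close> occurs only inside commutators and \<open>m\<close>.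
\<close>

lemma symmetrized_form:
  fixes P Q :: rmat
  defines "R \<equiv> P * Q - Q * P" and "m \<equiv> Q + adj Q"
  defines "S \<equiv> R * Q - Q * R" and "T \<equiv> m * Q - Q * m"
  defines "E \<equiv> adj P * (P * (Q * Q)) + adj (P * Q) * (P * Q)"
  shows "E + adj E = adj P * S + adj S * P + adj P * (m * R) + adj R * (m * P) + adj R * R + adj R * R
    + adj R * (m * P) + adj P * (m * R) + adj P * (T * P) + adj P * (m * (m * P))"
  unfolding E_def T_def S_def R_def m_def
  by (simp add: algebra_simps)

section \<open>Families: constants, reindexing and shifts\<close>

lemma ordf_const:
  assumes "\<And>i. 1 \<le> v i" "ordm k K"
  shows "ordf v k (\<lambda>_. K)"
  unfolding ordf_def
proof
  fix N
  obtain A where "bnd N k A K" using ordmE[OF assms(2)] .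
  thus "\<exists>A M. \<forall>i. bnd N k (A * v i ^ M) K"
    by (intro exI[of _ A] exI[of _ 0]) simp
qed

lemma ordf_unit: "ordf (\<lambda>_ :: unit. 1) k (\<lambda>_. K) \<longleftrightarrow> ordm k K"
  by (auto simp: ordf_def ordm_def)

lemma ordf_reindex:
  assumes "ordf v k K"
  shows "ordf (\<lambda>i. v (f i)) k (\<lambda>i. K (f i))"
  using assms unfolding ordf_def by meson

lemma ordf_mono_weight:
  assumes "ordf v k K" "\<And>i. 1 \<le> v i" "\<And>i. v i \<le> u i"
  shows "ordf u k K"
  unfolding ordf_def
proof
  fix N
  obtain A M where A: "0 \<le> A" "\<And>i. bnd N k (A * v i ^ M) (K i)"
    using ordfE[OF assms(1,2), of N] by metis
  have "bnd N k (A * u i ^ M) (K i)" for i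
    by (rule bnd_mono[OF A(2)])
      (use A(1) assms(2)[of i] assms(3)[of i] in \<open>auto intro!: mult_left_mono power_mono\<close>)
  thus "\<exists>A M. \<forall>i. bnd N k (A * u i ^ M) (K i)" by blast
qed

lemma ordf_add:
  assumes "ordf v k K" "ordf v k L" "\<And>i. 1 \<le> v i"
  shows "ordf v k (\<lambda>i l n. K i l n + L i l n)"
  unfolding ordf_def
proof
  fix N
  obtain A M where A: "0 \<le> A" "\<And>i. bnd N k (A * v i ^ M) (K i)"
    using ordfE[OF assms(1,3), of N] by metis
  obtain B M' where B: "0 \<le> B" "\<And>i. bnd N k (B * v i ^ M') (L i)"
    using ordfE[OF assms(2,3), of N] by metis
  have "bnd N k ((A + B) * v i ^ (M + M')) (\<lambda>l n. K i l n + L i l n)" for i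
  proof (rule bnd_mono[OF bnd_add[OF A(2) B(2)]])
    have "v i ^ M \<le> v i ^ (M + M')" "v i ^ M' \<le> v i ^ (M + M')"
      using assms(3)[of i] by (auto intro!: power_increasing)
    thus "A * v i ^ M + B * v i ^ M' \<le> (A + B) * v i ^ (M + M')"
      using A(1) B(1) by (simp add: distrib_right add_mono mult_left_mono)
  qed auto
  thus "\<exists>A M. \<forall>i. bnd N k (A * v i ^ M) (\<lambda>l n. K i l n + L i l n)" by blast
qed

lemma ordf_shift:
  assumes "ordf v k K" "\<And>i. 1 \<le> v i"
  shows "ordf (\<lambda>(i, p). v i * wt p) k (\<lambda>(i, p) l n. K i (l + p) (n + p))"
  unfolding ordf_def
proof
  fix N
  define J where "J = nat \<lceil>\<bar>k\<bar>\<rceil>"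
  have J: "\<bar>k\<bar> \<le> real J" unfolding J_def by linarith
  obtain A M where A: "0 \<le> A" "\<And>i. bnd N k (A * v i ^ M) (K i)"
    using ordfE[OF assms, of N] by metis
  have "bnd N k (A * (v i * wt p) ^ (M + J)) (\<lambda>l n. K i (l + p) (n + p))" for i p
    unfolding bnd_def
  proof (intro allI)
    fix l n
    have "cmod (K i (l + p) (n + p)) * wt (l - n) ^ N \<le> A * v i ^ M * wt (n + p) powr k"
      using bndD[OF A(2), of i "l + p" "n + p"] by simp
    also have "\<dots> \<le> A * v i ^ M * (wt p ^ J * wt n powr k)"
      using wt_powr_le_power[OF J, of "n + p" n] A(1) assms(2)[of i] by (intro mult_left_mono) auto
    also have "\<dots> = A * (v i ^ M * wt p ^ J) * wt n powr k" by simp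
    also have "\<dots> \<le> A * (v i ^ (M + J) * wt p ^ (M + J)) * wt n powr k"
      using A(1) assms(2)[of i] wt_ge_1
      by (intro mult_right_mono mult_left_mono mult_mono power_increasing) auto
    finally show "cmod (K i (l + p) (n + p)) * wt (l - n) ^ N
        \<le> A * (v i * wt p) ^ (M + J) * wt n powr k"
      by (simp add: power_mult_distrib)
  qed
  thus "\<exists>A M. \<forall>ip. bnd N k (A * (case ip of (i, p) \<Rightarrow> v i * wt p) ^ M)
      (case ip of (i, p) \<Rightarrow> \<lambda>l n. K i (l + p) (n + p))"
    by (intro exI[of _ A] exI[of _ "M + J"]) auto
qed

lemma lipf_const:
  assumes "\<And>i. 1 \<le> v i" "ordf wt (k - 1) (\<lambda>p. dif p K)"
  shows "lipf v k (\<lambda>_. K)"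
  unfolding lipf_def
proof (rule ordf_mono_weight)
  show "ordf (\<lambda>(i, p). wt p) (k - 1) (\<lambda>(i, p). dif p K)"
    using ordf_reindex[OF assms(2), of snd] by (simp add: case_prod_unfold)
  show "(case ip of (i, p) \<Rightarrow> wt p) \<le> (case ip of (i, p) \<Rightarrow> v i * wt p)" for ip
    using mult_right_mono[OF assms(1)] by (auto split: prod.splits)
qed (auto simp: wt_ge_1)


subsection \<open>First-order differential operators on the frequency side\<close>

definition rapid :: "(int^2 \<Rightarrow> complex) \<Rightarrow> bool" where
  "rapid \<gamma> \<longleftrightarrow> (\<forall>N. \<exists>A. \<forall>p. cmod (\<gamma> p) * wt p ^ N \<le> A)"

text \<open>Convolution with \<open>\<gamma>\<close>, that is, multiplication by the function with
  Fourier coefficients \<open>\<gamma>\<close>. Its entries are constant along diagonals, so every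
  \<open>dif p\<close> annihilates it.\<close>

definition tmat :: "(int^2 \<Rightarrow> complex) \<Rightarrow> matrix" where
  "tmat \<gamma> = (\<lambda>l n. \<gamma> (l - n))"

text \<open>The operator \<open>\<Sum>i. b i * \<partial>i + c\<close> on coefficients, where
  \<open>\<beta> i\<close> and \<open>\<gamma>\<close> belong to \<open>b i\<close> and
  \<open>c\<close>, and \<open>\<partial>i\<close> multiplies the \<open>n\<close>-th coefficient by
  \<open>\<i> * n $ i\<close>.\<close>

definition dmat :: "(2 \<Rightarrow> int^2 \<Rightarrow> complex) \<Rightarrow> (int^2 \<Rightarrow> complex) \<Rightarrow> matrix" where
  "dmat \<beta> \<gamma> = (\<lambda>l n. (\<Sum>i\<in>UNIV. \<beta> i (l - n) * (\<i> * of_int (n $ i))) + \<gamma> (l - n))"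

lemma ordm_tmat: "rapid \<gamma> \<Longrightarrow> ordm 0 (tmat \<gamma>)"
  by (simp add: rapid_def ordm_def bnd_def tmat_def) metis

lemma cmod_int_le_wt: "cmod (of_int (n $ i)) \<le> wt n"
  using component_le_norm_cart[of "freq n" i] by (simp add: wt_def)

lemma ordm_dmat:
  assumes "\<And>i. rapid (\<beta> i)" "rapid \<gamma>"
  shows "ordm 1 (dmat \<beta> \<gamma>)"
proof -
  have 1: "ordm 1 (\<lambda>l n. \<beta> i (l - n) * (\<i> * of_int (n $ i)))" for i
    unfolding ordm_def
  proof
    fix N
    obtain A where A: "cmod (\<beta> i p) * wt p ^ N \<le> A" for p
      using assms(1)[of i] unfolding rapid_def by metis
    have "cmod (\<beta> i (l - n)) * wt (l - n) ^ N * cmod (of_int (n $ i)) \<le> A * wt n" for l n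
      by (intro mult_mono A cmod_int_le_wt order_trans[OF _ A[of 0]]) auto
    hence "bnd N 1 A (\<lambda>l n. \<beta> i (l - n) * (\<i> * of_int (n $ i)))"
      by (simp add: bnd_def norm_mult mult_ac)
    thus "\<exists>A. bnd N 1 A (\<lambda>l n. \<beta> i (l - n) * (\<i> * of_int (n $ i)))" ..
  qed
  have "ordm 1 (tmat \<gamma>)" by (rule ordm_mono[OF ordm_tmat[OF assms(2)]]) simp
  from ordm_add[OF ordm_add[OF 1[of 1] 1[of 2]] this] show ?thesis
    by (simp add: dmat_def tmat_def sum_2)
qed

text \<open>Along a diagonal the entries of a first-order operator are affine in \<open>n\<close>.
  The difference is thus a multiplication operator, linear in \<open>p\<close>, and all second
  differences vanish.\<close>

lemma dif_dmat: "dif p (dmat \<beta> \<gamma>) = tmat (\<lambda>m. \<Sum>i\<in>UNIV. \<beta> i m * (\<i> * of_int (p $ i)))"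
  by (simp add: dif_def dmat_def tmat_def fun_eq_iff sum_2 algebra_simps)

lemma ordf_dif_dmat:
  assumes "\<And>i. rapid (\<beta> i)"
  shows "ordf wt 0 (\<lambda>p. dif p (dmat \<beta> \<gamma>))"
  unfolding ordf_def
proof
  fix N
  have "\<forall>i. \<exists>A. \<forall>p. cmod (\<beta> i p) * wt p ^ N \<le> A"
    using assms unfolding rapid_def by blast
  then obtain A where A: "\<And>i p. cmod (\<beta> i p) * wt p ^ N \<le> A i"
    by metis
  have "bnd N 0 ((A 1 + A 2) * wt p ^ 1) (dif p (dmat \<beta> \<gamma>))" for p
    unfolding bnd_def
  proof (intro allI)
    fix l n
    have "cmod (\<beta> i (l - n)) * wt (l - n) ^ N * cmod (of_int (p $ i)) \<le> A i * wt p" for i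
      by (intro mult_mono A cmod_int_le_wt order_trans[OF _ A[of i 0]]) auto
    from add_mono[OF this[of 1] this[of 2]]
    have "(cmod (\<beta> 1 (l - n) * (\<i> * of_int (p $ 1))) + cmod (\<beta> 2 (l - n) * (\<i> * of_int (p $ 2))))
        * wt (l - n) ^ N \<le> (A 1 + A 2) * wt p"
      by (simp add: norm_mult algebra_simps)
    moreover have "cmod (dif p (dmat \<beta> \<gamma>) l n) * wt (l - n) ^ N
        \<le> (cmod (\<beta> 1 (l - n) * (\<i> * of_int (p $ 1))) + cmod (\<beta> 2 (l - n) * (\<i> * of_int (p $ 2))))
        * wt (l - n) ^ N"
      unfolding dif_dmat tmat_def sum_2 by (intro mult_right_mono norm_triangle_ineq) simp
    ultimately have "cmod (dif p (dmat \<beta> \<gamma>) l n) * wt (l - n) ^ N \<le> (A 1 + A 2) * wt p"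
      by (rule order_trans[rotated])
    thus "cmod (dif p (dmat \<beta> \<gamma>) l n) * wt (l - n) ^ N
        \<le> (A 1 + A 2) * wt p ^ 1 * wt n powr 0" by simp
  qed
  thus "\<exists>A M. \<forall>p. bnd N 0 (A * wt p ^ M) (dif p (dmat \<beta> \<gamma>))" by blast
qed

text \<open>Two differences suffice, since only a double commutator has to be estimated.\<close>

definition symbolic :: "real \<Rightarrow> matrix \<Rightarrow> bool" where
  "symbolic k K \<longleftrightarrow> ordm k K \<and> ordf wt (k - 1) (\<lambda>p. dif p K) \<and>
     ordf (\<lambda>(p, q). wt p * wt q) (k - 2) (\<lambda>(p, q). dif q (dif p K))"

text \<open>A second commutator with \<open>Y\<close> takes first differences of
  \<open>X * Y - Y * X\<close>, of order \<open>k - 1\<close> uniformly in the shift.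
  \<open>diff_comm\<close> splits them into two commutators: one of \<open>dif p\<close> of
  \<open>X\<close> with \<open>Y\<close>, which uses the second differences of \<open>X\<close>, and
  one of the shifted \<open>X\<close> with \<open>dif p\<close> of \<open>Y\<close>, whose own
  differences are zero.\<close>

lemma double_commutator:
  assumes K: "symbolic k (ent X)" and \<beta>: "\<And>i. rapid (\<beta> i)" and \<gamma>: "rapid \<gamma>"
    and Y: "ent Y = dmat \<beta> \<gamma>"
  shows "ordm k (ent (X * Y - Y * X))"
    and "ordm k (ent ((X * Y - Y * X) * Y - Y * (X * Y - Y * X)))"
proof -
  define R where "R = X * Y - Y * X"
  have K0: "ordm k (ent X)" and K1: "ordf wt (k - 1) (\<lambda>p. dif p (ent X))"
    and K2: "ordf (\<lambda>(p, q). wt p * wt q) (k - 2) (\<lambda>(p, q). dif q (dif p (ent X)))"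
    using K by (simp_all add: symbolic_def)
  have Y0: "ordm 1 (ent Y)" and Y1: "ordf wt 0 (\<lambda>p. dif p (ent Y))"
    unfolding Y by (rule ordm_dmat[OF \<beta> \<gamma>], rule ordf_dif_dmat[OF \<beta>])
  have Y1': "lipf v 1 (\<lambda>_. ent Y)" if "\<And>i. 1 \<le> v i" for v :: "'a \<Rightarrow> real"
    using Y1 by (intro lipf_const that) simp
  have comm: "ordm k (ent (Z * Y - Y * Z))"
    if "ordm k (ent Z)" "ordf wt (k - 1) (\<lambda>p. dif p (ent Z))" for Z
  proof -
    have "ordf (\<lambda>_ :: unit. 1) (k + 1 - 1) (\<lambda>_. mcomm (ent Z) (ent Y))"
      using that Y0 Y1 by (intro mcomm_ordf lipf_const) (auto simp: ordf_unit)
    thus ?thesis by (simp add: ordf_unit ent_comm)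
  qed
  show "ordm k (ent (X * Y - Y * X))" by (rule comm[OF K0 K1])
  have "ordf wt (k - 1) (\<lambda>p. dif p (ent R))"
  proof -
    have "ordf wt (k - 1 + 1 - 1) (\<lambda>p. mcomm (dif p (ent X)) (ent Y))"
    proof (rule mcomm_ordf)
      show "lipf wt (k - 1) (\<lambda>p. dif p (ent X))" using K2 by (simp add: lipf_def)
      show "lipf wt 1 (\<lambda>_. ent Y)" using Y1 by (intro lipf_const) (auto simp: wt_ge_1)
    qed (auto simp: wt_ge_1 K1 intro: ordf_const Y0)
    moreover have "ordf wt (k + 0 - 1) (\<lambda>p. mcomm (ent (shft p X)) (dif p (ent Y)))"
    proof (rule mcomm_ordf)
      have "ordf (\<lambda>(i :: unit, p). 1 * wt p) k (\<lambda>(i, p) l n. ent X (l + p) (n + p))"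
        using K0 by (intro ordf_shift) (auto simp: ordf_unit)
      from ordf_reindex[OF this, of "\<lambda>p. ((), p)"] show "ordf wt k (\<lambda>p. ent (shft p X))"
        by (simp add: ent_shft)
      \<comment> \<open>Differences commute with shifts, so a difference of the shifted matrix is a
        shifted difference. \<open>prod.swap\<close> reconciles the order of the two indices with
        that in \<open>lipf\<close>.\<close>
      have "ordf (\<lambda>(q, p). wt q * wt p) (k - 1) (\<lambda>(q, p) l n. dif q (ent X) (l + p) (n + p))"
        by (rule ordf_shift[OF K1 wt_ge_1])
      from ordf_reindex[OF this, of prod.swap] show "lipf wt k (\<lambda>p. ent (shft p X))"
        by (simp add: lipf_def ent_shft dif_def prod.swap_def case_prod_unfold add_ac mult.commute)
      have "dif q (dif p (ent Y)) = (\<lambda>l n. 0)" for p q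
        unfolding Y dif_dmat by (simp add: dif_def tmat_def)
      thus "lipf wt 0 (\<lambda>p. dif p (ent Y))"
        by (auto simp: lipf_def ordf_def bnd_def intro!: exI[of _ 0])
    qed (auto simp: wt_ge_1 Y1)
    ultimately have "ordf wt (k - 1) (\<lambda>p l n. mcomm (dif p (ent X)) (ent Y) l n
        + mcomm (ent (shft p X)) (dif p (ent Y)) l n)"
      by (intro ordf_add) (auto simp: wt_ge_1)
    moreover have "dif p (ent R) = (\<lambda>l n. mcomm (dif p (ent X)) (ent Y) l n
        + mcomm (ent (shft p X)) (dif p (ent Y)) l n)" for p
      using arg_cong[OF diff_comm[of p X Y], of ent] by (simp only: R_def ent_diffm ent_add ent_comm)
    ultimately show ?thesis by simp
  qed
  with comm[OF K0 K1] show "ordm k (ent ((X * Y - Y * X) * Y - Y * (X * Y - Y * X)))"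
    unfolding R_def[symmetric] by (intro comm)
qed

section \<open>The estimate of the quadratic form on the frequency side\<close>

lemma ordm_entI_mult: "ordm j (ent X) \<Longrightarrow> ordm k (ent Y) \<Longrightarrow> i = j + k \<Longrightarrow> ordm i (ent (X * Y))"
  by (simp add: ent_mult ordm_mmul)

lemma ordm_entI_adj: "ordm j (ent X) \<Longrightarrow> ordm j (ent (adj X))"
  by (simp add: ent_adj ordm_adjm)

lemma ordm_entI_add: "ordm j (ent X) \<Longrightarrow> ordm j (ent Y) \<Longrightarrow> ordm j (ent (X + Y))"
  by (simp add: ent_add ordm_add)

lemma act_ent_mult:
  assumes "ordm j (ent X)" "ordm k (ent Y)" "hs (s + j + k) x"
  shows "act (ent (X * Y)) x = act (ent X) (act (ent Y) x)"
  unfolding ent_mult by (rule act_mmul[OF assms])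

lemma ip_act_act:
  assumes "ordm i (ent X)" "ordm j (ent Y)" "hs i x" "hs j x"
  shows "ip (act (ent X) x) (act (ent Y) x) = ip x (act (ent (adj X * Y)) x)"
proof -
  have "ip (act (ent X) x) (act (ent Y) x) = ip x (act (adjm (ent X)) (act (ent Y) x))"
    by (rule ip_act_adjm[OF assms(1), where s = 0]) (use assms in \<open>auto intro!: hs_act[OF assms(2)]\<close>)
  also have "act (adjm (ent X)) (act (ent Y) x) = act (ent (adj X * Y)) x"
    unfolding ent_adj[symmetric]
    by (rule act_ent_mult[OF ordm_entI_adj[OF assms(1)] assms(2), of "- i", symmetric])
      (use assms(4) in simp)
  finally show ?thesis .
qed

text \<open>The form is the real part of \<open>ip x (act (ent E) x)\<close>, that is, half of
  \<open>ip x (act (ent F) x)\<close> with \<open>F = E + adj E\<close>. By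
  \<open>symmetrized_form\<close> the matrix \<open>F\<close> has order \<open>2 * k\<close> and
  maps the space of order \<open>k\<close> to its dual. The regularity \<open>hs (2 + k) x\<close>
  justifies moving operators across \<open>ip\<close>; the bound itself sees only the norm of order
  \<open>k\<close>.\<close>

proposition frequency_estimate:
  assumes K: "symbolic k K" and \<beta>: "\<And>i. rapid (\<beta> i)" and \<gamma>: "rapid \<gamma>"
    and \<beta>_herm: "\<And>i p. \<beta> i (- p) = cnj (\<beta> i p)" and \<gamma>_herm: "\<And>p. \<gamma> (- p) = cnj (\<gamma> p)"
  defines "D \<equiv> act (dmat \<beta> \<gamma>)"
  shows "\<exists>C. \<forall>x. hs (2 + k) x \<longrightarrow>
    Re (ip (act K (D (D x))) (act K x)) + Re (ip (act K (D x)) (act K (D x))) \<le> C * nrm2 k x"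
proof -
  obtain P where P: "ent P = K"
    using Rmat_inverse K by (auto simp: symbolic_def)
  obtain Q where Q: "ent Q = dmat \<beta> \<gamma>"
    using Rmat_inverse[of "dmat \<beta> \<gamma>"] ordm_dmat[of \<beta> \<gamma>, OF \<beta> \<gamma>] by blast
  have P0: "ordm k (ent P)" using K P by (simp add: symbolic_def)
  have Q0: "ordm 1 (ent Q)" unfolding Q by (rule ordm_dmat[OF \<beta> \<gamma>])
  have Q1: "ordf wt 0 (\<lambda>p. dif p (ent Q))" unfolding Q by (rule ordf_dif_dmat[OF \<beta>])
  define R where "R = P * Q - Q * P"
  define S where "S = R * Q - Q * R"
  define m where "m = Q + adj Q"
  define T where "T = m * Q - Q * m"
  have R0: "ordm k (ent R)" and S0: "ordm k (ent S)"
    unfolding R_def S_def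
    using double_commutator[OF _ \<beta> \<gamma> Q, of k P] K P by simp_all
  \<comment> \<open>Real coefficients enter here: their hermitian symmetry cancels \<open>n\<close>
    and leaves only \<open>l - n\<close>. The matrix is that of multiplication by twice the
    zero-order coefficient minus the divergence of the first-order ones.\<close>
  have m_eq: "ent m = tmat (\<lambda>p. (\<Sum>i\<in>UNIV. \<beta> i p * (\<i> * of_int (- p $ i))) + 2 * \<gamma> p)"
  proof (intro ext)
    fix l n
    have "cnj (\<beta> i (n - l)) = \<beta> i (l - n)" "cnj (\<gamma> (n - l)) = \<gamma> (l - n)" for i
      using \<beta>_herm[of i "n - l"] \<gamma>_herm[of "n - l"] by simp_all
    thus "ent m l n = tmat (\<lambda>p. (\<Sum>i\<in>UNIV. \<beta> i p * (\<i> * of_int (- p $ i))) + 2 * \<gamma> p) l n"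
      unfolding m_def ent_add ent_adj Q
      by (simp add: adjm_def dmat_def tmat_def sum_2 algebra_simps)
  qed
  have m0: "ordm 0 (ent m)"
    unfolding m_eq
  proof (rule ordm_tmat)
    show "rapid (\<lambda>p. (\<Sum>i\<in>UNIV. \<beta> i p * (\<i> * of_int (- p $ i))) + 2 * \<gamma> p)"
      unfolding rapid_def
    proof
      fix N
      have "\<forall>i. \<exists>A. \<forall>p. cmod (\<beta> i p) * wt p ^ Suc N \<le> A"
        using \<beta> unfolding rapid_def by blast
      then obtain A where A: "\<And>i p. cmod (\<beta> i p) * wt p ^ Suc N \<le> A i"
        by metis
      obtain B where B: "\<And>p. cmod (\<gamma> p) * wt p ^ N \<le> B"
        using \<gamma> unfolding rapid_def by metis
      have "cmod ((\<Sum>i\<in>UNIV. \<beta> i p * (\<i> * of_int (- p $ i))) + 2 * \<gamma> p) * wt p ^ N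
          \<le> A 1 + A 2 + 2 * B" for p
      proof -
        have 1: "cmod (\<beta> i p * (\<i> * of_int (- p $ i))) * wt p ^ N \<le> A i" for i
        proof -
          have "cmod (\<beta> i p * (\<i> * of_int (- p $ i))) * wt p ^ N
              = cmod (\<beta> i p) * cmod (of_int (p $ i)) * wt p ^ N"
            by (simp add: norm_mult)
          also have "\<dots> \<le> cmod (\<beta> i p) * wt p * wt p ^ N"
            by (intro mult_right_mono mult_left_mono cmod_int_le_wt) auto
          also have "\<dots> = cmod (\<beta> i p) * wt p ^ Suc N" by simp
          also have "\<dots> \<le> A i" by (rule A)
          finally show ?thesis .
        qed
        have "cmod ((\<Sum>i\<in>UNIV. \<beta> i p * (\<i> * of_int (- p $ i))) + 2 * \<gamma> p) * wt p ^ N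
            \<le> (cmod (\<beta> 1 p * (\<i> * of_int (- p $ 1))) + cmod (\<beta> 2 p * (\<i> * of_int (- p $ 2)))
              + cmod (2 * \<gamma> p)) * wt p ^ N"
          unfolding sum_2 by (intro mult_right_mono norm_triangle_le add_mono norm_triangle_ineq) auto
        thus ?thesis using 1[of 1] 1[of 2] B[of p] by (simp add: norm_mult distrib_right)
      qed
      thus "\<exists>A. \<forall>p. cmod ((\<Sum>i\<in>UNIV. \<beta> i p * (\<i> * of_int (- p $ i))) + 2 * \<gamma> p) * wt p ^ N \<le> A"
        by blast
    qed
  qed
  have T0: "ordm 0 (ent T)"
  proof -
    \<comment> \<open>Multiplication operators have no diagonal differences, so the commutator with
      \<open>Q\<close> stays of order 0.\<close>
    have "dif p (ent m) = (\<lambda>l n. 0)" for p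
      unfolding m_eq by (simp add: dif_def tmat_def)
    hence "ordf wt (0 - 1) (\<lambda>p. dif p (ent m))"
      by (auto simp: ordf_def bnd_def intro!: exI[of _ 0])
    hence "ordf (\<lambda>_ :: unit. 1) (0 + 1 - 1) (\<lambda>_. mcomm (ent m) (ent Q))"
      using m0 Q0 Q1 by (intro mcomm_ordf lipf_const) (auto simp: ordf_unit)
    thus ?thesis by (simp add: ordf_unit T_def ent_comm)
  qed
  define E where "E = adj P * (P * (Q * Q)) + adj (P * Q) * (P * Q)"
  define F where "F = E + adj E"
  have mult0: "ordm k (ent (X * Y))" if "ordm 0 (ent X)" "ordm k (ent Y)" for X Y
    by (rule ordm_entI_mult[OF that]) simp
  have adj_mult: "ordm (2 * k) (ent (adj X * Y))" if "ordm k (ent X)" "ordm k (ent Y)" for X Y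
    by (rule ordm_entI_mult[OF ordm_entI_adj[OF that(1)] that(2)]) simp
  have F0: "ordm (2 * k) (ent F)"
    unfolding F_def E_def symmetrized_form R_def[symmetric] m_def[symmetric] S_def[symmetric] T_def[symmetric]
    by (intro ordm_entI_add adj_mult P0 R0 S0 mult0[OF m0] mult0[OF T0])
  have PQ0: "ordm (k + 1) (ent (P * Q))" and PQQ0: "ordm (k + 2) (ent (P * (Q * Q)))"
    by (rule ordm_entI_mult[OF P0 Q0 refl])
      (rule ordm_entI_mult[OF P0 ordm_entI_mult[OF Q0 Q0 refl]], simp)
  have PPQQ: "ordm (2 * k + 2) (ent (adj P * (P * (Q * Q))))"
    by (rule ordm_entI_mult[OF ordm_entI_adj[OF P0] PQQ0]) simp
  have QPPQ: "ordm (2 * k + 2) (ent (adj (P * Q) * (P * Q)))"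
    by (rule ordm_entI_mult[OF ordm_entI_adj[OF PQ0] PQ0]) simp
  have E1: "ordm (2 * k + 2) (ent E)"
    unfolding E_def by (rule ordm_entI_add[OF PPQQ QPPQ])
  obtain C where C: "0 \<le> C" "\<And>x. hs (- k + 2 * k) x \<Longrightarrow> nrm2 (- k) (act (ent F) x) \<le> C * nrm2 (- k + 2 * k) x"
    using nrm2_act[OF F0, of "- k"] by metis
  \<comment> \<open>One factor 1/2 of the constant comes from the symmetrization, the other from
    \<open>ip_bound\<close>.\<close>
  have "Re (ip (act K (D (D x))) (act K x)) + Re (ip (act K (D x)) (act K (D x))) \<le> (1 + C) / 4 * nrm2 k x"
    if x: "hs (2 + k) x" for x
  proof -
    have x': "hs t x" if "t \<le> 2 + k" for t
      by (rule hs_mono_bound(1)[OF x order_refl that])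
    have D: "D = act (ent Q)" by (simp add: D_def Q)
    have QQ: "act (ent (Q * Q)) x = D (D x)"
      unfolding D using x by (intro act_ent_mult[OF Q0 Q0, of k]) (simp add: add_ac)
    have PQQ: "act (ent (P * (Q * Q))) x = act (ent P) (D (D x))"
      unfolding QQ[symmetric] using x
      by (intro act_ent_mult[OF P0 ordm_entI_mult[OF Q0 Q0 refl], of 0]) (simp add: add_ac)
    have PQ: "act (ent (P * Q)) x = act (ent P) (D x)"
      unfolding D using x by (intro act_ent_mult[OF P0 Q0, of 1]) (simp add: add_ac)
    have "ip (act K (D (D x))) (act K x) = cnj (ip (act (ent P) x) (act (ent (P * (Q * Q))) x))"
      unfolding P[symmetric] PQQ by (rule ip_cnj)
    hence e1: "Re (ip (act K (D (D x))) (act K x)) = Re (ip x (act (ent (adj P * (P * (Q * Q)))) x))"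
      using ip_act_act[OF P0 PQQ0, of x] x' by simp
    have e2: "ip (act K (D x)) (act K (D x)) = ip x (act (ent (adj (P * Q) * (P * Q))) x)"
      unfolding P[symmetric] PQ[symmetric] by (rule ip_act_act[OF PQ0 PQ0]) (simp_all add: x')
    have "- k + (2 * k + 2) = 2 + k" by simp
    hence x2: "hs (- k + (2 * k + 2)) x" using x by (simp only:)
    have sumact: "act (ent (X + Y)) x = (\<lambda>l. act (ent X) x l + act (ent Y) x l)"
      if "ordm (2 * k + 2) (ent X)" "ordm (2 * k + 2) (ent Y)" for X Y
      unfolding act_def ent_add distrib_right
      by (intro ext infsum_add act_summable[OF that(1) x2] act_summable[OF that(2) x2])
    have sumip: "ip x (\<lambda>l. y l + z l) = ip x y + ip x z" if "hs (- (2 + k)) y" "hs (- (2 + k)) z" for y z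
      unfolding ip_def complex_cnj_add distrib_left
      by (intro infsum_add ip_summable[OF x] that)
    have hsE: "hs (- (2 + k)) (act (ent X) x)" if "ordm (2 * k + 2) (ent X)" for X
      by (rule hs_mono_bound(1)[OF hs_act[OF that x2] order_refl]) simp
    have add2: "ip x (act (ent (X + Y)) x) = ip x (act (ent X) x) + ip x (act (ent Y) x)"
      if "ordm (2 * k + 2) (ent X)" "ordm (2 * k + 2) (ent Y)" for X Y
      unfolding sumact[OF that] by (intro sumip hsE that)
    have "Re (ip (act K (D (D x))) (act K x)) + Re (ip (act K (D x)) (act K (D x))) = Re (ip x (act (ent E) x))"
      unfolding e1 e2 E_def add2[OF PPQQ QPPQ] by simp
    also have "\<dots> = Re (ip x (act (ent F) x)) / 2"
    proof -
      have "ip x (act (ent (adj E)) x) = ip (act (ent E) x) x"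
        unfolding ent_adj
      proof (rule ip_act_adjm[OF E1, where s = "- k", symmetric])
        show "hs (- k + (2 * k + 2)) x" by (rule x2)
        show "hs (- (- k)) x" by (rule x') simp
      qed
      also have "\<dots> = cnj (ip x (act (ent E) x))" by (rule ip_cnj)
      finally show ?thesis
        unfolding F_def add2[OF E1 ordm_entI_adj[OF E1]] by simp
    qed
    also have "\<dots> \<le> cmod (ip x (act (ent F) x)) / 2"
      using complex_Re_le_cmod by (intro divide_right_mono) auto
    also have "\<dots> \<le> (nrm2 k x + nrm2 (- k) (act (ent F) x)) / 2 / 2"
      using x'[of k] hs_act[OF F0, of "- k" x] by (intro divide_right_mono ip_bound(2)) auto
    also have "\<dots> \<le> (nrm2 k x + C * nrm2 k x) / 2 / 2"
      using C(2)[of x] x'[of k] by (intro divide_right_mono add_left_mono) auto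
    finally show ?thesis by (simp add: algebra_simps)
  qed
  thus ?thesis by blast
qed

subsection \<open>Integration over the torus\<close>

lemma torus_cell_sets [simp]: "torus_cell \<in> sets lebesgue"
  by (simp add: torus_cell_def)

lemma mem_torus_cell: "x \<in> torus_cell \<longleftrightarrow> (\<forall>i. 0 \<le> x $ i \<and> x $ i \<le> 2 * pi)"
  by (simp add: torus_cell_def mem_box_cart)

lemma compact_torus_cell: "compact torus_cell"
  by (simp add: torus_cell_def)

lemma integrable_torus:
  fixes f :: "plane \<Rightarrow> 'b::euclidean_space"
  assumes "continuous_on UNIV f"
  shows "integrable torus_measure f"
  unfolding torus_cell_def
  by (rule continuous_imp_integrable) (rule continuous_on_subset[OF assms], simp)

lemma integral_torus:
  fixes f :: "plane \<Rightarrow> 'b::euclidean_space"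
  assumes "continuous_on UNIV f"
  shows "integral\<^sup>L torus_measure f = integral torus_cell f"
  by (rule lebesgue_integral_eq_integral[OF integrable_torus[OF assms]]) simp

lemma measure_torus_cell: "measure lebesgue torus_cell = (2 * pi)\<^sup>2"
proof -
  have "measure lebesgue torus_cell = measure lborel (cbox 0 ((\<chi> i. 2 * pi) :: plane))"
    by (simp add: torus_cell_def)
  also have "\<dots> = (\<Prod>i\<in>(UNIV :: 2 set). 2 * pi)"
    by (subst content_cbox_cart) (auto simp: interval_eq_empty_cart not_less)
  finally show ?thesis by (simp add: UNIV_2 power2_eq_square)
qed

lemma measure_torus_space: "measure torus_measure torus_cell = (2 * pi)\<^sup>2"
  by (simp add: measure_restrict_space measure_torus_cell)

lemma axis_zero_right [simp]: "axis i (0::real) = 0"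
  by (simp add: vec_eq_iff axis_def)

lemma periodicD: "periodic f \<Longrightarrow> f (x + axis i (2 * pi)) = f x"
  by (simp add: periodic_def)

text \<open>The shifted cell is cut at \<open>x $ i = 2 * pi\<close>; the part that sticks out is a
  translate by one period of the slab \<open>x $ i \<le> t\<close> missing at the other end.\<close>

lemma integral_torus_shift:
  fixes f :: "plane \<Rightarrow> complex"
  assumes f: "continuous_on UNIV f" and per: "periodic f" and t: "0 \<le> t" "t \<le> 2 * pi"
  shows "integral torus_cell (\<lambda>x. f (x + axis i t)) = integral torus_cell f"
proof -
  define u :: plane where "u = (\<chi> i. 2 * pi) + axis i t"
  have int: "f integrable_on cbox a b" for a b
    by (rule integrable_continuous) (rule continuous_on_subset[OF f], simp)
  have b: "axis i (1::real) \<in> Basis" by simp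
  have ip: "x \<bullet> axis i 1 = x $ i" for x :: plane by (simp add: inner_axis)
  have "integral torus_cell (\<lambda>x. f (x + axis i t)) = integral (cbox (axis i t) u) f"
    using integral_shift_cbox[of "axis i t" "axis i t" u f] by (simp add: torus_cell_def u_def)
  also have "\<dots> = integral (cbox (axis i t) u \<inter> {x. x $ i \<le> 2 * pi}) f
      + integral (cbox (axis i t) u \<inter> {x. x $ i \<ge> 2 * pi}) f"
    using integral_split[OF int b, of "axis i t" u "2 * pi"] by (simp add: ip)
  also have "cbox (axis i t) u \<inter> {x. x $ i \<le> 2 * pi} = torus_cell \<inter> {x. x $ i \<ge> t}"
  proof -
    have "x \<in> cbox (axis i t) u \<inter> {x. x $ i \<le> 2 * pi} \<longleftrightarrow> x \<in> torus_cell \<inter> {x. x $ i \<ge> t}" for x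
    proof -
      have "(\<forall>j. axis i t $ j \<le> x $ j \<and> x $ j \<le> u $ j) \<and> x $ i \<le> 2 * pi \<longleftrightarrow>
        (\<forall>j. 0 \<le> x $ j \<and> x $ j \<le> 2 * pi) \<and> t \<le> x $ i"
        using t exhaust_2[of i] by (elim disjE; simp add: forall_2 u_def axis_def) argo+
      thus ?thesis by (simp add: mem_box_cart mem_torus_cell)
    qed
    thus ?thesis by blast
  qed
  also have "integral (cbox (axis i t) u \<inter> {x. x $ i \<ge> 2 * pi}) f
      = integral (torus_cell \<inter> {x. x $ i \<le> t}) f"
  proof -
    define v :: plane where "v = (\<chi> j. if j = i then t else 2 * pi)"
    have 1: "cbox (axis i t) u \<inter> {x. x $ i \<ge> 2 * pi} = cbox (axis i (2 * pi)) (v + axis i (2 * pi))"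
    proof -
      have "(\<forall>j. axis i t $ j \<le> x $ j \<and> x $ j \<le> u $ j) \<and> 2 * pi \<le> x $ i \<longleftrightarrow>
        (\<forall>j. axis i (2 * pi) $ j \<le> x $ j \<and> x $ j \<le> (v + axis i (2 * pi)) $ j)" for x
        using t exhaust_2[of i] by (elim disjE; simp add: forall_2 u_def v_def axis_def) argo+
      thus ?thesis by (simp only: set_eq_iff Int_iff mem_Collect_eq mem_box_cart simp_thms)
    qed
    have 2: "torus_cell \<inter> {x. x $ i \<le> t} = cbox 0 v"
    proof -
      have "(\<forall>j. 0 \<le> x $ j \<and> x $ j \<le> 2 * pi) \<and> x $ i \<le> t \<longleftrightarrow> (\<forall>j. 0 \<le> x $ j \<and> x $ j \<le> v $ j)" for x :: plane
        using t exhaust_2[of i] by (elim disjE; simp add: forall_2 v_def) argo+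
      thus ?thesis
        by (simp only: set_eq_iff Int_iff mem_Collect_eq mem_box_cart mem_torus_cell zero_index simp_thms)
    qed
    have "integral (cbox (axis i (2 * pi)) (v + axis i (2 * pi))) f
        = integral (cbox 0 v) (\<lambda>x. f (x + axis i (2 * pi)))"
      using integral_shift_cbox[of "axis i (2 * pi)" "axis i (2 * pi)" "v + axis i (2 * pi)" f] by simp
    thus ?thesis unfolding 1 2 by (simp add: periodicD[OF per])
  qed
  also have "integral (torus_cell \<inter> {x. x $ i \<ge> t}) f + integral (torus_cell \<inter> {x. x $ i \<le> t}) f
      = integral torus_cell f"
    using integral_split[OF int b, of 0 "\<chi> i. 2 * pi" t] by (simp add: ip torus_cell_def)
  finally show ?thesis .
qed

text \<open>The mean of \<open>x \<mapsto> f (x + t e\<^sub>i)\<close> over the torus does not depend on \<open>t\<close>; differentiate at \<open>t = 0\<close>.\<close>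

lemma integral_torus_partial:
  fixes f g :: "plane \<Rightarrow> complex"
  assumes d: "\<And>x. ((\<lambda>t. f (x + axis i t)) has_vector_derivative g x) (at 0)"
    and f: "continuous_on UNIV f" and g: "continuous_on UNIV g" and per: "periodic f"
  shows "integral torus_cell g = 0"
proof -
  \<comment> \<open>Invariance is available for shifts between 0 and \<open>2 * pi\<close>, so the
    derivative at 0 is taken one-sidedly, within \<open>U\<close>.\<close>
  define U where "U = {0..2 * pi}"
  have d': "((\<lambda>t. f (x + axis i t)) has_vector_derivative g (x + axis i t)) (at t within U)" for x t
  proof -
    have 1: "((\<lambda>s. s - t) has_vector_derivative 1) (at t)"
      using has_vector_derivative_diff[OF has_vector_derivative_id has_vector_derivative_const]
      by (simp only: diff_zero)
    have "((\<lambda>s. f (x + axis i t + axis i s)) has_vector_derivative g (x + axis i t)) (at (t - t))"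
      using d[of "x + axis i t"] by (simp only: diff_self)
    from vector_diff_chain_at[OF 1 this]
    have "((\<lambda>s. f (x + axis i t + axis i (s - t))) has_vector_derivative g (x + axis i t)) (at t)"
      by (simp only: o_def scaleR_one)
    moreover have "x + axis i t + axis i (s - t) = x + axis i s" for s
      by (simp add: vec_eq_iff axis_def)
    ultimately show ?thesis by (auto intro: has_vector_derivative_at_within)
  qed
  have cont_ax: "continuous_on UNIV (\<lambda>p :: real \<times> plane. snd p + axis i (fst p))"
  proof -
    define e :: plane where "e = axis i 1"
    have "axis i t = t *\<^sub>R e" for t by (simp add: e_def vec_eq_iff axis_def)
    thus ?thesis by (simp add: continuous_intros)
  qed
  have "((\<lambda>t. integral (cbox 0 (\<chi> i. 2 * pi)) (\<lambda>x. f (x + axis i t))) has_vector_derivative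
      integral (cbox 0 (\<chi> i. 2 * pi)) (\<lambda>x. g (x + axis i 0))) (at 0 within U)"
  proof (rule leibniz_rule_vector_derivative)
    show "((\<lambda>t. f (x + axis i t)) has_vector_derivative g (x + axis i t)) (at t within U)" for x t
      by (rule d')
    show "(\<lambda>x. f (x + axis i t)) integrable_on cbox 0 (\<chi> i. 2 * pi)" for t
      by (intro integrable_continuous continuous_on_compose2[OF f]) (auto intro!: continuous_intros)
    show "continuous_on (U \<times> cbox 0 (\<chi> i. 2 * pi)) (\<lambda>(t, x). g (x + axis i t))"
      using continuous_on_compose2[OF g continuous_on_subset[OF cont_ax]]
      by (simp add: case_prod_unfold)
  qed (auto simp: U_def)
  hence 1: "((\<lambda>t. integral torus_cell (\<lambda>x. f (x + axis i t))) has_vector_derivative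
      integral torus_cell g) (at 0 within U)"
    by (simp add: torus_cell_def)
  have "((\<lambda>t. integral torus_cell f) has_vector_derivative integral torus_cell g) (at 0 within U)"
    by (rule has_vector_derivative_transform[OF _ _ 1])
      (auto simp: U_def integral_torus_shift[OF f per])
  moreover have "((\<lambda>t. integral torus_cell f) has_vector_derivative 0) (at 0 within U)"
    by simp
  ultimately show ?thesis
    unfolding U_def
    by (intro vector_derivative_unique_within_closed_interval[of 0 "2 * pi" 0 "\<lambda>t. integral torus_cell f"]) auto
qed


subsection \<open>Smooth periodic functions\<close>

lemma smooth_foldr: "smooth f \<Longrightarrow> smooth (foldr dir_deriv vs f)"
  unfolding smooth_def by (metis foldr_append)

lemma smooth_dir_deriv: "smooth f \<Longrightarrow> smooth (dir_deriv v f)"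
  using smooth_foldr[of f "[v]"] by simp

lemma smooth_differentiable: "smooth f \<Longrightarrow> f differentiable (at x)"
  unfolding smooth_def by (metis foldr_Nil id_apply)

lemma smooth_has_derivative:
  "smooth f \<Longrightarrow> (f has_derivative (\<lambda>v. dir_deriv v f x)) (at x)"
  unfolding dir_deriv_def by (rule frechet_derivative_works[THEN iffD1, OF smooth_differentiable])

lemma smooth_continuous: "smooth f \<Longrightarrow> continuous_on S f"
  by (meson continuous_at_imp_continuous_on differentiable_imp_continuous_within smooth_differentiable)

lemma dir_deriv_eq: "(\<And>x. (f has_derivative f' x) (at x)) \<Longrightarrow> dir_deriv v f = (\<lambda>x. f' x v)"
  unfolding dir_deriv_def using frechet_derivative_at by metis

text \<open>A coinduction principle: smoothness follows from membership in any family of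
  differentiable functions closed under directional derivatives, which avoids formulas for iterated
  derivatives.\<close>

lemma smooth_of_derivs:
  assumes "f \<in> F" "\<And>g v. g \<in> F \<Longrightarrow> (\<forall>x. g differentiable (at x)) \<and> dir_deriv v g \<in> F"
  shows "smooth f"
proof -
  have "foldr dir_deriv vs f \<in> F" for vs
    by (induction vs) (use assms in auto)
  thus ?thesis using assms(2) by (auto simp: smooth_def)
qed

lemma periodic_dir_deriv:
  assumes "smooth f" "periodic f"
  shows "periodic (dir_deriv v f)"
  unfolding periodic_def
proof (intro allI)
  fix x i
  have "((\<lambda>y. f (y + axis i (2 * pi))) has_derivative (\<lambda>v. dir_deriv v f (x + axis i (2 * pi)))) (at x)"
    by (rule has_derivative_compose[OF _ smooth_has_derivative[OF assms(1)], of "\<lambda>y. y + axis i (2 * pi)" "\<lambda>v. v"])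
      (auto intro!: derivative_eq_intros)
  hence "(f has_derivative (\<lambda>v. dir_deriv v f (x + axis i (2 * pi)))) (at x)"
    by (simp add: periodicD[OF assms(2)])
  from has_derivative_unique[OF this smooth_has_derivative[OF assms(1)]]
  show "dir_deriv v f (x + axis i (2 * pi)) = dir_deriv v f x"
    by metis
qed

lemma smooth_of_real:
  fixes f :: "'a::real_normed_vector \<Rightarrow> real"
  assumes "smooth f"
  shows "smooth (\<lambda>x. complex_of_real (f x))"
proof (rule smooth_of_derivs[where F = "{\<lambda>x. complex_of_real (g x) | g. smooth g}"], goal_cases)
  case 1
  thus ?case using assms by blast
next
  case (2 g v)
  then obtain h where h: "smooth h" "g = (\<lambda>x. complex_of_real (h x))" by blast
  have d: "(g has_derivative (\<lambda>w. complex_of_real (dir_deriv w h x))) (at x)" for x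
    unfolding h(2) by (intro has_derivative_of_real smooth_has_derivative h(1))
  have "dir_deriv v g = (\<lambda>x. complex_of_real (dir_deriv v h x))"
    by (rule dir_deriv_eq[OF d])
  thus ?case using d smooth_dir_deriv[OF h(1)] by (auto simp: differentiable_def)
qed

lemma dir_deriv_of_real:
  fixes f :: "'a::real_normed_vector \<Rightarrow> real"
  assumes "smooth f"
  shows "dir_deriv v (\<lambda>x. complex_of_real (f x)) = (\<lambda>x. complex_of_real (dir_deriv v f x))"
  by (rule dir_deriv_eq) (intro has_derivative_of_real smooth_has_derivative assms)

lemma periodic_int: "periodic f \<Longrightarrow> f (x + axis i (2 * pi * of_int k)) = f x"
proof (induction k arbitrary: x rule: int_induct[where k = 0])
  case (step1 k)
  have "x + axis i (2 * pi * of_int (k + 1)) = x + axis i (2 * pi * of_int k) + axis i (2 * pi)"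
    by (simp add: vec_eq_iff axis_def algebra_simps)
  hence "f (x + axis i (2 * pi * of_int (k + 1))) = f (x + axis i (2 * pi * of_int k))"
    by (simp only: periodicD[OF step1.prems])
  thus ?case by (simp only: step1.IH[OF step1.prems])
next
  case (step2 k)
  have "x + axis i (2 * pi * of_int k) = x + axis i (2 * pi * of_int (k - 1)) + axis i (2 * pi)"
    by (simp add: vec_eq_iff axis_def algebra_simps)
  hence "f (x + axis i (2 * pi * of_int k)) = f (x + axis i (2 * pi * of_int (k - 1)))"
    by (simp only: periodicD[OF step2.prems])
  thus ?case by (simp only: step2.IH[OF step2.prems])
qed simp

lemma periodic_reduce:
  obtains y where "y \<in> torus_cell" "\<And>f. periodic f \<Longrightarrow> f y = f x"
proof -
  define k where "k i = - \<lfloor>x $ i / (2 * pi)\<rfloor>" for i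
  define y where "y = x + axis 1 (2 * pi * of_int (k 1)) + axis 2 (2 * pi * of_int (k 2))"
  have y: "y $ i = x $ i + 2 * pi * of_int (k i)" for i
    using exhaust_2[of i] by (auto simp: y_def axis_def)
  have "0 \<le> y $ i \<and> y $ i \<le> 2 * pi" for i
  proof -
    define z where "z = x $ i / (2 * pi)"
    have "y $ i = 2 * pi * (z - of_int \<lfloor>z\<rfloor>)"
      by (simp add: y k_def z_def algebra_simps)
    moreover have "0 \<le> z - of_int \<lfloor>z\<rfloor>" "z - of_int \<lfloor>z\<rfloor> \<le> 1"
      by linarith+
    ultimately show ?thesis by (simp add: mult_left_le)
  qed
  hence "y \<in> torus_cell" by (simp add: mem_torus_cell)
  moreover have "f y = f x" if "periodic f" for f :: "plane \<Rightarrow> 'b"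
    unfolding y_def periodic_int[OF that] ..
  ultimately show ?thesis using that by blast
qed

lemma periodic_bounded:
  fixes f :: "plane \<Rightarrow> 'b::real_normed_vector"
  assumes "periodic f" "continuous_on UNIV f"
  obtains B where "0 \<le> B" "\<And>x. norm (f x) \<le> B"
proof -
  have "compact (f ` torus_cell)"
    by (intro compact_continuous_image continuous_on_subset[OF assms(2)] compact_torus_cell) simp
  then obtain B where B: "\<And>y. y \<in> torus_cell \<Longrightarrow> norm (f y) \<le> B"
    using compact_imp_bounded[of "f ` torus_cell"] unfolding bounded_iff by auto
  have "norm (f x) \<le> B" for x
    using periodic_reduce[of x] B assms(1) by metis
  moreover have "0 \<le> B" using calculation[of 0] norm_ge_zero order_trans by blast
  ultimately show ?thesis using that by blast
qed


subsection \<open>Fourier coefficients\<close>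

definition ev :: "int^2 \<Rightarrow> plane \<Rightarrow> complex" where
  "ev n x = cis (freq n \<bullet> x)"

text \<open>The complex-valued version of \<open>fourier_coeff\<close>, for exponentials and for
  symbols at a fixed frequency.\<close>

definition fc :: "(plane \<Rightarrow> complex) \<Rightarrow> int^2 \<Rightarrow> complex" where
  "fc g n = (LINT x|torus_measure. ev (- n) x * g x) / (2 * pi)\<^sup>2"

lemma fourier_coeff_eq_fc: "fourier_coeff f n = fc (\<lambda>x. complex_of_real (f x)) n"
  by (simp add: fourier_coeff_def fc_def ev_def freq_minus)

lemma norm_ev [simp]: "cmod (ev n x) = 1"
  by (simp add: ev_def)

lemma ev_add: "ev (m + n) x = ev m x * ev n x"
  by (simp add: ev_def freq_add inner_add_left cis_mult)

lemma ev_minus: "ev (- n) x = cnj (ev n x)"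
  by (simp add: ev_def freq_minus cis_cnj)

lemma ev_zero [simp]: "ev 0 x = 1"
  by (simp add: ev_def)

lemma periodic_ev: "periodic (ev n)"
  unfolding periodic_def
proof (intro allI)
  fix x i
  have "freq n \<bullet> (x + axis i (2 * pi)) = freq n \<bullet> x + 2 * pi * of_int (n $ i)"
    by (simp add: inner_add_right inner_axis)
  thus "ev n (x + axis i (2 * pi)) = ev n x"
    by (simp add: ev_def cis_mult[symmetric] del: cis_mult)
qed

lemma ev_has_derivative: "(ev n has_derivative (\<lambda>v. \<i> * of_real (freq n \<bullet> v) * ev n x)) (at x)"
proof -
  have "((\<lambda>x. \<i> * of_real (freq n \<bullet> x)) has_derivative (\<lambda>v. \<i> * of_real (freq n \<bullet> v))) (at x)"
    by (intro has_derivative_mult_right has_derivative_of_real has_derivative_inner_right has_derivative_ident)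
  from has_derivative_compose[OF this DERIV_exp[unfolded has_field_derivative_def]]
  show ?thesis unfolding ev_def cis_conv_exp by (simp add: mult_ac)
qed

lemma continuous_ev [continuous_intros]: "continuous_on S (ev n)"
  using ev_has_derivative has_derivative_continuous by (blast intro: continuous_at_imp_continuous_on)

lemma fc_bound:
  assumes "continuous_on UNIV g" "\<And>x. cmod (g x) \<le> B"
  shows "cmod (fc g n) \<le> B"
proof -
  have "cmod (LINT x|torus_measure. ev (- n) x * g x) \<le> (LINT x|torus_measure. B)"
    by (intro Bochner_Integration.integral_norm_bound_integral integrable_torus continuous_intros assms(1))
      (use assms(2) in \<open>auto simp: norm_mult\<close>)
  also have "\<dots> = B * (2 * pi)\<^sup>2"
    using measure_torus_space by simp
  finally show ?thesis
    by (simp add: fc_def norm_divide norm_power norm_mult pos_divide_le_eq)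
qed

text \<open>Integration by parts: the partial derivative of \<open>ev (- n) x * g x\<close> has mean
  zero over the torus.\<close>

lemma fc_partial:
  assumes "smooth g" "periodic g"
  shows "fc (dir_deriv (axis i 1) g) n = \<i> * of_int (n $ i) * fc g n"
proof -
  let ?G = "dir_deriv (axis i 1) g"
  have cont: "continuous_on UNIV g" "continuous_on UNIV ?G"
    using assms smooth_continuous smooth_dir_deriv by blast+
  define e :: plane where "e = axis i 1"
  have ax: "axis i t = t *\<^sub>R e" for t by (simp add: e_def vec_eq_iff axis_def)
  have "integral torus_cell (\<lambda>x. ev (- n) x * ?G x - \<i> * of_int (n $ i) * (ev (- n) x * g x)) = 0"
  proof (rule integral_torus_partial[where f = "\<lambda>x. ev (- n) x * g x" and i = i])
    fix x
    have "((\<lambda>x. ev (- n) x * g x) has_derivative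
        (\<lambda>v. ev (- n) x * dir_deriv v g x + \<i> * of_real (freq (- n) \<bullet> v) * ev (- n) x * g x)) (at x)"
      by (intro has_derivative_mult ev_has_derivative smooth_has_derivative assms)
    hence "((\<lambda>x. ev (- n) x * g x) has_derivative
        (\<lambda>v. ev (- n) x * dir_deriv v g x + \<i> * of_real (freq (- n) \<bullet> v) * ev (- n) x * g x)) (at (x + axis i 0))"
      by simp
    note * = this
    have "((\<lambda>t. x + axis i t) has_derivative (\<lambda>t. axis i t)) (at 0)"
      unfolding ax by (auto intro!: derivative_eq_intros)
    from has_derivative_compose[where x = 0 and g = "\<lambda>x. ev (- n) x * g x", OF this *]
    have "((\<lambda>t. ev (- n) (x + axis i t) * g (x + axis i t)) has_derivative
        (\<lambda>t. ev (- n) x * dir_deriv (axis i t) g x + \<i> * of_real (freq (- n) \<bullet> axis i t) * ev (- n) x * g x)) (at 0)" .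
    moreover have "ev (- n) x * dir_deriv (axis i t) g x + \<i> * of_real (freq (- n) \<bullet> axis i t) * ev (- n) x * g x
        = t *\<^sub>R (ev (- n) x * ?G x - \<i> * of_int (n $ i) * (ev (- n) x * g x))" for t
    proof -
      have "dir_deriv (t *\<^sub>R e) g x = t *\<^sub>R dir_deriv e g x"
        by (rule linear_simps(5)[OF has_derivative_bounded_linear[OF smooth_has_derivative[OF assms(1)]]])
      hence "dir_deriv (axis i t) g x = of_real t * ?G x"
        unfolding ax[of t] e_def[symmetric] scaleR_conv_of_real[where 'a = complex] .
      moreover have "freq (- n) \<bullet> axis i t = - (of_int (n $ i) * t)"
        by (simp add: inner_axis freq_minus)
      ultimately show ?thesis
        by (simp add: scaleR_conv_of_real algebra_simps)
    qed
    ultimately show "((\<lambda>t. ev (- n) (x + axis i t) * g (x + axis i t)) has_vector_derivative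
        ev (- n) x * ?G x - \<i> * of_int (n $ i) * (ev (- n) x * g x)) (at 0)"
      unfolding has_vector_derivative_def by (simp only:)
  next
    show "periodic (\<lambda>x. ev (- n) x * g x)"
      using periodic_ev[of "- n"] assms(2) by (simp add: periodic_def)
  qed (auto intro!: continuous_intros cont)
  moreover have "integrable torus_measure (\<lambda>x. ev (- n) x * ?G x)"
    "integrable torus_measure (\<lambda>x. ev (- n) x * g x)"
    by (intro integrable_torus continuous_intros cont)+
  ultimately have "(LINT x|torus_measure. ev (- n) x * ?G x)
      - \<i> * of_int (n $ i) * (LINT x|torus_measure. ev (- n) x * g x) = 0"
    using integral_torus[of "\<lambda>x. ev (- n) x * ?G x - \<i> * of_int (n $ i) * (ev (- n) x * g x)"]
    by (simp add: continuous_intros cont)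
  thus ?thesis by (simp add: fc_def)
qed

lemma fc_partials:
  assumes "smooth g" "periodic g"
  shows "fc (foldr dir_deriv (replicate N (axis i 1)) g) n = (\<i> * of_int (n $ i)) ^ N * fc g n"
    and "periodic (foldr dir_deriv (replicate N (axis i 1)) g)"
proof (induction N)
  case (Suc N)
  case 1
  show ?case using fc_partial[OF smooth_foldr[OF assms(1)] Suc(2)] Suc(1) by simp
next
  case (Suc N)
  case 2
  show ?case using periodic_dir_deriv[OF smooth_foldr[OF assms(1)] Suc(2)] by simp
qed (use assms in auto)

lemma wt_power_le: "wt n ^ N \<le> 3 ^ N * (1 + \<bar>real_of_int (n $ 1)\<bar> ^ N + \<bar>real_of_int (n $ 2)\<bar> ^ N)"
proof -
  define a b where "a = \<bar>real_of_int (n $ 1)\<bar>" and "b = \<bar>real_of_int (n $ 2)\<bar>"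
  define m where "m = max 1 (max a b)"
  have "wt n \<le> 1 + a + b"
    using norm_le_l1_cart[of "freq n"] by (simp add: wt_def a_def b_def sum_2)
  also have "\<dots> \<le> 3 * m" by (auto simp: m_def)
  finally have "wt n ^ N \<le> (3 * m) ^ N" by (intro power_mono) auto
  also have "\<dots> = 3 ^ N * m ^ N" by (rule power_mult_distrib)
  also have "m ^ N \<le> 1 + a ^ N + b ^ N"
    by (auto simp: m_def max_def a_def b_def)
  finally show ?thesis by (simp add: a_def b_def)
qed

text \<open>\<open>N\<close> derivatives in the single direction \<open>i\<close> give the factor
  \<open>\<bar>n $ i\<bar> ^ N\<close>, and these powers control \<open>wt n ^ N\<close>. The
  constants are explicit because in \<open>sig_bound\<close> they depend on \<xi>.\<close>

lemma fc_decay: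
  assumes g: "smooth g" "periodic g" and B: "\<And>x. cmod (g x) \<le> B"
    and D: "\<And>x i. cmod (foldr dir_deriv (replicate N (axis i 1)) g x) \<le> D"
  shows "cmod (fc g n) * wt n ^ N \<le> 3 ^ N * (B + 2 * D)"
proof -
  have "cmod (fc g n) * \<bar>real_of_int (n $ i)\<bar> ^ N \<le> D" for i
  proof -
    have "cmod (fc g n) * \<bar>real_of_int (n $ i)\<bar> ^ N = cmod (fc (foldr dir_deriv (replicate N (axis i 1)) g) n)"
      unfolding fc_partials(1)[OF g] by (simp add: norm_mult norm_power)
    also have "\<dots> \<le> D"
      by (intro fc_bound D smooth_continuous smooth_foldr g)
    finally show ?thesis .
  qed
  moreover have "cmod (fc g n) \<le> B" by (intro fc_bound B smooth_continuous g)
  ultimately have "cmod (fc g n) * 1 + cmod (fc g n) * \<bar>real_of_int (n $ 1)\<bar> ^ N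
      + cmod (fc g n) * \<bar>real_of_int (n $ 2)\<bar> ^ N \<le> B + D + D"
    by (intro add_mono) simp_all
  hence "cmod (fc g n) * (1 + \<bar>real_of_int (n $ 1)\<bar> ^ N + \<bar>real_of_int (n $ 2)\<bar> ^ N) \<le> B + 2 * D"
    by (simp add: distrib_left)
  from mult_left_mono[OF this, of "3 ^ N"] mult_left_mono[OF wt_power_le[of n N], of "cmod (fc g n)"]
  show ?thesis by (simp add: algebra_simps)
qed

lemma rapid_fc:
  assumes "smooth g" "periodic g"
  shows "rapid (fc g)"
  unfolding rapid_def
proof
  fix N
  obtain B where B: "\<And>x. cmod (g x) \<le> B"
    using periodic_bounded[OF assms(2) smooth_continuous[OF assms(1)]] by blast
  have "\<exists>D. \<forall>x. cmod (foldr dir_deriv (replicate N (axis i 1)) g x) \<le> D" for i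
    using periodic_bounded[OF fc_partials(2)[OF assms] smooth_continuous[OF smooth_foldr[OF assms(1)]]]
    by metis
  then obtain D where D: "\<And>i x. cmod (foldr dir_deriv (replicate N (axis i 1)) g x) \<le> D i"
    by metis
  have "cmod (foldr dir_deriv (replicate N (axis i 1)) g x) \<le> max (D 1) (D 2)" for i x
    using D[of i x] exhaust_2[of i] by auto
  from fc_decay[OF assms B this] show "\<exists>A. \<forall>p. cmod (fc g p) * wt p ^ N \<le> A" by blast
qed

lemma smooth_torus_of_real:
  assumes "f \<in> smooth_torus"
  shows "smooth (\<lambda>x. complex_of_real (f x))" "periodic (\<lambda>x. complex_of_real (f x))"
  using assms by (auto simp: smooth_torus_def periodic_def intro: smooth_of_real)

lemma rapid_fourier_coeff: "f \<in> smooth_torus \<Longrightarrow> rapid (fourier_coeff f)"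
  using rapid_fc[OF smooth_torus_of_real] by (simp add: fourier_coeff_eq_fc[abs_def])

lemma fourier_coeff_minus: "fourier_coeff f (- n) = cnj (fourier_coeff f n)"
  unfolding fourier_coeff_eq_fc fc_def complex_cnj_divide Bochner_Integration.integral_cnj[symmetric]
  by (simp add: ev_minus)

lemma fourier_coeff_partial:
  assumes "f \<in> smooth_torus"
  shows "fourier_coeff (dir_deriv (axis i 1) f) n = \<i> * of_int (n $ i) * fourier_coeff f n"
  using fc_partial[OF smooth_torus_of_real[OF assms]] assms
  by (simp add: fourier_coeff_eq_fc dir_deriv_of_real smooth_torus_def)

lemma dir_deriv_smooth_torus: "f \<in> smooth_torus \<Longrightarrow> dir_deriv v f \<in> smooth_torus"
  by (simp add: smooth_torus_def smooth_dir_deriv periodic_dir_deriv)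

section \<open>Square-integrable functions on the torus\<close>

lemma measurable_torus: "f \<in> borel_measurable lebesgue \<Longrightarrow> f \<in> borel_measurable torus_measure"
  by (rule measurable_restrict_space1)

lemma L2_torusD:
  assumes "f \<in> L2_torus"
  shows "periodic f" "f \<in> borel_measurable lebesgue" "f \<in> borel_measurable torus_measure"
    "integrable torus_measure (\<lambda>x. (f x)\<^sup>2)"
  using assms by (auto simp: L2_torus_def measurable_torus)

lemma integrable_torus_const [simp]: "integrable torus_measure (\<lambda>x. c :: real)"
  by (rule integrable_torus) simp

lemma L2_torus_integrable_mult:
  assumes "f \<in> L2_torus" "g \<in> L2_torus"
  shows "integrable torus_measure (\<lambda>x. f x * g x)"
proof (rule Bochner_Integration.integrable_bound)
  show "integrable torus_measure (\<lambda>x. (f x)\<^sup>2 + (g x)\<^sup>2)"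
    using assms by (intro Bochner_Integration.integrable_add L2_torusD)
  show "(\<lambda>x. f x * g x) \<in> borel_measurable torus_measure"
    using L2_torusD(3)[OF assms(1)] L2_torusD(3)[OF assms(2)] by simp
  have "\<bar>a * b\<bar> \<le> a\<^sup>2 + b\<^sup>2" for a b :: real
  proof -
    have "2 * (\<bar>a\<bar> * \<bar>b\<bar>) \<le> a\<^sup>2 + b\<^sup>2"
      using sum_squares_bound[of "\<bar>a\<bar>" "\<bar>b\<bar>"] by simp
    moreover have "0 \<le> \<bar>a\<bar> * \<bar>b\<bar>" by simp
    ultimately show ?thesis unfolding abs_mult by linarith
  qed
  thus "AE x in torus_measure. norm (f x * g x) \<le> norm ((f x)\<^sup>2 + (g x)\<^sup>2)"
    by simp
qed

lemma L2_torus_integrable: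
  assumes "f \<in> L2_torus"
  shows "integrable torus_measure f"
proof (rule Bochner_Integration.integrable_bound)
  show "integrable torus_measure (\<lambda>x. 1 + (f x)\<^sup>2)"
    using assms by (intro Bochner_Integration.integrable_add L2_torusD) simp_all
  show "f \<in> borel_measurable torus_measure" by (rule L2_torusD[OF assms])
  have "\<bar>a\<bar> \<le> 1 + a\<^sup>2" for a :: real
    using sum_squares_bound[of "\<bar>a\<bar>" 1] zero_le_power2[of a] abs_ge_zero[of a]
    unfolding power2_abs power_one mult_1_right by linarith
  thus "AE x in torus_measure. norm (f x) \<le> norm (1 + (f x)\<^sup>2)" by simp
qed

lemma L2_torus_lincomb:
  assumes "f \<in> L2_torus" "g \<in> L2_torus"
  shows "(\<lambda>x. a * f x + b * g x) \<in> L2_torus"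
proof -
  have "integrable torus_measure (\<lambda>x. a\<^sup>2 * (f x)\<^sup>2 + 2 * a * b * (f x * g x) + b\<^sup>2 * (g x)\<^sup>2)"
    using assms
    by (intro Bochner_Integration.integrable_add integrable_mult_right L2_torusD L2_torus_integrable_mult) auto
  moreover have "(\<lambda>x. (a * f x + b * g x)\<^sup>2)
      = (\<lambda>x. a\<^sup>2 * (f x)\<^sup>2 + 2 * a * b * (f x * g x) + b\<^sup>2 * (g x)\<^sup>2)"
    by (simp add: fun_eq_iff power2_eq_square algebra_simps)
  ultimately show ?thesis
    using L2_torusD(1,2)[OF assms(1)] L2_torusD(1,2)[OF assms(2)]
    by (simp add: L2_torus_def periodic_def)
qed

lemma L2_torus_add: "f \<in> L2_torus \<Longrightarrow> g \<in> L2_torus \<Longrightarrow> (\<lambda>x. f x + g x) \<in> L2_torus"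
  using L2_torus_lincomb[of f g 1 1] by simp

lemma L2_torus_diff: "f \<in> L2_torus \<Longrightarrow> g \<in> L2_torus \<Longrightarrow> (\<lambda>x. f x - g x) \<in> L2_torus"
  using L2_torus_lincomb[of f g 1 "-1"] by simp

lemma borel_measurable_continuous_lebesgue:
  fixes f :: "plane \<Rightarrow> 'b::{real_normed_vector, second_countable_topology}"
  assumes "continuous_on UNIV f"
  shows "f \<in> borel_measurable lebesgue"
  using borel_measurable_continuous_onI[OF assms] by (simp add: measurable_completion)

lemma L2_torus_continuous:
  assumes "continuous_on UNIV f" "periodic f"
  shows "f \<in> L2_torus"
  unfolding L2_torus_def using assms
  by (auto intro!: borel_measurable_continuous_lebesgue integrable_torus continuous_intros)

lemma L2_torus_mult:
  assumes "b \<in> smooth_torus" "f \<in> L2_torus"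
  shows "(\<lambda>x. b x * f x) \<in> L2_torus"
proof -
  have b: "continuous_on UNIV b" "periodic b"
    using assms(1) by (auto simp: smooth_torus_def smooth_continuous)
  obtain B where B: "0 \<le> B" "\<And>x. norm (b x) \<le> B"
    using periodic_bounded[OF b(2,1)] by blast
  have m: "(\<lambda>x. b x * f x) \<in> borel_measurable lebesgue"
    using borel_measurable_continuous_lebesgue[OF b(1)] L2_torusD(2)[OF assms(2)] by simp
  have "integrable torus_measure (\<lambda>x. (b x * f x)\<^sup>2)"
  proof (rule Bochner_Integration.integrable_bound)
    show "integrable torus_measure (\<lambda>x. B\<^sup>2 * (f x)\<^sup>2)"
      by (intro integrable_mult_right L2_torusD assms)
    show "(\<lambda>x. (b x * f x)\<^sup>2) \<in> borel_measurable torus_measure"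
      using measurable_torus[OF m] by simp
    have "(b x)\<^sup>2 \<le> B\<^sup>2" for x
      using power_mono[OF B(2)[of x], of 2] by simp
    thus "AE x in torus_measure. norm ((b x * f x)\<^sup>2) \<le> norm (B\<^sup>2 * (f x)\<^sup>2)"
      by (simp add: power_mult_distrib mult_right_mono)
  qed
  thus ?thesis
    using m b(2) L2_torusD(1)[OF assms(2)] by (auto simp: L2_torus_def periodic_def)
qed

lemma smooth_torus_L2: "f \<in> smooth_torus \<Longrightarrow> f \<in> L2_torus"
  by (intro L2_torus_continuous) (auto simp: smooth_torus_def smooth_continuous)


subsection \<open>Term-by-term integration\<close>

lemma infinite_int2: "infinite (UNIV :: (int^2) set)"
proof
  assume "finite (UNIV :: (int^2) set)"
  hence "finite ((\<lambda>n :: int^2. n $ 1) ` UNIV)" by (rule finite_imageI)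
  moreover have "(\<lambda>n :: int^2. n $ 1) ` UNIV = UNIV"
    by (auto intro!: image_eqI[of _ _ "\<chi> i. x" for x])
  ultimately show False by simp
qed

text \<open>Dominated convergence for the partial sums along an enumeration of the lattice. The
  integrals are absolutely summable, which makes the result independent of the enumeration.\<close>

lemma has_sum_integral:
  fixes F :: "int^2 \<Rightarrow> plane \<Rightarrow> complex"
  assumes F: "\<And>n. integrable torus_measure (F n)" and c: "c summable_on UNIV" and G: "integrable torus_measure G"
    and bound: "\<And>n x. cmod (F n x) \<le> c n * G x"
    and sum: "\<And>x. ((\<lambda>n. F n x) has_sum f x) UNIV"
  shows "integrable torus_measure f"
    and "((\<lambda>n. LINT x|torus_measure. F n x) has_sum (LINT x|torus_measure. f x)) UNIV"
proof -
  define e where "e = from_nat_into (UNIV :: (int^2) set)"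
  have e: "bij_betw e UNIV UNIV"
    unfolding e_def by (rule bij_betw_from_nat_into) (auto simp: infinite_int2)
  have "(\<lambda>n. \<bar>c n\<bar>) summable_on UNIV"
    using iffD1[OF summable_on_iff_abs_summable_on_real c] by (simp only: real_norm_def)
  hence cs: "(\<lambda>k. \<bar>c (e k)\<bar>) summable_on UNIV"
    using summable_on_reindex_bij_betw[OF e, of "\<lambda>n. \<bar>c n\<bar>"] by (simp only:)
  have bound': "cmod (F n x) \<le> \<bar>c n\<bar> * \<bar>G x\<bar>" for n x
    using bound[of n x] by (metis abs_ge_self abs_mult order_trans)
  define w where "w x = (\<Sum>\<^sub>\<infinity>k. \<bar>c (e k)\<bar>) * \<bar>G x\<bar>" for x
  have w: "integrable torus_measure w"
    unfolding w_def by (intro integrable_mult_right integrable_abs G)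
  have part: "(\<lambda>N. \<Sum>k<N. F (e k) x) \<longlonglongrightarrow> f x" for x
    using has_sum_imp_sums[of "\<lambda>k. F (e k) x"] sum[of x]
      has_sum_reindex_bij_betw[OF e, where f = "\<lambda>n. F n x" and S = "f x"] by (simp add: sums_def)
  have m: "(\<lambda>x. \<Sum>k<N. F (e k) x) \<in> borel_measurable torus_measure" for N
    using F by (intro borel_measurable_sum borel_measurable_integrable)
  have fm: "f \<in> borel_measurable torus_measure"
    by (rule borel_measurable_LIMSEQ_metric[OF m part])
  have le: "cmod (\<Sum>k<N. F (e k) x) \<le> w x" for N x
  proof -
    have "cmod (\<Sum>k<N. F (e k) x) \<le> (\<Sum>k<N. \<bar>c (e k)\<bar> * \<bar>G x\<bar>)"
      by (rule sum_norm_le) (rule bound')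
    also have "\<dots> = (\<Sum>k<N. \<bar>c (e k)\<bar>) * \<bar>G x\<bar>" by (rule sum_distrib_right[symmetric])
    also have "\<dots> \<le> w x"
      unfolding w_def by (intro mult_right_mono finite_sum_le_infsum cs) auto
    finally show ?thesis .
  qed
  show "integrable torus_measure f"
    by (rule integrable_dominated_convergence[where s = "\<lambda>N x. \<Sum>k<N. F (e k) x", OF fm m w])
      (use part le in auto)
  have "(\<lambda>N. LINT x|torus_measure. (\<Sum>k<N. F (e k) x)) \<longlonglongrightarrow> (LINT x|torus_measure. f x)"
    by (rule integral_dominated_convergence[where s = "\<lambda>N x. \<Sum>k<N. F (e k) x", OF fm m w])
      (use part le in auto)
  hence "(\<lambda>k. LINT x|torus_measure. F (e k) x) sums (LINT x|torus_measure. f x)"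
    by (simp add: sums_def Bochner_Integration.integral_sum F)
  moreover have "summable (\<lambda>k. cmod (LINT x|torus_measure. F (e k) x))"
  proof (rule summable_comparison_test')
    show "summable (\<lambda>k. \<bar>c (e k)\<bar> * (LINT x|torus_measure. \<bar>G x\<bar>))"
      by (intro summable_mult2 summable_on_imp_summable cs)
    have "cmod (LINT x|torus_measure. F (e k) x) \<le> (LINT x|torus_measure. \<bar>c (e k)\<bar> * \<bar>G x\<bar>)" for k
      by (intro Bochner_Integration.integral_norm_bound_integral F integrable_mult_right integrable_abs G)
        (rule bound')
    thus "norm (cmod (LINT x|torus_measure. F (e k) x)) \<le> \<bar>c (e k)\<bar> * (LINT x|torus_measure. \<bar>G x\<bar>)"
      if "k \<ge> 0" for k by simp
  qed
  ultimately have "((\<lambda>k. LINT x|torus_measure. F (e k) x) has_sum (LINT x|torus_measure. f x)) UNIV"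
    by (intro norm_summable_imp_has_sum)
  thus "((\<lambda>n. LINT x|torus_measure. F n x) has_sum (LINT x|torus_measure. f x)) UNIV"
    using has_sum_reindex_bij_betw[OF e, where f = "\<lambda>n. LINT x|torus_measure. F n x"] by simp
qed


subsection \<open>Orthogonality\<close>

lemma smooth_ev: "smooth (ev n)"
proof (rule smooth_of_derivs[where F = "{\<lambda>x. c * ev n x | c. True}"], goal_cases)
  case 1
  show ?case by (auto intro: exI[of _ 1])
next
  case (2 g v)
  then obtain c where g: "g = (\<lambda>x. c * ev n x)" by blast
  have d: "(g has_derivative (\<lambda>v. c * (\<i> * of_real (freq n \<bullet> v) * ev n x))) (at x)" for x
    unfolding g by (intro has_derivative_mult_right ev_has_derivative)
  have "dir_deriv v g = (\<lambda>x. (c * (\<i> * of_real (freq n \<bullet> v))) * ev n x)"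
    by (subst dir_deriv_eq[OF d]) (simp add: mult.assoc)
  thus ?case using d by (auto simp: differentiable_def)
qed

text \<open>For distinct frequencies no integral is computed: \<open>ev n\<close> is an
  eigenfunction of the partial derivative with eigenvalue \<open>\<i> * n $ i\<close>, while
  integration by parts produces \<open>\<i> * m $ i\<close>.\<close>

lemma fc_ev: "fc (ev n) m = (if m = n then 1 else 0)"
proof (cases "m = n")
  case True
  have "fc (ev n) n = (LINT x|torus_measure. (1::complex)) / (2 * pi)\<^sup>2"
    unfolding fc_def by (simp flip: ev_add)
  also have "(LINT x|torus_measure. (1::complex)) = (2 * pi)\<^sup>2"
    using measure_torus_space by (simp add: scaleR_conv_of_real)
  finally show ?thesis using True by simp
next
  case False
  then obtain i where i: "m $ i \<noteq> n $ i" by (auto simp: vec_eq_iff)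
  have "dir_deriv (axis i 1) (ev n) = (\<lambda>x. (\<i> * of_int (n $ i)) * ev n x)"
    by (subst dir_deriv_eq[OF ev_has_derivative]) (simp add: inner_axis)
  hence "fc (\<lambda>x. (\<i> * of_int (n $ i)) * ev n x) m = \<i> * of_int (m $ i) * fc (ev n) m"
    using fc_partial[OF smooth_ev periodic_ev, of i n m] by simp
  moreover have "fc (\<lambda>x. (\<i> * of_int (n $ i)) * ev n x) m = \<i> * of_int (n $ i) * fc (ev n) m"
    by (simp add: fc_def mult.left_commute[of "ev _ _"])
  ultimately have "\<i> * of_int (n $ i) * fc (ev n) m = \<i> * of_int (m $ i) * fc (ev n) m" by simp
  thus ?thesis using i False by auto
qed

definition tp :: "(int^2) set \<Rightarrow> (int^2 \<Rightarrow> complex) \<Rightarrow> plane \<Rightarrow> complex" where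
  "tp F c x = (\<Sum>n\<in>F. c n * ev n x)"

lemma continuous_tp [continuous_intros]: "continuous_on S (tp F c)"
  unfolding tp_def[abs_def] by (intro continuous_intros)

lemma periodic_tp: "periodic (tp F c)"
  using periodic_ev by (simp add: periodic_def tp_def)

lemma integral_tp_mult:
  assumes "finite F" "integrable torus_measure h"
  shows "(LINT x|torus_measure. tp F c x * h x) = (2 * pi)\<^sup>2 * (\<Sum>n\<in>F. c n * fc h (- n))"
proof -
  have I: "integrable torus_measure (\<lambda>x. c n * (ev n x * h x))" for n
  proof (rule integrable_mult_right, rule Bochner_Integration.integrable_bound[OF assms(2)])
    show "(\<lambda>x. ev n x * h x) \<in> borel_measurable torus_measure"
      using borel_measurable_integrable[OF assms(2)]
        measurable_torus[OF borel_measurable_continuous_lebesgue[OF continuous_ev]] by simp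
  qed (simp add: norm_mult)
  have "(LINT x|torus_measure. tp F c x * h x) = (LINT x|torus_measure. (\<Sum>n\<in>F. c n * (ev n x * h x)))"
    by (simp add: tp_def sum_distrib_right mult.assoc)
  also have "\<dots> = (\<Sum>n\<in>F. LINT x|torus_measure. c n * (ev n x * h x))"
    by (intro Bochner_Integration.integral_sum I)
  also have "\<dots> = (\<Sum>n\<in>F. c n * ((2 * pi)\<^sup>2 * fc h (- n)))"
    by (simp add: fc_def)
  finally show ?thesis by (simp add: sum_distrib_left mult_ac)
qed

lemma fc_tp:
  assumes "finite F"
  shows "fc (tp F c) m = (if m \<in> F then c m else 0)"
proof -
  have "fc (tp F c) m = (LINT x|torus_measure. tp F c x * ev (- m) x) / (2 * pi)\<^sup>2"
    by (simp add: fc_def mult.commute)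
  also have "\<dots> = (\<Sum>n\<in>F. c n * fc (ev (- m)) (- n))"
    by (subst integral_tp_mult[OF assms]) (auto intro!: integrable_torus continuous_intros)
  also have "\<dots> = (if m \<in> F then c m else 0)"
    using assms by (simp add: fc_ev if_distrib sum.delta cong: if_cong)
  finally show ?thesis .
qed

lemma fc_cnj: "fc (\<lambda>x. cnj (h x)) n = cnj (fc h (- n))"
  unfolding fc_def complex_cnj_divide Bochner_Integration.integral_cnj[symmetric]
  by (simp add: ev_minus)

lemma integral_norm_tp:
  assumes "finite F"
  shows "(LINT x|torus_measure. (cmod (tp F c x))\<^sup>2) = (2 * pi)\<^sup>2 * (\<Sum>n\<in>F. (cmod (c n))\<^sup>2)"
proof -
  have "complex_of_real (LINT x|torus_measure. (cmod (tp F c x))\<^sup>2)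
      = (LINT x|torus_measure. tp F c x * cnj (tp F c x))"
    by (simp only: integral_complex_of_real[symmetric] complex_norm_square)
  also have "\<dots> = (2 * pi)\<^sup>2 * (\<Sum>n\<in>F. c n * cnj (c n))"
    by (subst integral_tp_mult[OF assms])
      (auto intro!: integrable_torus continuous_intros simp: fc_cnj fc_tp[OF assms])
  also have "\<dots> = complex_of_real ((2 * pi)\<^sup>2 * (\<Sum>n\<in>F. (cmod (c n))\<^sup>2))"
    by (simp only: of_real_mult of_real_sum complex_norm_square)
  finally show ?thesis using of_real_eq_iff by blast
qed

text \<open>Expansion of the nonnegative squared distance between \<open>f\<close> and its own
  Fourier partial sum over \<open>F\<close>.\<close>

lemma bessel_inequality:
  assumes f: "f \<in> L2_torus" and F: "finite F"
  shows "(2 * pi)\<^sup>2 * (\<Sum>n\<in>F. (cmod (fourier_coeff f n))\<^sup>2) \<le> L2_inner f f"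
proof -
  define c where "c = fourier_coeff f"
  have fi: "integrable torus_measure (\<lambda>x. complex_of_real (f x))"
    using L2_torus_integrable[OF f] by simp
  have I1: "integrable torus_measure (\<lambda>x. (f x)\<^sup>2)" by (rule L2_torusD[OF f])
  have I2: "integrable torus_measure (\<lambda>x. (cmod (tp F c x))\<^sup>2)"
    by (intro integrable_torus continuous_intros)
  have I3: "integrable torus_measure (\<lambda>x. tp F c x * complex_of_real (f x))"
  proof -
    obtain B where B: "\<And>x. cmod (tp F c x) \<le> B"
      using periodic_bounded[OF periodic_tp continuous_tp] by metis
    show ?thesis
    proof (rule Bochner_Integration.integrable_bound[OF integrable_mult_right[OF fi, of "complex_of_real B"]])
      show "(\<lambda>x. tp F c x * complex_of_real (f x)) \<in> borel_measurable torus_measure"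
        using borel_measurable_integrable[OF fi]
          measurable_torus[OF borel_measurable_continuous_lebesgue[OF continuous_tp]] by simp
      show "AE x in torus_measure. norm (tp F c x * complex_of_real (f x)) \<le> norm (complex_of_real B * complex_of_real (f x))"
        unfolding norm_mult norm_of_real using B
        by (intro AE_I2 mult_right_mono) (auto intro: order_trans[OF _ abs_ge_self])
    qed
  qed
  have "0 \<le> (LINT x|torus_measure. (cmod (complex_of_real (f x) - tp F c x))\<^sup>2)"
    by (intro Bochner_Integration.integral_nonneg) simp
  also have "\<dots> = (LINT x|torus_measure. (f x)\<^sup>2 + (cmod (tp F c x))\<^sup>2 - 2 * Re (tp F c x * complex_of_real (f x)))"
  proof (intro Bochner_Integration.integral_cong refl)
    fix x
    show "(cmod (complex_of_real (f x) - tp F c x))\<^sup>2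
        = (f x)\<^sup>2 + (cmod (tp F c x))\<^sup>2 - 2 * Re (tp F c x * complex_of_real (f x))"
      unfolding cmod_power2 by (simp add: power2_eq_square algebra_simps)
  qed
  also have "\<dots> = L2_inner f f + (2 * pi)\<^sup>2 * (\<Sum>n\<in>F. (cmod (c n))\<^sup>2)
      - 2 * Re (LINT x|torus_measure. tp F c x * complex_of_real (f x))"
  proof -
    have "L2_inner f f = (LINT x|torus_measure. (f x)\<^sup>2)"
      by (simp add: L2_inner_def power2_eq_square)
    thus ?thesis
      unfolding integral_norm_tp[OF F, symmetric] integral_Re[OF I3, symmetric]
      using I1 I2 integrable_Re[OF I3] by simp
  qed
  also have "Re (LINT x|torus_measure. tp F c x * complex_of_real (f x)) = (2 * pi)\<^sup>2 * (\<Sum>n\<in>F. (cmod (c n))\<^sup>2)"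
  proof -
    have "(LINT x|torus_measure. tp F c x * complex_of_real (f x))
        = (2 * pi)\<^sup>2 * (\<Sum>n\<in>F. c n * cnj (c n))"
      unfolding integral_tp_mult[OF F fi] fourier_coeff_eq_fc[symmetric] fourier_coeff_minus
      by (simp add: c_def)
    also have "\<dots> = complex_of_real ((2 * pi)\<^sup>2 * (\<Sum>n\<in>F. (cmod (c n))\<^sup>2))"
      by (simp only: of_real_mult of_real_sum complex_norm_square)
    finally show ?thesis by (simp only: Re_complex_of_real)
  qed
  finally show ?thesis by (simp add: c_def)
qed

lemma hs_fourier_coeff:
  assumes "f \<in> L2_torus"
  shows "hs 0 (fourier_coeff f)"
  unfolding hs_def
proof (rule nonneg_bdd_above_summable_on)
  have "(\<Sum>n\<in>F. (wt n powr 0 * cmod (fourier_coeff f n))\<^sup>2) \<le> L2_inner f f / (2 * pi)\<^sup>2"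
    if "finite F" for F
    using bessel_inequality[OF assms that] by (simp add: pos_le_divide_eq mult.commute)
  thus "bdd_above (sum (\<lambda>n. (wt n powr 0 * cmod (fourier_coeff f n))\<^sup>2) ` {F. F \<subseteq> UNIV \<and> finite F})"
    by (intro bdd_aboveI2) auto
qed simp

subsection \<open>The Riesz--Fischer theorem\<close>

text \<open>Boxes are symmetric under \<open>n \<mapsto> - n\<close>, which keeps partial sums with
  hermitian coefficients real, and they exhaust the lattice, so they compute unconditional
  sums.\<close>

definition freq_box :: "nat \<Rightarrow> (int^2) set" where
  "freq_box j = {n. \<forall>i. \<bar>n $ i\<bar> \<le> int j}"

lemma finite_freq_box [simp]: "finite (freq_box j)"
proof -
  have "freq_box j \<subseteq> (\<lambda>n :: int^2. (n $ 1, n $ 2)) -` ({- int j..int j} \<times> {- int j..int j})"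
    by (auto simp: freq_box_def abs_le_iff) (metis minus_le_iff)+
  moreover have "finite ((\<lambda>n :: int^2. (n $ 1, n $ 2)) -` ({- int j..int j} \<times> {- int j..int j}))"
    using bij_vec2 by (intro finite_vimageI) (auto simp: bij_betw_def)
  ultimately show ?thesis by (rule finite_subset)
qed

lemma freq_box_minus: "n \<in> freq_box j \<longleftrightarrow> - n \<in> freq_box j"
  by (simp add: freq_box_def)

lemma freq_box_mono: "i \<le> j \<Longrightarrow> freq_box i \<subseteq> freq_box j"
  by (auto simp: freq_box_def intro: order_trans)

lemma mem_freq_box_self: "n \<in> freq_box (nat (max \<bar>n $ 1\<bar> \<bar>n $ 2\<bar>))"
proof -
  have "\<bar>n $ i\<bar> \<le> max \<bar>n $ 1\<bar> \<bar>n $ 2\<bar>" for i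
    using exhaust_2[of i] by auto
  moreover have "0 \<le> max \<bar>n $ 1\<bar> \<bar>n $ 2\<bar>" by simp
  ultimately show ?thesis by (simp only: freq_box_def mem_Collect_eq nat_0_le simp_thms)
qed

lemma filterlim_freq_box: "filterlim freq_box (finite_subsets_at_top UNIV) sequentially"
  unfolding filterlim_finite_subsets_at_top
proof (intro allI impI)
  fix X :: "(int^2) set"
  assume X: "finite X \<and> X \<subseteq> UNIV"
  define J where "J = (\<Sum>n\<in>X. nat (max \<bar>n $ 1\<bar> \<bar>n $ 2\<bar>))"
  have "X \<subseteq> freq_box j" if "J \<le> j" for j
  proof
    fix n assume "n \<in> X"
    hence "nat (max \<bar>n $ 1\<bar> \<bar>n $ 2\<bar>) \<le> J"
      unfolding J_def using X by (intro member_le_sum) auto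
    thus "n \<in> freq_box j" using that mem_freq_box_self[of n] freq_box_mono by (meson order_trans subsetD)
  qed
  thus "\<forall>\<^sub>F j in sequentially. finite (freq_box j) \<and> X \<subseteq> freq_box j \<and> freq_box j \<subseteq> UNIV"
    by (auto simp: eventually_sequentially)
qed

lemma has_sum_freq_box: "(f has_sum S) UNIV \<Longrightarrow> (\<lambda>j. sum f (freq_box j)) \<longlonglongrightarrow> S"
  unfolding has_sum_def by (rule filterlim_compose[OF _ filterlim_freq_box])

lemma of_real_Re_tp:
  assumes "\<And>n. n \<in> F \<longleftrightarrow> - n \<in> F" "\<And>n. c (- n) = cnj (c n)"
  shows "complex_of_real (Re (tp F c x)) = tp F c x"
proof -
  have "bij_betw uminus F F"
    by (rule bij_betwI[where g = uminus]) (use assms(1) in auto)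
  from sum.reindex_bij_betw[OF this, of "\<lambda>n. c n * ev n x"]
  have "cnj (tp F c x) = tp F c x"
    by (simp add: tp_def assms(2) ev_minus)
  thus ?thesis by (simp add: complex_eq_iff)
qed

lemma tp_diff:
  assumes "finite F" "finite G" "F \<subseteq> G"
  shows "tp G c x - tp F c x = tp (G - F) c x"
  using sum.subset_diff[OF assms(3,2), of "\<lambda>n. c n * ev n x"] by (simp add: tp_def)

text \<open>Cauchy-Schwarz with the weights \<open>(1 / 2) ^ k\<close> and \<open>2 ^ k\<close>
  makes the increments absolutely summable. The second bound is uniform in \<open>N\<close> and
  becomes the integrable majorant in \<open>riesz_fischer\<close>.\<close>

lemma rapid_convergence:
  fixes s :: "nat \<Rightarrow> real"
  assumes "summable (\<lambda>k. 2 ^ k * (s (Suc k) - s k)\<^sup>2)"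
  shows "convergent s" and "(s N)\<^sup>2 \<le> 2 * (s 0)\<^sup>2 + 4 * (\<Sum>k. 2 ^ k * (s (Suc k) - s k)\<^sup>2)"
proof -
  define d where "d k = \<bar>s (Suc k) - s k\<bar>" for k
  define H where "H = (\<Sum>k. 2 ^ k * (s (Suc k) - s k)\<^sup>2)"
  have H0: "0 \<le> H" unfolding H_def by (intro suminf_nonneg assms) simp
  have sq: "(\<Sum>k<N. d k)\<^sup>2 \<le> 2 * H" for N
  proof -
    have "(\<Sum>k<N. d k)\<^sup>2 = (\<Sum>k<N. sqrt ((1 / 2) ^ k) * (sqrt (2 ^ k) * d k))\<^sup>2"
      by (simp add: mult.assoc[symmetric] power_divide flip: real_sqrt_mult)
    also have "\<dots> \<le> (\<Sum>k<N. (sqrt ((1 / 2) ^ k))\<^sup>2) * (\<Sum>k<N. (sqrt (2 ^ k) * d k)\<^sup>2)"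
      by (rule Cauchy_Schwarz_ineq_sum)
    also have "\<dots> = (\<Sum>k<N. (1 / 2 :: real) ^ k) * (\<Sum>k<N. 2 ^ k * (s (Suc k) - s k)\<^sup>2)"
      by (simp add: power_mult_distrib d_def)
    also have "\<dots> \<le> 2 * H"
    proof (rule mult_mono)
      show "(\<Sum>k<N. (1 / 2 :: real) ^ k) \<le> 2"
        by (subst sum_gp_strict) simp
      show "(\<Sum>k<N. 2 ^ k * (s (Suc k) - s k)\<^sup>2) \<le> H"
        unfolding H_def by (intro sum_le_suminf assms) auto
    qed (auto intro: sum_nonneg)
    finally show ?thesis .
  qed
  have "(\<Sum>k<N. d k) \<le> sqrt (2 * H)" for N
    using sq[of N] by (intro real_le_rsqrt)
  hence "summable d"
    by (intro summableI_nonneg_bounded[where x = "sqrt (2 * H)"]) (auto simp: d_def)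
  hence "summable (\<lambda>k. s (Suc k) - s k)"
    unfolding d_def by (rule summable_rabs_cancel)
  hence "convergent (\<lambda>n. \<Sum>k<n. s (Suc k) - s k)" by (simp add: summable_iff_convergent)
  moreover have tel: "(\<Sum>k<n. s (Suc k) - s k) = s n - s 0" for n
    by (rule sum_lessThan_telescope)
  ultimately have "convergent (\<lambda>n. s n - s 0 + s 0)"
    by (intro convergent_add convergent_const) simp
  thus "convergent s" by simp
  have "\<bar>s N\<bar> \<le> \<bar>s 0\<bar> + (\<Sum>k<N. d k)"
    using sum_abs[of "\<lambda>k. s (Suc k) - s k" "{..<N}"] unfolding tel d_def by linarith
  hence "(s N)\<^sup>2 \<le> (\<bar>s 0\<bar> + (\<Sum>k<N. d k))\<^sup>2"
    using power_mono[of "\<bar>s N\<bar>" _ 2] by simp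
  also have "\<dots> \<le> 2 * (s 0)\<^sup>2 + 2 * (\<Sum>k<N. d k)\<^sup>2"
    using sum_squares_bound[of "\<bar>s 0\<bar>" "\<Sum>k<N. d k"] by (simp add: power2_sum)
  finally show "(s N)\<^sup>2 \<le> 2 * (s 0)\<^sup>2 + 4 * (\<Sum>k. 2 ^ k * (s (Suc k) - s k)\<^sup>2)"
    using sq[of N] by (simp add: H_def)
qed

lemma integrable_rapid_sum:
  assumes d: "\<And>k. integrable M (d k)" "\<And>k x. 0 \<le> d k x" and s: "summable (\<lambda>k. integral\<^sup>L M (d k))"
  shows "AE x in M. summable (\<lambda>k. d k x)" and "integrable M (\<lambda>x. \<Sum>k. d k x :: real)"
proof -
  have m [measurable]: "d k \<in> borel_measurable M" for k
    using d(1) by (rule borel_measurable_integrable)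
  have "(\<integral>\<^sup>+x. (\<Sum>k. ennreal (d k x)) \<partial>M) = (\<Sum>k. \<integral>\<^sup>+x. ennreal (d k x) \<partial>M)"
    by (intro nn_integral_suminf) auto
  also have "\<dots> = (\<Sum>k. ennreal (integral\<^sup>L M (d k)))"
    by (intro suminf_cong nn_integral_eq_integral d) (auto simp: d)
  also have "\<dots> \<noteq> \<infinity>"
    unfolding infinity_ennreal_def
    by (intro ennreal_suminf_neq_top s Bochner_Integration.integral_nonneg d)
  finally have "AE x in M. (\<Sum>k. ennreal (d k x)) \<noteq> \<infinity>"
    by (intro nn_integral_PInf_AE) auto
  thus *: "AE x in M. summable (\<lambda>k. d k x)"
    by eventually_elim (auto intro!: summable_suminf_not_top d)
  show "integrable M (\<lambda>x. \<Sum>k. d k x)"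
    by (rule integrable_suminf) (use d s * in auto)
qed

text \<open>
  The square partial sums converge in \<open>L\<^sup>2\<close>; along a subsequence whose increments are square summable
  with weights \<open>2\<^sup>k\<close>, they also converge almost everywhere and are dominated.
\<close>

theorem riesz_fischer:
  assumes herm: "\<And>n. c (- n) = cnj (c n)" and c: "hs 0 c"
  obtains g where "g \<in> L2_torus" "\<And>n. fourier_coeff g n = c n" "L2_inner g g = (2 * pi)\<^sup>2 * nrm2 0 c"
proof -
  define s where "s j x = Re (tp (freq_box j) c x)" for j x
  have s_eq: "complex_of_real (s j x) = tp (freq_box j) c x" for j x
    unfolding s_def by (rule of_real_Re_tp) (rule freq_box_minus, rule herm)
  have s_cont: "continuous_on UNIV (s j)" for j
    unfolding s_def by (intro continuous_intros)
  have s_per: "s j (x + axis i (2 * pi)) = s j x" for j x i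
    using periodic_tp[of "freq_box j" c] by (simp add: s_def periodic_def)
  define S where "S j = (\<Sum>n\<in>freq_box j. (cmod (c n))\<^sup>2)" for j
  have "((\<lambda>n. (cmod (c n))\<^sup>2) has_sum nrm2 0 c) UNIV"
    using has_sum_nrm2[OF c] by simp
  hence S_lim: "S \<longlonglongrightarrow> nrm2 0 c" and S_le: "S j \<le> nrm2 0 c" for j
    unfolding S_def by (auto intro: has_sum_freq_box finite_sum_le_has_sum)
  have norm_s: "(LINT x|torus_measure. (s j x)\<^sup>2) = (2 * pi)\<^sup>2 * S j" for j
  proof -
    have "(s j x)\<^sup>2 = (cmod (tp (freq_box j) c x))\<^sup>2" for x
      unfolding s_eq[symmetric] by simp
    thus ?thesis by (simp only: integral_norm_tp[OF finite_freq_box] S_def)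
  qed
  have norm_diff: "(LINT x|torus_measure. (s j x - s i x)\<^sup>2) = (2 * pi)\<^sup>2 * (S j - S i)" if "i \<le> j" for i j
  proof -
    have "(s j x - s i x)\<^sup>2 = (cmod (tp (freq_box j - freq_box i) c x))\<^sup>2" for x
      unfolding tp_diff[OF finite_freq_box finite_freq_box freq_box_mono[OF that], symmetric] s_eq[symmetric]
      by (simp flip: of_real_diff)
    moreover have "(\<Sum>n\<in>freq_box j - freq_box i. (cmod (c n))\<^sup>2) = S j - S i"
      unfolding S_def by (rule sum_diff) (auto simp: freq_box_mono[OF that])
    ultimately show ?thesis by (simp add: integral_norm_tp)
  qed
  \<comment> \<open>A tail of size \<open>(1 / 4) ^ k\<close> is still \<open>(1 / 2) ^ k\<close>,
    hence summable, after multiplication by the weight \<open>2 ^ k\<close>.\<close>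
  have "\<exists>r\<ge>k. nrm2 0 c - S r \<le> (1 / 4) ^ k" for k
  proof -
    have "\<forall>\<^sub>F r in sequentially. dist (S r) (nrm2 0 c) < (1 / 4) ^ k"
      using S_lim by (rule tendstoD) simp
    hence "\<forall>\<^sub>F r in sequentially. k \<le> r \<and> dist (S r) (nrm2 0 c) < (1 / 4) ^ k"
      by (intro eventually_conj eventually_ge_at_top)
    then obtain r where "k \<le> r" "dist (S r) (nrm2 0 c) < (1 / 4) ^ k"
      using eventually_happens by force
    thus ?thesis by (auto simp: dist_real_def intro!: exI[of _ r])
  qed
  then obtain r where r: "\<And>k. k \<le> r k" "\<And>k. nrm2 0 c - S (r k) \<le> (1 / 4) ^ k"
    by metis
  define d where "d k x = 2 ^ k * (s (r (Suc k)) x - s (r k) x)\<^sup>2" for k x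
  have d_int: "integrable torus_measure (d k)" for k
    unfolding d_def by (intro integrable_torus continuous_intros s_cont)
  have d_le: "(LINT x|torus_measure. d k x) \<le> (2 * pi)\<^sup>2 * (1 / 2) ^ k" for k
  proof -
    have "(LINT x|torus_measure. (s (r (Suc k)) x - s (r k) x)\<^sup>2) \<le> (2 * pi)\<^sup>2 * (1 / 4) ^ k"
    \<comment> \<open>\<open>r\<close> is not chosen monotone, so the later box may be the smaller
      one; the tail bound serves in both cases.\<close>
    proof (cases "r k \<le> r (Suc k)")
      case True
      show ?thesis unfolding norm_diff[OF True]
        using r(2)[of k] S_le[of "r (Suc k)"] by (intro mult_left_mono) auto
    next
      case False
      hence "(LINT x|torus_measure. (s (r (Suc k)) x - s (r k) x)\<^sup>2) = (2 * pi)\<^sup>2 * (S (r k) - S (r (Suc k)))"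
        using norm_diff[of "r (Suc k)" "r k"] by (simp add: power2_commute)
      also have "(1 / 4 :: real) ^ Suc k \<le> (1 / 4) ^ k" by simp
      hence "(2 * pi)\<^sup>2 * (S (r k) - S (r (Suc k))) \<le> (2 * pi)\<^sup>2 * (1 / 4) ^ k"
        using r(2)[of "Suc k"] S_le[of "r k"] by (intro mult_left_mono) (linarith | simp)+
      finally show ?thesis .
    qed
    moreover have "(2::real) ^ k * (1 / 4) ^ k = (1 / 2) ^ k"
      by (simp flip: power_mult_distrib)
    ultimately show ?thesis
      using mult_left_mono[of _ "(2 * pi)\<^sup>2 * (1 / 4) ^ k" "2 ^ k"] unfolding d_def
      by (simp add: mult.left_commute[of "2 ^ k"])
  qed
  have "summable (\<lambda>k. LINT x|torus_measure. d k x)"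
  proof (rule summable_comparison_test')
    show "summable (\<lambda>k. (2 * pi)\<^sup>2 * (1 / 2 :: real) ^ k)"
      by (intro summable_mult summable_geometric) simp
    show "norm (LINT x|torus_measure. d k x) \<le> (2 * pi)\<^sup>2 * (1 / 2) ^ k" if "k \<ge> 0" for k
      using d_le[of k] by (simp add: d_def Bochner_Integration.integral_nonneg)
  qed
  hence AE_sum: "AE x in torus_measure. summable (\<lambda>k. d k x)"
    and H_int: "integrable torus_measure (\<lambda>x. \<Sum>k. d k x)"
    using integrable_rapid_sum[of torus_measure d, OF d_int] unfolding d_def by simp_all
  define W where "W x = 2 * (s (r 0) x)\<^sup>2 + 4 * (\<Sum>k. d k x)" for x
  have W_int: "integrable torus_measure W"
    unfolding W_def
    by (intro Bochner_Integration.integrable_add integrable_mult_right H_int integrable_torus continuous_intros s_cont)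
  \<comment> \<open>Taking the pointwise \<open>lim\<close> everywhere makes \<open>g\<close>
    periodic at every point, even where the sequence diverges.\<close>
  define g where "g x = lim (\<lambda>k. s (r k) x)" for x
  have AE_lim: "AE x in torus_measure. (\<lambda>k. s (r k) x) \<longlonglongrightarrow> g x \<and> (\<forall>k. (s (r k) x)\<^sup>2 \<le> W x)"
    using AE_sum
  proof eventually_elim
    case (elim x)
    from rapid_convergence[of "\<lambda>k. s (r k) x"] elim show ?case
      unfolding d_def g_def W_def by (auto simp: convergent_LIMSEQ_iff)
  qed
  have sm: "s j \<in> borel_measurable lebesgue" for j
    by (rule borel_measurable_continuous_lebesgue[OF s_cont])
  have gm: "g \<in> borel_measurable lebesgue"
    unfolding g_def by (intro borel_measurable_lim_metric sm)
  note smt = measurable_torus[OF sm] and gmt = measurable_torus[OF gm]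
  have lim2: "AE x in torus_measure. (\<lambda>k. (s (r k) x)\<^sup>2) \<longlonglongrightarrow> (g x)\<^sup>2"
    using AE_lim by eventually_elim (auto intro: tendsto_power)
  have le2: "AE x in torus_measure. norm ((s (r k) x)\<^sup>2) \<le> W x" for k
    using AE_lim by eventually_elim auto
  have m2: "(\<lambda>x. (g x)\<^sup>2) \<in> borel_measurable torus_measure"
    "(\<lambda>x. (s (r k) x)\<^sup>2) \<in> borel_measurable torus_measure" for k
    using smt gmt by simp_all
  have sq: "integrable torus_measure (\<lambda>x. (g x)\<^sup>2)"
    "(\<lambda>k. LINT x|torus_measure. (s (r k) x)\<^sup>2) \<longlonglongrightarrow> (LINT x|torus_measure. (g x)\<^sup>2)"
    by (rule integrable_dominated_convergence[where s = "\<lambda>k x. (s (r k) x)\<^sup>2", OF m2 W_int lim2 le2],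
        rule integral_dominated_convergence[where s = "\<lambda>k x. (s (r k) x)\<^sup>2", OF m2 W_int lim2 le2])
  have "periodic g"
    by (simp add: periodic_def g_def s_per)
  hence gL2: "g \<in> L2_torus"
    using gm sq by (simp add: L2_torus_def)
  have r_lim: "filterlim r at_top sequentially"
    by (rule filterlim_at_top_mono[OF filterlim_ident]) (simp add: r)
  have "(\<lambda>k. (2 * pi)\<^sup>2 * S (r k)) \<longlonglongrightarrow> (2 * pi)\<^sup>2 * nrm2 0 c"
    by (intro tendsto_mult_left filterlim_compose[OF S_lim r_lim])
  hence "(LINT x|torus_measure. (g x)\<^sup>2) = (2 * pi)\<^sup>2 * nrm2 0 c"
    using sq LIMSEQ_unique unfolding norm_s by blast
  hence norm_g: "L2_inner g g = (2 * pi)\<^sup>2 * nrm2 0 c"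
    by (simp add: L2_inner_def power2_eq_square)
  have "fourier_coeff g n = c n" for n
  proof -
    have "(\<lambda>k. LINT x|torus_measure. ev (- n) x * complex_of_real (s (r k) x))
        \<longlonglongrightarrow> (LINT x|torus_measure. ev (- n) x * complex_of_real (g x))"
    proof (rule integral_dominated_convergence[where w = "\<lambda>x. 1 + W x"])
      show "integrable torus_measure (\<lambda>x. 1 + W x)"
        by (intro Bochner_Integration.integrable_add W_int) simp
      show "AE x in torus_measure. (\<lambda>k. ev (- n) x * complex_of_real (s (r k) x)) \<longlonglongrightarrow> ev (- n) x * complex_of_real (g x)"
        using AE_lim by eventually_elim (auto intro: tendsto_intros)
      have le: "\<bar>a\<bar> \<le> 1 + w" if "a\<^sup>2 \<le> w" for a w :: real
        using sum_squares_bound[of "\<bar>a\<bar>" 1] that abs_ge_zero[of a]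
        unfolding power2_abs power_one mult_1_right by linarith
      show "AE x in torus_measure. norm (ev (- n) x * complex_of_real (s (r k) x)) \<le> 1 + W x" for k
        using AE_lim by eventually_elim (auto simp: norm_mult intro: le)
      have em: "ev (- n) \<in> borel_measurable torus_measure"
        by (intro measurable_torus borel_measurable_continuous_lebesgue continuous_ev)
      show "(\<lambda>x. ev (- n) x * complex_of_real (g x)) \<in> borel_measurable torus_measure"
        "(\<lambda>x. ev (- n) x * complex_of_real (s (r k) x)) \<in> borel_measurable torus_measure" for k
        using em smt[of "r k"] gmt by simp_all
    qed
    hence "(\<lambda>k. fc (tp (freq_box (r k)) c) n) \<longlonglongrightarrow> fourier_coeff g n"
      unfolding fourier_coeff_eq_fc fc_def s_eq by (intro tendsto_divide) auto
    moreover have "\<forall>\<^sub>F k in sequentially. fc (tp (freq_box (r k)) c) n = c n"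
    proof -
      have "\<forall>\<^sub>F j in sequentially. n \<in> freq_box j"
        using filterlim_freq_box unfolding filterlim_finite_subsets_at_top
        by (elim allE[of _ "{n}"]) (auto elim: eventually_mono)
      hence "\<forall>\<^sub>F k in sequentially. n \<in> freq_box (r k)"
        by (rule eventually_compose_filterlim[OF _ r_lim])
      thus ?thesis by eventually_elim (simp add: fc_tp)
    qed
    ultimately show ?thesis by (rule LIMSEQ_unique[OF _ tendsto_eventually])
  qed
  thus ?thesis using that gL2 norm_g by blast
qed

subsection \<open>Completeness of the trigonometric system and Parseval's identity\<close>

inductive trig_poly :: "(plane \<Rightarrow> complex) \<Rightarrow> bool" where
  mono: "trig_poly (\<lambda>x. c * ev n x)"
| add: "trig_poly f \<Longrightarrow> trig_poly g \<Longrightarrow> trig_poly (\<lambda>x. f x + g x)"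

lemma trig_poly_mult_mono: "trig_poly f \<Longrightarrow> trig_poly (\<lambda>x. c * ev n x * f x)"
proof (induction rule: trig_poly.induct)
  case (mono d m)
  have "(\<lambda>x. c * ev n x * (d * ev m x)) = (\<lambda>x. (c * d) * ev (n + m) x)"
    by (simp add: ev_add fun_eq_iff)
  thus ?case by (simp only: trig_poly.mono)
next
  case (add f g)
  thus ?case by (simp only: distrib_left trig_poly.add)
qed

lemma trig_poly_mult: "trig_poly f \<Longrightarrow> trig_poly g \<Longrightarrow> trig_poly (\<lambda>x. f x * g x)"
  by (induction rule: trig_poly.induct)
    (simp_all only: trig_poly_mult_mono distrib_right trig_poly.add)

lemma trig_poly_const: "trig_poly (\<lambda>x. c)"
  using trig_poly.mono[of c 0] by simp

lemma trig_poly_cos_sin: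
  shows "trig_poly (\<lambda>x. complex_of_real (cos (x $ i)))" "trig_poly (\<lambda>x. complex_of_real (sin (x $ i)))"
proof -
  define n :: "int^2" where "n = axis i 1"
  have "freq n \<bullet> x = x $ i" for x
    using exhaust_2[of i] by (auto simp: n_def inner_vec_def sum_2 axis_def)
  hence e: "ev n x = cis (x $ i)" "ev (- n) x = cnj (cis (x $ i))" for x
    by (simp_all add: ev_minus) (simp_all add: ev_def)
  have "(\<lambda>x. complex_of_real (cos (x $ i))) = (\<lambda>x. (1 / 2) * ev n x + (1 / 2) * ev (- n) x)"
    unfolding e by (simp add: fun_eq_iff complex_eq_iff)
  thus "trig_poly (\<lambda>x. complex_of_real (cos (x $ i)))"
    by (simp only: trig_poly.intros)
  have "(\<lambda>x. complex_of_real (sin (x $ i))) = (\<lambda>x. (- \<i> / 2) * ev n x + (\<i> / 2) * ev (- n) x)"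
    unfolding e by (simp add: fun_eq_iff complex_eq_iff)
  thus "trig_poly (\<lambda>x. complex_of_real (sin (x $ i)))"
    by (simp only: trig_poly.intros)
qed

text \<open>The embedding of the torus into a real Euclidean space of dimension 4, in which
  polynomials pull back to trigonometric polynomials and the Stone-Weierstrass theorem is
  available.\<close>

definition circles :: "plane \<Rightarrow> complex \<times> complex" where
  "circles x = (cis (x $ 1), cis (x $ 2))"

lemma continuous_circles [continuous_intros]: "continuous_on S circles"
  unfolding circles_def[abs_def] by (intro continuous_intros)

lemma trig_poly_circles:
  "real_polynomial_function p \<Longrightarrow> trig_poly (\<lambda>x. complex_of_real (p (circles x)))"
proof (induction rule: real_polynomial_function.induct)
  case (linear f)
  interpret bounded_linear f by (rule linear)
  have dec: "f (circles x) = cos (x $ 1) * f (1, 0) + sin (x $ 1) * f (\<i>, 0)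
      + cos (x $ 2) * f (0, 1) + sin (x $ 2) * f (0, \<i>)" for x
  proof -
    have "circles x = cos (x $ 1) *\<^sub>R (1, 0) + sin (x $ 1) *\<^sub>R (\<i>, 0)
        + cos (x $ 2) *\<^sub>R (0, 1) + sin (x $ 2) *\<^sub>R (0, \<i>)"
      by (simp add: circles_def complex_eq_iff)
    thus ?thesis by (simp only: add scaleR real_scaleR_def)
  qed
  show ?case
    unfolding dec of_real_add of_real_mult
    by (intro trig_poly.add trig_poly_mult trig_poly_cos_sin trig_poly_const)
next
  case (const c)
  show ?case by (rule trig_poly_const)
qed (simp_all only: of_real_add of_real_mult trig_poly.add trig_poly_mult)

lemma integral_trig_poly:
  assumes "trig_poly h" "integrable torus_measure f" "\<And>n. fc f n = 0"
  shows "integrable torus_measure (\<lambda>x. h x * f x) \<and> (LINT x|torus_measure. h x * f x) = 0"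
  using assms(1)
proof (induction rule: trig_poly.induct)
  case (mono c n)
  have "integrable torus_measure (\<lambda>x. c * (ev n x * f x))"
  proof (rule integrable_mult_right, rule Bochner_Integration.integrable_bound[OF assms(2)])
    show "(\<lambda>x. ev n x * f x) \<in> borel_measurable torus_measure"
      using borel_measurable_integrable[OF assms(2)]
        measurable_torus[OF borel_measurable_continuous_lebesgue[OF continuous_ev]] by simp
  qed (simp add: norm_mult)
  moreover have "(LINT x|torus_measure. ev n x * f x) = 0"
    using assms(3)[of "- n"] by (simp add: fc_def)
  ultimately show ?case by (simp add: mult.assoc)
next
  case (add h g)
  thus ?case by (simp add: distrib_right)
qed

text \<open>Polynomials in \<open>circles x\<close> are trigonometric polynomials, so they integrate
  to 0 against \<open>f\<close>. Replacing \<open>G\<close> by a polynomial that is uniformly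
  \<open>e\<close>-close on the range of \<open>circles\<close> changes the integral by at most
  \<open>e\<close> times the integral of \<open>\<bar>f\<bar>\<close>.\<close>

lemma integral_continuous_circles:
  fixes G :: "complex \<times> complex \<Rightarrow> real"
  assumes f: "f \<in> L2_torus" and z: "\<And>n. fourier_coeff f n = 0" and G: "continuous_on UNIV G"
  shows "(LINT x|torus_measure. G (circles x) * f x) = 0"
proof -
  define A where "A = (LINT x|torus_measure. \<bar>f x\<bar>)"
  have A: "0 \<le> A" unfolding A_def by (intro Bochner_Integration.integral_nonneg) simp
  have fi: "integrable torus_measure f" by (rule L2_torus_integrable[OF f])
  have Gi: "integrable torus_measure (\<lambda>x. G (circles x) * f x)"
  proof -
    have c: "continuous_on UNIV (\<lambda>x. G (circles x))"
      by (intro continuous_on_compose2[OF G] continuous_intros) simp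
    have "periodic (\<lambda>x. G (circles x))"
    proof -
      have "circles (x + axis i (2 * pi)) = circles x" for x i
        using exhaust_2[of i] by (auto simp: circles_def axis_def complex_eq_iff)
      thus ?thesis by (simp add: periodic_def)
    qed
    thus ?thesis by (intro L2_torus_integrable_mult f L2_torus_continuous c)
  qed
  have "\<bar>LINT x|torus_measure. G (circles x) * f x\<bar> \<le> e * A" if e: "0 < e" for e
  proof -
    \<comment> \<open>Radius 2 is the sum of the moduli of the two unit complex numbers in
      \<open>circles x\<close>.\<close>
    define S :: "(complex \<times> complex) set" where "S = cball 0 2"
    have circ: "circles x \<in> S" for x
      using norm_Pair_le[of "cis (x $ 1)" "cis (x $ 2)"] by (simp add: S_def circles_def)
    obtain p where p: "real_polynomial_function p" "\<And>y. y \<in> S \<Longrightarrow> \<bar>G y - p y\<bar> < e"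
      using Stone_Weierstrass_real_polynomial_function[OF _ continuous_on_subset[OF G] e, of S]
      by (auto simp: S_def)
    have "integrable torus_measure (\<lambda>x. complex_of_real (p (circles x)) * complex_of_real (f x)) \<and>
        (LINT x|torus_measure. complex_of_real (p (circles x)) * complex_of_real (f x)) = 0"
      using trig_poly_circles[OF p(1)] fi z
      by (intro integral_trig_poly) (auto simp: fourier_coeff_eq_fc)
    hence pi: "integrable torus_measure (\<lambda>x. p (circles x) * f x)" "(LINT x|torus_measure. p (circles x) * f x) = 0"
      unfolding of_real_mult[symmetric] complex_of_real_integrable_eq integral_complex_of_real by simp_all
    have "(LINT x|torus_measure. G (circles x) * f x)
        = (LINT x|torus_measure. G (circles x) * f x - p (circles x) * f x)"
      using Gi pi by simp
    also have "\<bar>\<dots>\<bar> \<le> (LINT x|torus_measure. e * \<bar>f x\<bar>)"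
    proof -
      have "norm (G (circles x) * f x - p (circles x) * f x) \<le> e * \<bar>f x\<bar>" for x
        using p(2)[OF circ, of x] by (simp add: abs_mult mult_right_mono flip: left_diff_distrib)
      hence "norm (LINT x|torus_measure. G (circles x) * f x - p (circles x) * f x) \<le> (LINT x|torus_measure. e * \<bar>f x\<bar>)"
        by (intro Bochner_Integration.integral_norm_bound_integral Bochner_Integration.integrable_diff Gi pi integrable_mult_right integrable_abs fi)
      thus ?thesis by simp
    qed
    finally show ?thesis by (simp add: A_def)
  qed
  hence "\<bar>LINT x|torus_measure. G (circles x) * f x\<bar> \<le> 0"
  proof -
    have "\<bar>LINT x|torus_measure. G (circles x) * f x\<bar> \<le> 0 + e" if "0 < e" for e
    proof -
      have "e / (A + 1) * A \<le> e" using A that by (simp add: field_simps)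
      thus ?thesis using \<open>\<And>e. 0 < e \<Longrightarrow> _ \<le> e * A\<close>[of "e / (A + 1)"] A that by simp
    qed
    thus ?thesis by (rule field_le_epsilon)
  qed
  thus ?thesis by simp
qed

text \<open>Opposite faces of the cell are identified, so one point must be interior: then the
  coordinates differ by strictly less than a full period.\<close>

lemma circles_inj:
  assumes "circles x = circles y" "x \<in> torus_cell" "y \<in> Topology_Euclidean_Space.box 0 (\<chi> i. 2 * pi)"
  shows "x = y"
proof -
  have "x $ i = y $ i" for i
  proof -
    have "sin (x $ i) = sin (y $ i) \<and> cos (x $ i) = cos (y $ i)"
      using assms(1) exhaust_2[of i] by (auto simp: circles_def complex_eq_iff)
    then obtain k :: int where k: "x $ i = y $ i + 2 * pi * k"
      using sin_cos_eq_iff by blast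
    have "0 \<le> x $ i" "x $ i \<le> 2 * pi" "0 < y $ i" "y $ i < 2 * pi"
      using assms(2,3) by (auto simp: mem_torus_cell mem_box_cart)
    hence "2 * pi * real_of_int k < 2 * pi * 1" "2 * pi * (- 1) < 2 * pi * real_of_int k"
      using k by linarith+
    hence "real_of_int k < 1" "- 1 < real_of_int k"
      by (simp_all only: mult_less_cancel_left_pos[of "2 * pi"] pi_gt_zero zero_less_mult_iff zero_less_numeral simp_thms)
    hence "k = 0" by linarith
    thus ?thesis using k by simp
  qed
  thus ?thesis by (simp add: vec_eq_iff)
qed

text \<open>
  The indicator function of a compact set in the open cell is a pointwise limit of continuous
  functions of \<open>circles x\<close>, to which the Stone--Weierstrass theorem applies.
\<close>

lemma integral_compact_eq_0:
  assumes f: "f \<in> L2_torus" and z: "\<And>n. fourier_coeff f n = 0"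
    and K: "compact K" "K \<subseteq> Topology_Euclidean_Space.box 0 (\<chi> i. 2 * pi)"
  shows "(LINT x|torus_measure. indicator K x * f x) = 0"
proof (cases "K = {}")
  case False
  define A where "A = circles ` K"
  have A: "compact A" "A \<noteq> {}"
    unfolding A_def using False by (auto intro!: compact_continuous_image K continuous_intros)
  define g where "g j x = max 0 (1 - real j * infdist (circles x) A)" for j x
  have g01: "0 \<le> g j x" "g j x \<le> 1" for j x
    by (auto simp: g_def infdist_nonneg)
  have g_lim: "(\<lambda>j. g j x) \<longlonglongrightarrow> indicator K x" if x: "x \<in> torus_cell" for x
  proof (cases "x \<in> K")
    case True
    hence "g j x = 1" for j by (simp add: g_def A_def)
    thus ?thesis using True by simp
  next
    case x_nin: False
    have "circles x \<notin> A"
    proof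
      assume "circles x \<in> A"
      then obtain y where "y \<in> K" "circles x = circles y" by (auto simp: A_def)
      with circles_inj[of x y] x K x_nin show False by auto
    qed
    hence d: "0 < infdist (circles x) A"
      using in_closed_iff_infdist_zero[OF compact_imp_closed[OF A(1)] A(2)]
      by (metis infdist_nonneg less_eq_real_def)
    obtain J :: nat where J: "1 / infdist (circles x) A < real J"
      using reals_Archimedean2 by blast
    have "g j x = 0" if "J \<le> j" for j
    proof -
      have "1 / infdist (circles x) A \<le> real j" using J that by linarith
      hence "1 \<le> real j * infdist (circles x) A" using d by (simp add: field_simps)
      thus ?thesis by (simp add: g_def)
    qed
    hence "\<forall>\<^sub>F j in sequentially. g j x = 0"
      by (auto simp: eventually_sequentially)
    thus ?thesis using x_nin by (simp add: tendsto_eventually)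
  qed
  have Kl: "K \<in> sets lebesgue" using K(1) by (simp add: borel_compact)
  have "(\<lambda>j. LINT x|torus_measure. g j x * f x) \<longlonglongrightarrow> (LINT x|torus_measure. indicator K x * f x)"
  proof (rule integral_dominated_convergence[where w = "\<lambda>x. \<bar>f x\<bar>"])
    show "integrable torus_measure (\<lambda>x. \<bar>f x\<bar>)"
      by (intro integrable_abs L2_torus_integrable f)
    have "(\<lambda>x. indicator K x * f x) \<in> borel_measurable lebesgue"
      using L2_torusD(2)[OF f] Kl by simp
    thus "(\<lambda>x. indicator K x * f x) \<in> borel_measurable torus_measure" by (rule measurable_torus)
    have "continuous_on UNIV (g j)" for j
      unfolding g_def[abs_def] by (intro continuous_intros)
    from measurable_torus[OF borel_measurable_continuous_lebesgue[OF this]]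
    show "(\<lambda>x. g j x * f x) \<in> borel_measurable torus_measure" for j
      using L2_torusD(3)[OF f] by simp
    show "AE x in torus_measure. (\<lambda>j. g j x * f x) \<longlonglongrightarrow> indicator K x * f x"
      by (intro AE_I2 tendsto_mult_right g_lim) simp
    show "AE x in torus_measure. norm (g j x * f x) \<le> \<bar>f x\<bar>" for j
      using g01 by (intro AE_I2) (simp add: abs_mult mult_left_le_one_le)
  qed
  moreover have "(LINT x|torus_measure. g j x * f x) = 0" for j
    unfolding g_def
    by (rule integral_continuous_circles[OF f z]) (intro continuous_intros)
  ultimately show ?thesis by (simp add: LIMSEQ_const_iff)
qed simp

text \<open>Inner regularity: a closed set \<open>T\<close> filling the set up to measure
  \<open>e\<close> is compact, \<open>f\<close> is positive on it and integrates to 0 over it, so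
  \<open>T\<close> is a null set.\<close>

lemma null_positive_set:
  assumes f: "f \<in> L2_torus" and z: "\<And>n. fourier_coeff f n = 0"
  shows "{x \<in> Topology_Euclidean_Space.box 0 (\<chi> i. 2 * pi). 0 < f x} \<in> null_sets lebesgue"
proof -
  define B :: "plane set" where "B = Topology_Euclidean_Space.box 0 (\<chi> i. 2 * pi)"
  have BC: "B \<subseteq> torus_cell"
    unfolding B_def torus_cell_def by (rule box_subset_cbox)
  define U where "U = {x \<in> B. 0 < f x}"
  have "U = B \<inter> (f -` {0<..} \<inter> space lebesgue)" by (auto simp: U_def)
  moreover have "f -` {0<..} \<inter> space lebesgue \<in> sets lebesgue"
    by (rule measurable_sets[OF L2_torusD(2)[OF f]]) simp
  ultimately have U: "U \<in> sets lebesgue" by (auto simp: B_def intro!: sets.Int)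
  have le: "emeasure lebesgue U \<le> 0 + ennreal e" if e: "0 < e" for e
  proof -
    obtain T where T: "closed T" "T \<subseteq> U" "U - T \<in> lmeasurable" "emeasure lebesgue (U - T) < ennreal e"
      using sets_lebesgue_inner_closed[OF U e] .
    have TB: "T \<subseteq> B" using T(2) by (auto simp: U_def)
    have "compact T"
      using T(1) bounded_subset[OF bounded_box TB[unfolded B_def]] by (simp add: compact_eq_bounded_closed)
    have Tl: "T \<in> sets lebesgue" using T(1) by (simp add: borel_closed)
    have int0: "(LINT x|torus_measure. indicator T x * f x) = 0"
      by (rule integral_compact_eq_0[OF f z \<open>compact T\<close> TB[unfolded B_def]])
    have nonneg: "0 \<le> indicator T x * f x" for x
      using T(2) by (auto simp: indicator_def U_def)
    have "integrable torus_measure (\<lambda>x. indicator T x * f x)"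
    proof (rule Bochner_Integration.integrable_bound[OF L2_torus_integrable[OF f]])
      have "(\<lambda>x. indicator T x * f x) \<in> borel_measurable lebesgue"
        using L2_torusD(2)[OF f] Tl by simp
      thus "(\<lambda>x. indicator T x * f x) \<in> borel_measurable torus_measure" by (rule measurable_torus)
    qed (auto simp: indicator_def)
    hence "AE x in torus_measure. indicator T x * f x = 0"
      using integral_nonneg_eq_0_iff_AE[of torus_measure "\<lambda>x. indicator T x * f x"] int0 nonneg by simp
    hence "AE x in torus_measure. x \<notin> T"
      by eventually_elim (use T(2) in \<open>auto simp: indicator_def U_def\<close>)
    hence "AE x in lebesgue. x \<in> torus_cell \<longrightarrow> x \<notin> T"
      by (subst (asm) AE_restrict_space_iff) simp_all
    hence "AE x in lebesgue. x \<notin> T"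
      by eventually_elim (use TB BC in auto)
    hence "T \<in> null_sets lebesgue" using Tl by (simp add: AE_iff_null_sets)
    hence "emeasure lebesgue U = emeasure lebesgue (U - T)"
      by (rule emeasure_Diff_null_set[symmetric, OF _ U])
    thus ?thesis using T(4) by simp
  qed
  have "emeasure lebesgue U \<le> 0"
    by (rule ennreal_le_epsilon) (rule le)
  thus ?thesis using U by (simp add: null_sets_def U_def B_def)
qed

theorem fourier_completeness:
  assumes f: "f \<in> L2_torus" and z: "\<And>n. fourier_coeff f n = 0"
  shows "AE x in torus_measure. f x = 0"
proof -
  let ?B = "Topology_Euclidean_Space.box 0 (\<chi> i. 2 * pi) :: plane set"
  have f': "(\<lambda>x. - f x) \<in> L2_torus" using L2_torus_lincomb[OF f f, of "-1" 0] by simp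
  have z': "fourier_coeff (\<lambda>x. - f x) n = 0" for n
    using z[of n] by (simp add: fourier_coeff_eq_fc fc_def)
  have "AE x in lebesgue. x \<notin> {x \<in> ?B. 0 < f x}" "AE x in lebesgue. x \<notin> {x \<in> ?B. 0 < - f x}"
    by (intro AE_not_in null_positive_set[OF f z], intro AE_not_in null_positive_set[OF f' z'])
  moreover have "AE x in lebesgue. x \<notin> torus_cell - ?B"
    unfolding torus_cell_def
    by (intro AE_not_in) (simp add: negligible_frontier_interval flip: negligible_iff_null_sets)
  ultimately have "AE x in lebesgue. x \<in> torus_cell \<longrightarrow> f x = 0"
    by eventually_elim auto
  thus ?thesis by (subst AE_restrict_space_iff) simp_all
qed

lemma fourier_coeff_lincomb:
  assumes "f \<in> L2_torus" "g \<in> L2_torus"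
  shows "fourier_coeff (\<lambda>x. a * f x + b * g x) n
    = complex_of_real a * fourier_coeff f n + complex_of_real b * fourier_coeff g n"
proof -
  have I: "integrable torus_measure (\<lambda>x. ev (- n) x * complex_of_real (h x))" if "h \<in> L2_torus" for h
  proof (rule Bochner_Integration.integrable_bound[OF L2_torus_integrable[OF that]])
    show "(\<lambda>x. ev (- n) x * complex_of_real (h x)) \<in> borel_measurable torus_measure"
      using L2_torusD(3)[OF that]
        measurable_torus[OF borel_measurable_continuous_lebesgue[OF continuous_ev]] by simp
  qed (simp add: norm_mult)
  have "(LINT x|torus_measure. ev (- n) x * complex_of_real (a * f x + b * g x))
      = (LINT x|torus_measure. complex_of_real a * (ev (- n) x * complex_of_real (f x))
        + complex_of_real b * (ev (- n) x * complex_of_real (g x)))"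
    by (simp add: algebra_simps)
  also have "\<dots> = complex_of_real a * (LINT x|torus_measure. ev (- n) x * complex_of_real (f x))
      + complex_of_real b * (LINT x|torus_measure. ev (- n) x * complex_of_real (g x))"
    by (subst Bochner_Integration.integral_add) (auto intro!: integrable_mult_right I assms)
  finally show ?thesis
    by (simp add: fourier_coeff_eq_fc fc_def add_divide_distrib)
qed

lemma fourier_coeff_add:
  "f \<in> L2_torus \<Longrightarrow> g \<in> L2_torus \<Longrightarrow> fourier_coeff (\<lambda>x. f x + g x) n = fourier_coeff f n + fourier_coeff g n"
  using fourier_coeff_lincomb[of f g 1 1] by simp

lemma fourier_coeff_diff:
  "f \<in> L2_torus \<Longrightarrow> g \<in> L2_torus \<Longrightarrow> fourier_coeff (\<lambda>x. f x - g x) n = fourier_coeff f n - fourier_coeff g n"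
  using fourier_coeff_lincomb[of f g 1 "-1"] by simp

lemma fourier_unique:
  assumes "f \<in> L2_torus" "g \<in> L2_torus" "\<And>n. fourier_coeff f n = fourier_coeff g n"
  shows "AE x in torus_measure. f x = g x"
  using fourier_completeness[OF L2_torus_diff[OF assms(1,2)]] assms
  by (simp add: fourier_coeff_diff)

text \<open>The Riesz-Fischer theorem gives a function with the same coefficients whose norm is
  known, and completeness identifies it with \<open>f\<close> almost everywhere.\<close>

theorem parseval_norm:
  assumes f: "f \<in> L2_torus"
  shows "L2_inner f f = (2 * pi)\<^sup>2 * nrm2 0 (fourier_coeff f)"
proof -
  obtain g where g: "g \<in> L2_torus" "\<And>n. fourier_coeff g n = fourier_coeff f n"
    "L2_inner g g = (2 * pi)\<^sup>2 * nrm2 0 (fourier_coeff f)"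
    using riesz_fischer[OF fourier_coeff_minus hs_fourier_coeff[OF f]] by metis
  have "AE x in torus_measure. f x = g x" using fourier_unique[OF f g(1)] g(2) by simp
  hence "L2_inner f f = L2_inner g g"
    unfolding L2_inner_def using L2_torusD(3)[OF f] L2_torusD(3)[OF g(1)]
    by (intro integral_cong_AE) auto
  thus ?thesis using g(3) by simp
qed

text \<open>Polarization of \<open>parseval_norm\<close>.\<close>

theorem parseval:
  assumes f: "f \<in> L2_torus" and g: "g \<in> L2_torus"
  shows "L2_inner f g = (2 * pi)\<^sup>2 * Re (ip (fourier_coeff f) (fourier_coeff g))"
proof -
  have I: "integrable torus_measure (\<lambda>x. f x * f x)" "integrable torus_measure (\<lambda>x. g x * g x)"
    "integrable torus_measure (\<lambda>x. f x * g x)" "integrable torus_measure (\<lambda>x. g x * f x)"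
    by (intro L2_torus_integrable_mult f g)+
  have "L2_inner (\<lambda>x. f x + g x) (\<lambda>x. f x + g x) = L2_inner f f + L2_inner g g + 2 * L2_inner f g"
    using I by (simp add: L2_inner_def distrib_left distrib_right mult.commute[of "g _" "f _"])
  hence 1: "2 * L2_inner f g = (2 * pi)\<^sup>2 * (nrm2 0 (\<lambda>n. fourier_coeff f n + fourier_coeff g n)
      - nrm2 0 (fourier_coeff f) - nrm2 0 (fourier_coeff g))"
    using parseval_norm[OF L2_torus_add[OF f g]] parseval_norm[OF f] parseval_norm[OF g]
    by (simp add: fourier_coeff_add[OF f g, abs_def] algebra_simps)
  let ?x = "fourier_coeff f" and ?y = "fourier_coeff g"
  have x: "hs 0 ?x" "hs 0 ?y" by (intro hs_fourier_coeff f g)+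
  have "((\<lambda>n. (cmod (?x n))\<^sup>2 + (cmod (?y n))\<^sup>2 + 2 * Re (?x n * cnj (?y n)))
      has_sum (nrm2 0 ?x + nrm2 0 ?y + 2 * Re (ip ?x ?y))) UNIV"
  proof (intro has_sum_add has_sum_cmult_right has_sum_Re)
    show "((\<lambda>n. ?x n * cnj (?y n)) has_sum ip ?x ?y) UNIV"
      unfolding ip_def using ip_summable[of 0 ?x ?y] x by (intro has_sum_infsum) simp
  qed (use has_sum_nrm2[OF x(1)] has_sum_nrm2[OF x(2)] in simp_all)
  moreover have "(cmod (a + b))\<^sup>2 = (cmod a)\<^sup>2 + (cmod b)\<^sup>2 + 2 * Re (a * cnj b)" for a b
    unfolding cmod_power2 by (simp add: power2_eq_square algebra_simps)
  ultimately have "nrm2 0 (\<lambda>n. ?x n + ?y n) = nrm2 0 ?x + nrm2 0 ?y + 2 * Re (ip ?x ?y)"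
    unfolding nrm2_def[of 0 "\<lambda>n. ?x n + ?y n"] by (intro infsumI) simp
  with 1 show ?thesis by simp
qed

subsection \<open>Fourier coefficients of symbols\<close>

lemma smooth_slice:
  fixes h :: "'a::real_normed_vector \<times> 'b::real_normed_vector \<Rightarrow> 'c::real_normed_vector"
  assumes "smooth h"
  shows "smooth (\<lambda>x. h (x, \<xi>))" and "dir_deriv v (\<lambda>x. h (x, \<xi>)) = (\<lambda>x. dir_deriv (v, 0) h (x, \<xi>))"
proof -
  have d: "((\<lambda>x. g (x, \<xi>)) has_derivative (\<lambda>v. dir_deriv (v, 0) g (x, \<xi>))) (at x)" if "smooth g"
    for g :: "'a \<times> 'b \<Rightarrow> 'c" and x
    by (rule has_derivative_compose[OF _ smooth_has_derivative[OF that], of "\<lambda>x. (x, \<xi>)" "\<lambda>v. (v, 0)"])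
      (intro has_derivative_Pair has_derivative_ident has_derivative_const)
  show dd: "dir_deriv v (\<lambda>x. h (x, \<xi>)) = (\<lambda>x. dir_deriv (v, 0) h (x, \<xi>))"
    by (rule dir_deriv_eq[OF d[OF assms]])
  show "smooth (\<lambda>x. h (x, \<xi>))"
  proof (rule smooth_of_derivs[where F = "{\<lambda>x. g (x, \<xi>) | g. smooth g}"], goal_cases)
    case 1
    show ?case using assms by blast
  next
    case (2 f v)
    then obtain g where g: "smooth g" "f = (\<lambda>x. g (x, \<xi>))" by blast
    have "dir_deriv v f = (\<lambda>x. dir_deriv (v, 0) g (x, \<xi>))"
      unfolding g(2) by (rule dir_deriv_eq[OF d[OF g(1)]])
    thus ?case using d[OF g(1)] g smooth_dir_deriv[OF g(1)] by (auto simp: differentiable_def)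
  qed
qed

lemma foldr_slice:
  fixes h :: "plane \<times> plane \<Rightarrow> complex"
  assumes "smooth h"
  shows "foldr dir_deriv (replicate N (axis i 1)) (\<lambda>x. h (x, \<xi>))
    = (\<lambda>x. foldr (\<lambda>i. dir_deriv (axis i 1, 0)) (replicate N i) h (x, \<xi>))"
proof (induction N)
  case (Suc N)
  have "smooth (foldr (\<lambda>i. dir_deriv (axis i 1, 0)) (replicate N i) h)"
    using smooth_foldr[OF assms, of "map (\<lambda>i. (axis i 1, 0)) (replicate N i)"] by (simp add: foldr_map o_def)
  from smooth_slice(2)[OF this] Suc show ?case by simp
qed simp

lemma periodic_slice_dir_deriv:
  fixes h :: "plane \<times> plane \<Rightarrow> complex"
  assumes "smooth h" "\<And>\<xi>. periodic (\<lambda>x. h (x, \<xi>))"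
  shows "periodic (\<lambda>x. dir_deriv v h (x, \<xi>))"
  unfolding periodic_def
proof (intro allI)
  fix x i
  let ?c = "(axis i (2 * pi), 0) :: plane \<times> plane"
  have per: "h (y + ?c) = h y" for y
    using periodicD[OF assms(2)[of "snd y"], of "fst y" i] by (cases y) simp
  have "((\<lambda>y. h (y + ?c)) has_derivative (\<lambda>v. dir_deriv v h ((x, \<xi>) + ?c))) (at (x, \<xi>))"
    by (rule has_derivative_compose[OF _ smooth_has_derivative[OF assms(1)], of "\<lambda>y. y + ?c" "\<lambda>v. v"])
      (intro has_derivative_add_const has_derivative_ident)
  hence "(h has_derivative (\<lambda>v. dir_deriv v h ((x, \<xi>) + ?c))) (at (x, \<xi>))"
    by (simp only: per)
  from has_derivative_unique[OF this smooth_has_derivative[OF assms(1)]]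
  have "dir_deriv v h ((x, \<xi>) + ?c) = dir_deriv v h (x, \<xi>)"
    by (rule fun_cong)
  thus "dir_deriv v h (x + axis i (2 * pi), \<xi>) = dir_deriv v h (x, \<xi>)" by simp
qed

text \<open>The mean value inequality on the segment from \<xi> to \<open>\<xi> + \<eta>\<close>,
  where Peetre's inequality replaces the intermediate point by \<xi>. The factor 2 counts
  coordinates, and the extra power of \<open>1 + norm \<eta>\<close> is the length of the step.
  \<open>F\<close> is general so that a difference can be inserted for it.\<close>

lemma difference_bound:
  fixes F :: "plane \<Rightarrow> complex" and G :: "2 \<Rightarrow> plane \<Rightarrow> complex"
  assumes d: "\<And>\<xi> \<eta> t. ((\<lambda>t. F (\<xi> + t *\<^sub>R \<eta>)) has_vector_derivative
      (\<Sum>j\<in>UNIV. of_real (\<eta> $ j) * G j (\<xi> + t *\<^sub>R \<eta>))) (at t)"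
    and G: "\<And>j \<xi>. cmod (G j \<xi>) \<le> A * (1 + norm \<xi>) powr s"
  shows "cmod (F (\<xi> + \<eta>) - F \<xi>) \<le> 2 * A * (1 + norm \<eta>) powr (\<bar>s\<bar> + 1) * (1 + norm \<xi>) powr s"
proof -
  have A: "0 \<le> A"
  proof -
    have "0 \<le> A * (1 + norm (0::plane)) powr s" using G[of 1 0] by (rule order_trans[rotated]) simp
    thus ?thesis by simp
  qed
  have der: "((\<lambda>t. F (\<xi> + t *\<^sub>R \<eta>)) has_derivative
      (\<lambda>h. h *\<^sub>R (\<Sum>j\<in>UNIV. of_real (\<eta> $ j) * G j (\<xi> + t *\<^sub>R \<eta>)))) (at t)" for t
    using d unfolding has_vector_derivative_def .
  have "\<exists>t\<in>{0<..<1::real}. norm (F (\<xi> + 1 *\<^sub>R \<eta>) - F (\<xi> + 0 *\<^sub>R \<eta>))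
      \<le> norm ((1 - 0) *\<^sub>R (\<Sum>j\<in>UNIV. of_real (\<eta> $ j) * G j (\<xi> + t *\<^sub>R \<eta>)))"
    by (rule mvt_general[OF _ _ der])
      (auto intro!: continuous_at_imp_continuous_on has_derivative_continuous[OF der])
  then obtain t where t: "0 < t" "t < 1"
    and le: "cmod (F (\<xi> + \<eta>) - F \<xi>) \<le> cmod (\<Sum>j\<in>UNIV. of_real (\<eta> $ j) * G j (\<xi> + t *\<^sub>R \<eta>))"
    by auto
  define D where "D = A * ((1 + norm \<eta>) powr \<bar>s\<bar> * (1 + norm \<xi>) powr s)"
  have GD: "cmod (G j (\<xi> + t *\<^sub>R \<eta>)) \<le> D" for j
  proof -
    have "cmod (G j (\<xi> + t *\<^sub>R \<eta>)) \<le> A * (1 + norm (\<xi> + t *\<^sub>R \<eta>)) powr s" by (rule G)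
    also have "\<dots> \<le> A * ((1 + norm (t *\<^sub>R \<eta>)) powr \<bar>s\<bar> * (1 + norm \<xi>) powr s)"
      by (intro mult_left_mono peetre_inequality A)
    also have "\<dots> \<le> D"
      unfolding D_def using t
      by (intro mult_left_mono mult_right_mono powr_mono2 A) (auto simp: mult_left_le_one_le)
    finally show ?thesis .
  qed
  have D0: "0 \<le> D" using GD[of 1] norm_ge_zero order_trans by blast
  have "cmod (of_real (\<eta> $ j) * G j (\<xi> + t *\<^sub>R \<eta>)) \<le> (1 + norm \<eta>) * D" for j
    unfolding norm_mult norm_of_real using component_le_norm_cart[of \<eta> j] D0
    by (intro mult_mono GD) auto
  from add_mono[OF this[of 1] this[of 2]]
  have "cmod (\<Sum>j\<in>UNIV. of_real (\<eta> $ j) * G j (\<xi> + t *\<^sub>R \<eta>)) \<le> (1 + norm \<eta>) * D + (1 + norm \<eta>) * D"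
    unfolding sum_2 by (rule norm_triangle_le)
  also have "\<dots> = 2 * A * ((1 + norm \<eta>) powr \<bar>s\<bar> * (1 + norm \<eta>) powr 1) * (1 + norm \<xi>) powr s"
    by (simp add: D_def mult_ac)
  also have "(1 + norm \<eta>) powr \<bar>s\<bar> * (1 + norm \<eta>) powr 1 = (1 + norm \<eta>) powr (\<bar>s\<bar> + 1)"
    by (rule powr_add[symmetric])
  finally show ?thesis using le by (rule order_trans[rotated])
qed

text \<open>The quantity A(m, \<xi>) of the overview, with the symbol first differentiated in the
  directions \<open>js\<close> in \<xi>.\<close>

definition sig :: "(plane \<times> plane \<Rightarrow> complex) \<Rightarrow> 2 list \<Rightarrow> int^2 \<Rightarrow> plane \<Rightarrow> complex" where
  "sig a js m \<xi> = fc (\<lambda>x. foldr (\<lambda>j. dir_deriv (0, axis j 1)) js a (x, \<xi>)) m"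

lemma smooth_symbol:
  assumes "a \<in> symbol_class k"
  shows "smooth (foldr (\<lambda>j. dir_deriv (0, axis j 1)) js a)"
  using smooth_foldr[of a "map (\<lambda>j. (0, axis j 1)) js"] assms
  by (simp add: foldr_map o_def symbol_class_def)

lemma periodic_symbol:
  assumes "a \<in> symbol_class k"
  shows "periodic (\<lambda>x. foldr (\<lambda>j. dir_deriv (0, axis j 1)) js a (x, \<xi>))"
proof (induction js arbitrary: \<xi>)
  case Nil
  show ?case using assms by (simp add: symbol_class_def)
next
  case (Cons j js)
  show ?case using periodic_slice_dir_deriv[OF smooth_symbol[OF assms, of js] Cons] by simp
qed

text \<open>\<open>fc_decay\<close> in the space variable at frozen \<xi>; the symbol estimates for
  \<xi>-derivatives followed by space derivatives provide its two constants.\<close>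

lemma sig_bound:
  assumes a: "a \<in> symbol_class k"
  shows "\<exists>C. \<forall>m \<xi>. cmod (sig a js m \<xi>) * wt m ^ N \<le> C * (1 + norm \<xi>) powr (k - real (length js))"
proof -
  let ?h = "foldr (\<lambda>j. dir_deriv (0, axis j 1)) js a"
  have "\<forall>is. \<exists>C. \<forall>x \<xi>. norm (foldr (\<lambda>i. dir_deriv (axis i 1, 0)) is ?h (x, \<xi>))
      \<le> C * (1 + norm \<xi>) powr (k - real (length js))"
    using a by (auto simp: symbol_class_def)
  then obtain C where C: "\<And>is x \<xi>. norm (foldr (\<lambda>i. dir_deriv (axis i 1, 0)) is ?h (x, \<xi>))
      \<le> C is * (1 + norm \<xi>) powr (k - real (length js))"
    by metis
  define D where "D = max (C (replicate N 1)) (C (replicate N 2))"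
  have "cmod (sig a js m \<xi>) * wt m ^ N \<le> (3 ^ N * (C [] + 2 * D)) * (1 + norm \<xi>) powr (k - real (length js))" for m \<xi>
  proof -
    let ?w = "(1 + norm \<xi>) powr (k - real (length js))"
    have "cmod (sig a js m \<xi>) * wt m ^ N \<le> 3 ^ N * (C [] * ?w + 2 * (D * ?w))"
      unfolding sig_def
    proof (rule fc_decay)
      show "smooth (\<lambda>x. ?h (x, \<xi>))" by (rule smooth_slice(1)[OF smooth_symbol[OF a]])
      show "periodic (\<lambda>x. ?h (x, \<xi>))" by (rule periodic_symbol[OF a])
      show "cmod (?h (x, \<xi>)) \<le> C [] * ?w" for x using C[of "[]" x \<xi>] by simp
      show "cmod (foldr dir_deriv (replicate N (axis i 1)) (\<lambda>x. ?h (x, \<xi>)) x) \<le> D * ?w" for x i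
      proof -
        have "C (replicate N i) \<le> D" using exhaust_2[of i] by (auto simp: D_def)
        hence "C (replicate N i) * ?w \<le> D * ?w" by (rule mult_right_mono) simp
        thus ?thesis
          using C[of "replicate N i" x \<xi>] unfolding foldr_slice[OF smooth_symbol[OF a]] by linarith
      qed
    qed
    thus ?thesis by (simp add: algebra_simps)
  qed
  thus ?thesis by blast
qed

text \<open>Differentiation under the integral over the torus, along the line through \<xi> in
  direction \<eta>.\<close>

lemma sig_derivative:
  assumes a: "a \<in> symbol_class k"
  shows "((\<lambda>t. sig a js m (\<xi> + t *\<^sub>R \<eta>)) has_vector_derivative
    (\<Sum>j\<in>UNIV. of_real (\<eta> $ j) * sig a (j # js) m (\<xi> + t *\<^sub>R \<eta>))) (at t)"
proof -
  let ?h = "\<lambda>js. foldr (\<lambda>j. dir_deriv (0, axis j 1)) js a"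
  define f where "f t x = ev (- m) x * ?h js (x, \<xi> + t *\<^sub>R \<eta>)" for t x
  define g where "g t x = (\<Sum>j\<in>UNIV. of_real (\<eta> $ j) * (ev (- m) x * ?h (j # js) (x, \<xi> + t *\<^sub>R \<eta>)))" for t x
  have ch: "continuous_on S (?h js)" for S js by (rule smooth_continuous[OF smooth_symbol[OF a]])
  have cpath: "continuous_on UNIV (\<lambda>p :: real \<times> plane. (snd p, \<xi> + fst p *\<^sub>R \<eta>))"
    by (intro continuous_intros)
  have chp: "continuous_on UNIV (\<lambda>p :: real \<times> plane. ?h js (snd p, \<xi> + fst p *\<^sub>R \<eta>))" for js
    by (rule continuous_on_compose2[OF ch[of UNIV] cpath]) simp
  have cev: "continuous_on UNIV (\<lambda>p :: real \<times> plane. ev (- m) (snd p))"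
    by (rule continuous_on_compose2[OF continuous_ev[of UNIV]]) (auto intro!: continuous_intros)
  have cont_g: "continuous_on UNIV (\<lambda>(t, x). g t x)"
    unfolding g_def case_prod_unfold by (intro continuous_intros cev chp)
  have cf: "continuous_on UNIV (\<lambda>x. ev (- m) x * ?h js (x, \<zeta>))" for js \<zeta>
    by (intro continuous_intros continuous_on_compose2[OF ch[of UNIV]]) auto
  have fd: "((\<lambda>t. f t x) has_vector_derivative g t x) (at t within UNIV)" for t x
  proof -
    interpret bounded_linear "\<lambda>v. dir_deriv v (?h js) (x, \<xi> + t *\<^sub>R \<eta>)"
      by (rule has_derivative_bounded_linear[OF smooth_has_derivative[OF smooth_symbol[OF a]]])
    have "((\<lambda>t. (x, \<xi> + t *\<^sub>R \<eta>)) has_derivative (\<lambda>h. (0, h *\<^sub>R \<eta>))) (at t)"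
      by (auto intro!: derivative_eq_intros)
    from has_derivative_compose[OF this smooth_has_derivative[OF smooth_symbol[OF a]]]
    have "((\<lambda>t. ?h js (x, \<xi> + t *\<^sub>R \<eta>)) has_derivative
        (\<lambda>h. dir_deriv (0, h *\<^sub>R \<eta>) (?h js) (x, \<xi> + t *\<^sub>R \<eta>))) (at t)" .
    hence 1: "((\<lambda>t. ev (- m) x * ?h js (x, \<xi> + t *\<^sub>R \<eta>)) has_derivative
        (\<lambda>h. ev (- m) x * dir_deriv (0, h *\<^sub>R \<eta>) (?h js) (x, \<xi> + t *\<^sub>R \<eta>))) (at t)"
      by (rule has_derivative_mult_right)
    have 2: "dir_deriv (0, h *\<^sub>R \<eta>) (?h js) (x, \<xi> + t *\<^sub>R \<eta>)
        = h *\<^sub>R (\<Sum>j\<in>UNIV. of_real (\<eta> $ j) * ?h (j # js) (x, \<xi> + t *\<^sub>R \<eta>))" for h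
    proof -
      have "(0, h *\<^sub>R \<eta>) = h *\<^sub>R (\<eta> $ 1 *\<^sub>R (0 :: plane, axis 1 1 :: plane) + \<eta> $ 2 *\<^sub>R (0, axis 2 1))"
        by (simp add: vec_eq_iff forall_2 axis_def)
      hence "dir_deriv (0, h *\<^sub>R \<eta>) (?h js) (x, \<xi> + t *\<^sub>R \<eta>)
          = h *\<^sub>R (\<eta> $ 1 *\<^sub>R dir_deriv (0, axis 1 1) (?h js) (x, \<xi> + t *\<^sub>R \<eta>)
            + \<eta> $ 2 *\<^sub>R dir_deriv (0, axis 2 1) (?h js) (x, \<xi> + t *\<^sub>R \<eta>))"
        by (simp only: scaleR add)
      thus ?thesis by (simp add: sum_2 scaleR_conv_of_real)
    qed
    have "(\<lambda>h. ev (- m) x * dir_deriv (0, h *\<^sub>R \<eta>) (?h js) (x, \<xi> + t *\<^sub>R \<eta>)) = (\<lambda>h. h *\<^sub>R g t x)"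
      unfolding 2 g_def by (simp add: sum_2 scaleR_conv_of_real algebra_simps)
    thus ?thesis using 1 unfolding has_vector_derivative_def f_def by simp
  qed
  have "((\<lambda>t. integral (cbox 0 (\<chi> i. 2 * pi)) (f t)) has_vector_derivative
      integral (cbox 0 (\<chi> i. 2 * pi)) (g t)) (at t within UNIV)"
  proof (rule leibniz_rule_vector_derivative[OF fd])
    show "f t integrable_on cbox 0 (\<chi> i. 2 * pi)" for t
      unfolding f_def by (rule integrable_continuous) (rule continuous_on_subset[OF cf], simp)
    show "continuous_on (UNIV \<times> cbox 0 (\<chi> i. 2 * pi)) (\<lambda>(t, x). g t x)"
      by (rule continuous_on_subset[OF cont_g]) simp
  qed auto
  hence "((\<lambda>t. integral torus_cell (f t) / (2 * pi)\<^sup>2) has_vector_derivative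
      integral torus_cell (g t) / (2 * pi)\<^sup>2) (at t)"
    by (intro has_vector_derivative_divide) (simp add: torus_cell_def)
  moreover have "integral torus_cell (f t) / (2 * pi)\<^sup>2 = sig a js m (\<xi> + t *\<^sub>R \<eta>)" for t
    unfolding sig_def fc_def integral_torus[OF cf] f_def ..
  moreover have "integral torus_cell (g t) / (2 * pi)\<^sup>2
      = (\<Sum>j\<in>UNIV. of_real (\<eta> $ j) * sig a (j # js) m (\<xi> + t *\<^sub>R \<eta>))"
  proof -
    have I: "(\<lambda>x. of_real (\<eta> $ j) * (ev (- m) x * ?h (j # js) (x, \<xi> + t *\<^sub>R \<eta>))) integrable_on torus_cell" for j
      unfolding torus_cell_def
      by (intro integrable_continuous continuous_on_mult continuous_on_const continuous_on_subset[OF cf]) simp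
    have "integral torus_cell (g t) = (\<Sum>j\<in>UNIV. integral torus_cell
        (\<lambda>x. of_real (\<eta> $ j) * (ev (- m) x * ?h (j # js) (x, \<xi> + t *\<^sub>R \<eta>))))"
      unfolding g_def by (rule Henstock_Kurzweil_Integration.integral_sum) (use I in auto)
    also have "\<dots> = (\<Sum>j\<in>UNIV. of_real (\<eta> $ j) * integral torus_cell
        (\<lambda>x. ev (- m) x * ?h (j # js) (x, \<xi> + t *\<^sub>R \<eta>)))"
      by (simp only: Henstock_Kurzweil_Integration.integral_mult_right)
    finally show ?thesis
      unfolding sig_def fc_def integral_torus[OF cf] by (simp add: sum_divide_distrib)
  qed
  ultimately show ?thesis by simp
qed

definition symbol_matrix :: "(plane \<times> plane \<Rightarrow> complex) \<Rightarrow> matrix" where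
  "symbol_matrix a = (\<lambda>l n. sig a [] (l - n) (freq n))"

lemma wt_powr_le_nat: "wt p powr s \<le> wt p ^ nat \<lceil>s\<rceil>"
proof -
  have "wt p powr s \<le> wt p powr real (nat \<lceil>s\<rceil>)"
    using wt_ge_1 by (intro powr_mono) linarith+
  thus ?thesis by (simp add: powr_realpow)
qed

text \<open>\<open>dif p\<close> changes only the frequency argument of \<open>sig\<close>, from
  \<open>freq n\<close> to \<open>freq n + freq p\<close>. Each difference is one use of
  \<open>difference_bound\<close>, which trades it for a \<xi>-derivative and thus one
  order.\<close>

proposition symbolic_symbol_matrix:
  assumes a: "a \<in> symbol_class k"
  shows "symbolic k (symbol_matrix a)"
  unfolding symbolic_def
proof (intro conjI)
  show "ordm k (symbol_matrix a)"
    unfolding ordm_def bnd_def symbol_matrix_def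
    using sig_bound[OF a, of "[]"] by (auto simp: wt_def) metis
next
  show "ordf wt (k - 1) (\<lambda>p. dif p (symbol_matrix a))"
    unfolding ordf_def
  proof
    fix N
    have "\<forall>j. \<exists>C. \<forall>m \<xi>. cmod (sig a [j] m \<xi>) * wt m ^ N \<le> C * (1 + norm \<xi>) powr (k - 1)"
      using sig_bound[OF a, of "[_]" N] by simp
    then obtain C where C: "\<And>j m \<xi>. cmod (sig a [j] m \<xi>) * wt m ^ N \<le> C j * (1 + norm \<xi>) powr (k - 1)"
      by metis
    define A where "A = \<bar>C 1\<bar> + \<bar>C 2\<bar>"
    define M where "M = nat \<lceil>\<bar>k - 1\<bar> + 1\<rceil>"
    have CA: "C j \<le> A" for j using exhaust_2[of j] by (auto simp: A_def)
    have "bnd N (k - 1) (2 * A * wt p ^ M) (dif p (symbol_matrix a))" for p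
      unfolding bnd_def
    proof (intro allI)
      fix l n :: "int^2"
      define m where "m = l - n"
      have "cmod (sig a [] m (freq n + freq p) - sig a [] m (freq n))
          \<le> 2 * (A / wt m ^ N) * (1 + norm (freq p)) powr (\<bar>k - 1\<bar> + 1) * (1 + norm (freq n)) powr (k - 1)"
      proof (rule difference_bound[OF sig_derivative[OF a]])
        fix j \<xi>
        have "cmod (sig a [j] m \<xi>) * wt m ^ N \<le> A * (1 + norm \<xi>) powr (k - 1)"
          using C[of j m \<xi>] mult_right_mono[OF CA, of "(1 + norm \<xi>) powr (k - 1)" j] by simp
        thus "cmod (sig a [j] m \<xi>) \<le> A / wt m ^ N * (1 + norm \<xi>) powr (k - 1)"
          by (simp add: pos_le_divide_eq)
      qed
      also have "\<dots> \<le> 2 * (A / wt m ^ N) * wt p ^ M * (1 + norm (freq n)) powr (k - 1)"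
        using wt_powr_le_nat[of p "\<bar>k - 1\<bar> + 1"]
        by (intro mult_right_mono mult_left_mono) (auto simp: wt_def[symmetric] M_def A_def)
      finally have "cmod (dif p (symbol_matrix a) l n) \<le> (2 * A * wt p ^ M * wt n powr (k - 1)) / wt m ^ N"
        by (simp add: dif_def symbol_matrix_def m_def freq_add wt_def[symmetric])
      thus "cmod (dif p (symbol_matrix a) l n) * wt (l - n) ^ N \<le> 2 * A * wt p ^ M * wt n powr (k - 1)"
        by (simp add: pos_le_divide_eq m_def)
    qed
    thus "\<exists>A M. \<forall>p. bnd N (k - 1) (A * wt p ^ M) (dif p (symbol_matrix a))" by blast
  qed
next
  show "ordf (\<lambda>(p, q). wt p * wt q) (k - 2) (\<lambda>(p, q). dif q (dif p (symbol_matrix a)))"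
    unfolding ordf_def
  proof
    fix N
    have "\<forall>i j. \<exists>C. \<forall>m \<xi>. cmod (sig a [i, j] m \<xi>) * wt m ^ N \<le> C * (1 + norm \<xi>) powr (k - 2)"
      using sig_bound[OF a, of "[_, _]" N] by simp
    then obtain C where C: "\<And>i j m \<xi>. cmod (sig a [i, j] m \<xi>) * wt m ^ N \<le> C i j * (1 + norm \<xi>) powr (k - 2)"
      by metis
    define A where "A = \<bar>C 1 1\<bar> + \<bar>C 1 2\<bar> + \<bar>C 2 1\<bar> + \<bar>C 2 2\<bar>"
    define M where "M = nat \<lceil>\<bar>k - 2\<bar> + 1\<rceil>"
    have CA: "C i j \<le> A" for i j using exhaust_2[of i] exhaust_2[of j] by (auto simp: A_def)
    have "bnd N (k - 2) (4 * A * (wt p * wt q) ^ M) (dif q (dif p (symbol_matrix a)))" for p q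
      unfolding bnd_def
    proof (intro allI)
      fix l n :: "int^2"
      define m where "m = l - n"
      define \<eta> where "\<eta> = freq p"
      define B where "B = 2 * (A / wt m ^ N) * (1 + norm \<eta>) powr (\<bar>k - 2\<bar> + 1)"
      \<comment> \<open>The difference in \<open>p\<close> of the first \<xi>-derivatives is bounded
        first; \<open>B\<close> then serves as the derivative bound when the difference in
        \<open>q\<close> is taken of the difference in \<open>p\<close>.\<close>
      have 1: "cmod (sig a [j] m (\<xi> + \<eta>) - sig a [j] m \<xi>) \<le> B * (1 + norm \<xi>) powr (k - 2)" for j \<xi>
        unfolding B_def
      proof (rule difference_bound[OF sig_derivative[OF a]])
        fix i \<xi>
        have "cmod (sig a [i, j] m \<xi>) * wt m ^ N \<le> A * (1 + norm \<xi>) powr (k - 2)"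
          using C[of i j m \<xi>] mult_right_mono[OF CA, of "(1 + norm \<xi>) powr (k - 2)" i j] by simp
        thus "cmod (sig a [i, j] m \<xi>) \<le> A / wt m ^ N * (1 + norm \<xi>) powr (k - 2)"
          by (simp add: pos_le_divide_eq)
      qed
      have "cmod ((sig a [] m (freq n + freq q + \<eta>) - sig a [] m (freq n + freq q))
            - (sig a [] m (freq n + \<eta>) - sig a [] m (freq n)))
          \<le> 2 * B * (1 + norm (freq q)) powr (\<bar>k - 2\<bar> + 1) * (1 + norm (freq n)) powr (k - 2)"
      proof (rule difference_bound[where F = "\<lambda>\<xi>. sig a [] m (\<xi> + \<eta>) - sig a [] m \<xi>"
            and G = "\<lambda>j \<xi>. sig a [j] m (\<xi> + \<eta>) - sig a [j] m \<xi>", OF _ 1])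
        fix \<xi> \<zeta> :: plane and t
        have "((\<lambda>t. sig a [] m (\<xi> + \<eta> + t *\<^sub>R \<zeta>) - sig a [] m (\<xi> + t *\<^sub>R \<zeta>)) has_vector_derivative
            (\<Sum>j\<in>UNIV. of_real (\<zeta> $ j) * sig a [j] m (\<xi> + \<eta> + t *\<^sub>R \<zeta>))
            - (\<Sum>j\<in>UNIV. of_real (\<zeta> $ j) * sig a [j] m (\<xi> + t *\<^sub>R \<zeta>))) (at t)"
          by (intro has_vector_derivative_diff sig_derivative[OF a])
        moreover have "\<xi> + \<eta> + t *\<^sub>R \<zeta> = \<xi> + t *\<^sub>R \<zeta> + \<eta>" for t by simp
        ultimately show "((\<lambda>t. sig a [] m (\<xi> + t *\<^sub>R \<zeta> + \<eta>) - sig a [] m (\<xi> + t *\<^sub>R \<zeta>)) has_vector_derivative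
            (\<Sum>j\<in>UNIV. of_real (\<zeta> $ j) * (sig a [j] m (\<xi> + t *\<^sub>R \<zeta> + \<eta>) - sig a [j] m (\<xi> + t *\<^sub>R \<zeta>)))) (at t)"
          by (simp only: right_diff_distrib sum_subtractf)
      qed
      also have "\<dots> = 4 * (A / wt m ^ N) * (wt p powr (\<bar>k - 2\<bar> + 1) * wt q powr (\<bar>k - 2\<bar> + 1)) * wt n powr (k - 2)"
        by (simp add: B_def \<eta>_def wt_def[symmetric])
      also have "\<dots> \<le> 4 * (A / wt m ^ N) * (wt p ^ M * wt q ^ M) * wt n powr (k - 2)"
        using wt_powr_le_nat[of _ "\<bar>k - 2\<bar> + 1"]
        by (intro mult_right_mono mult_left_mono mult_mono) (auto simp: M_def A_def)
      finally have "cmod (dif q (dif p (symbol_matrix a)) l n) \<le> (4 * A * (wt p * wt q) ^ M * wt n powr (k - 2)) / wt m ^ N"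
        by (simp add: dif_def symbol_matrix_def m_def \<eta>_def freq_add power_mult_distrib add_ac)
      thus "cmod (dif q (dif p (symbol_matrix a)) l n) * wt (l - n) ^ N \<le> 4 * A * (wt p * wt q) ^ M * wt n powr (k - 2)"
        by (simp add: pos_le_divide_eq m_def)
    qed
    thus "\<exists>A M. \<forall>i. bnd N (k - 2) (A * (case i of (p, q) \<Rightarrow> wt p * wt q) ^ M)
        (case i of (p, q) \<Rightarrow> dif q (dif p (symbol_matrix a)))"
      by (intro exI[of _ "4 * A"] exI[of _ M]) auto
  qed
qed

subsection \<open>Weak derivatives and products on the Fourier side\<close>

lemma hs_le:
  assumes "hs s x" "\<And>n. wt n powr t * cmod (y n) \<le> C * (wt n powr s * cmod (x n))"
  shows "hs t y" and "nrm2 t y \<le> C\<^sup>2 * nrm2 s x"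
proof -
  have le: "(wt n powr t * cmod (y n))\<^sup>2 \<le> C\<^sup>2 * (wt n powr s * cmod (x n))\<^sup>2" for n
    using power_mono[OF assms(2), of n 2] by (simp only: power_mult_distrib) simp
  have S: "((\<lambda>n. C\<^sup>2 * (wt n powr s * cmod (x n))\<^sup>2) has_sum C\<^sup>2 * nrm2 s x) UNIV"
    by (intro has_sum_cmult_right has_sum_nrm2 assms)
  show *: "hs t y"
    unfolding hs_def by (rule summable_on_comparison_test[OF has_sum_imp_summable[OF S]]) (use le in auto)
  show "nrm2 t y \<le> C\<^sup>2 * nrm2 s x"
    by (rule has_sum_mono[OF has_sum_nrm2[OF *] S]) (rule le)
qed

lemma hs_diff:
  assumes "hs s x" "hs s y"
  shows "hs s (\<lambda>n. x n - y n)"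
  unfolding hs_def
proof (rule summable_on_comparison_test)
  show "(\<lambda>n. 2 * (wt n powr s * cmod (x n))\<^sup>2 + 2 * (wt n powr s * cmod (y n))\<^sup>2) summable_on UNIV"
    using assms unfolding hs_def by (intro summable_on_add summable_on_cmult_right)
  fix n
  have "(wt n powr s * cmod (x n - y n))\<^sup>2 \<le> (wt n powr s * cmod (x n) + wt n powr s * cmod (y n))\<^sup>2"
    unfolding distrib_left[symmetric] by (intro power_mono mult_left_mono norm_triangle_ineq4) auto
  also have "\<dots> \<le> 2 * (wt n powr s * cmod (x n))\<^sup>2 + 2 * (wt n powr s * cmod (y n))\<^sup>2"
    using sum_squares_bound[of "wt n powr s * cmod (x n)" "wt n powr s * cmod (y n)"]
    unfolding power2_sum by linarith
  finally show "(wt n powr s * cmod (x n - y n))\<^sup>2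
      \<le> 2 * (wt n powr s * cmod (x n))\<^sup>2 + 2 * (wt n powr s * cmod (y n))\<^sup>2" .
qed simp

lemma rapid_summable:
  assumes "rapid \<gamma>"
  shows "(\<lambda>n. wt n powr s * cmod (\<gamma> n)) summable_on UNIV"
proof -
  define J where "J = nat \<lceil>s\<rceil>"
  obtain A where A: "\<And>p. cmod (\<gamma> p) * wt p ^ (J + 4) \<le> A"
    using assms unfolding rapid_def by metis
  show ?thesis
  proof (rule summable_on_comparison_test)
    show "(\<lambda>n. A * (1 / wt n ^ 4)) summable_on UNIV"
      by (intro summable_on_cmult_right summable_wt)
    fix n
    have "wt n powr s * cmod (\<gamma> n) * wt n ^ 4 \<le> wt n ^ J * cmod (\<gamma> n) * wt n ^ 4"
      unfolding J_def by (intro mult_right_mono wt_powr_le_nat) auto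
    also have "\<dots> \<le> A" using A[of n] by (simp add: power_add mult_ac)
    finally show "wt n powr s * cmod (\<gamma> n) \<le> A * (1 / wt n ^ 4)"
      by (simp add: pos_le_divide_eq)
  qed simp
qed

lemma rapid_hs:
  assumes "rapid \<gamma>"
  shows "hs s \<gamma>"
proof -
  obtain A where A: "\<And>p. cmod (\<gamma> p) * wt p ^ 0 \<le> A"
    using assms unfolding rapid_def by metis
  have S: "(\<lambda>n. A * (wt n powr (2 * s) * cmod (\<gamma> n))) summable_on UNIV"
    by (intro summable_on_cmult_right rapid_summable assms)
  have "(wt n powr s * cmod (\<gamma> n))\<^sup>2 \<le> A * (wt n powr (2 * s) * cmod (\<gamma> n))" for n
  proof -
    have "(wt n powr s * cmod (\<gamma> n))\<^sup>2 = cmod (\<gamma> n) * (wt n powr (2 * s) * cmod (\<gamma> n))"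
    proof -
      have "wt n powr (2 * s) = wt n powr s * wt n powr s" by (simp flip: powr_add)
      thus ?thesis by (simp add: power2_eq_square)
    qed
    also have "\<dots> \<le> A * (wt n powr (2 * s) * cmod (\<gamma> n))"
      using A[of n] by (intro mult_right_mono) auto
    finally show ?thesis .
  qed
  thus ?thesis unfolding hs_def by (rule summable_on_comparison_test[OF S]) simp
qed

lemma act_diff:
  assumes "ordm j K" "hs (s + j) x" "hs (s + j) y"
  shows "act K (\<lambda>n. x n - y n) l = act K x l - act K y l"
  unfolding act_def right_diff_distrib
  by (intro infsum_diff act_summable[OF assms(1,2)] act_summable[OF assms(1,3)])

lemma ip_fourier_real:
  "ip (fourier_coeff f) (fourier_coeff g) = complex_of_real (Re (ip (fourier_coeff f) (fourier_coeff g)))"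
proof -
  have "bij_betw uminus (UNIV :: (int^2) set) UNIV"
    by (rule bij_betwI[where g = uminus]) auto
  from infsum_reindex_bij_betw[OF this, of "\<lambda>n. fourier_coeff f n * cnj (fourier_coeff g n)"]
  have "ip (fourier_coeff f) (fourier_coeff g) = cnj (ip (fourier_coeff f) (fourier_coeff g))"
    unfolding ip_def infsum_cnj[symmetric] by (simp add: fourier_coeff_minus)
  thus ?thesis by (simp add: complex_eq_iff)
qed

text \<open>Parseval's identity for the real and imaginary parts of \<open>h\<close>, in bilinear
  form: \<open>- n\<close> takes the place of a conjugation. It is stated for complex
  \<open>h\<close> because \<open>fourier_coeff_mult\<close> tests with an exponential times a
  coefficient.\<close>

lemma parseval_complex:
  assumes f: "f \<in> L2_torus" and h: "continuous_on UNIV h" "periodic h"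
  shows "(LINT x|torus_measure. complex_of_real (f x) * h x) = (2 * pi)\<^sup>2 * (\<Sum>\<^sub>\<infinity>n. fourier_coeff f n * fc h (- n))"
proof -
  define u v where "u x = Re (h x)" and "v x = Im (h x)" for x
  have u: "u \<in> L2_torus" and v: "v \<in> L2_torus"
    using h(2) unfolding u_def v_def
    by (auto intro!: L2_torus_continuous continuous_intros h(1) simp: periodic_def)
  have h_eq: "h x = complex_of_real (u x) + \<i> * complex_of_real (v x)" for x
    by (simp add: u_def v_def complex_eq_iff)
  have I: "integrable torus_measure (\<lambda>x. complex_of_real (f x * u x))"
    "integrable torus_measure (\<lambda>x. complex_of_real (f x * v x))"
    by (simp_all only: complex_of_real_integrable_eq L2_torus_integrable_mult f u v)
  have "(LINT x|torus_measure. complex_of_real (f x) * h x)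
      = (LINT x|torus_measure. complex_of_real (f x * u x) + \<i> * complex_of_real (f x * v x))"
    by (simp add: h_eq algebra_simps)
  also have "\<dots> = complex_of_real (L2_inner f u) + \<i> * complex_of_real (L2_inner f v)"
    unfolding L2_inner_def integral_complex_of_real[symmetric] integral_mult_right_zero[symmetric]
    by (intro Bochner_Integration.integral_add integrable_mult_right I)
  also have "\<dots> = (2 * pi)\<^sup>2 * (ip (fourier_coeff f) (fourier_coeff u) + \<i> * ip (fourier_coeff f) (fourier_coeff v))"
    unfolding parseval[OF f u] parseval[OF f v]
    by (subst (3 4) ip_fourier_real) (simp add: algebra_simps)
  also have "ip (fourier_coeff f) (fourier_coeff u) + \<i> * ip (fourier_coeff f) (fourier_coeff v)
      = (\<Sum>\<^sub>\<infinity>n. fourier_coeff f n * cnj (fourier_coeff u n) + \<i> * (fourier_coeff f n * cnj (fourier_coeff v n)))"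
    unfolding ip_def infsum_cmult_right'[symmetric]
    using hs_fourier_coeff[OF f] hs_fourier_coeff[OF u] hs_fourier_coeff[OF v]
    by (intro infsum_add[symmetric] summable_on_cmult_right ip_summable[of 0]) simp_all
  also have "\<dots> = (\<Sum>\<^sub>\<infinity>n. fourier_coeff f n * fc h (- n))"
  proof (rule infsum_cong)
    fix n
    have "fc h (- n) = fc (\<lambda>x. complex_of_real (u x)) (- n) + \<i> * fc (\<lambda>x. complex_of_real (v x)) (- n)"
    proof -
      have J: "integrable torus_measure (\<lambda>x. ev n x * complex_of_real (w x))" if "continuous_on UNIV w" for w
        by (intro integrable_torus continuous_intros that)
      have "(LINT x|torus_measure. ev n x * h x)
          = (LINT x|torus_measure. ev n x * complex_of_real (u x) + \<i> * (ev n x * complex_of_real (v x)))"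
        by (simp add: h_eq algebra_simps)
      also have "\<dots> = (LINT x|torus_measure. ev n x * complex_of_real (u x))
          + \<i> * (LINT x|torus_measure. ev n x * complex_of_real (v x))"
        unfolding integral_mult_right_zero[symmetric]
        by (intro Bochner_Integration.integral_add integrable_mult_right J)
          (auto simp: u_def v_def intro!: continuous_intros h(1))
      finally show ?thesis by (simp add: fc_def add_divide_distrib)
    qed
    thus "fourier_coeff f n * cnj (fourier_coeff u n) + \<i> * (fourier_coeff f n * cnj (fourier_coeff v n))
        = fourier_coeff f n * fc h (- n)"
      unfolding fourier_coeff_eq_fc[symmetric] fourier_coeff_minus by (simp add: algebra_simps)
  qed
  finally show ?thesis .
qed

text \<open>The convolution theorem: \<open>b\<close> is absorbed into the test function
  \<open>ev (- l) x * b x\<close>, so only \<open>f\<close> has to be square integrable.\<close>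

lemma fourier_coeff_mult:
  assumes b: "b \<in> smooth_torus" and f: "f \<in> L2_torus"
  shows "fourier_coeff (\<lambda>x. b x * f x) l = act (tmat (fourier_coeff b)) (fourier_coeff f) l"
proof -
  define h where "h x = ev (- l) x * complex_of_real (b x)" for x
  have bc: "continuous_on UNIV b" "periodic b"
    using b by (auto simp: smooth_torus_def smooth_continuous)
  have "continuous_on UNIV h" unfolding h_def by (intro continuous_intros bc)
  moreover have "periodic h" using periodic_ev[of "- l"] bc(2) by (simp add: periodic_def h_def)
  ultimately have "(LINT x|torus_measure. complex_of_real (f x) * h x)
      = (2 * pi)\<^sup>2 * (\<Sum>\<^sub>\<infinity>n. fourier_coeff f n * fc h (- n))"
    by (rule parseval_complex[OF f])
  moreover have "fc h (- n) = fourier_coeff b (l - n)" for n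
  proof -
    have "ev n x * h x = ev (- (l - n)) x * complex_of_real (b x)" for x
      unfolding h_def mult.assoc[symmetric] ev_add[symmetric] by simp
    thus ?thesis by (simp add: fourier_coeff_eq_fc fc_def)
  qed
  moreover have "fourier_coeff (\<lambda>x. b x * f x) l = (LINT x|torus_measure. complex_of_real (f x) * h x) / (2 * pi)\<^sup>2"
    by (simp add: fourier_coeff_eq_fc fc_def h_def mult_ac)
  ultimately show ?thesis by (simp add: act_def tmat_def mult.commute)
qed

lemma smooth_torus_Re_tp: "(\<lambda>x. Re (tp F c x)) \<in> smooth_torus"
proof -
  define d where "d c v n = c n * (\<i> * of_real (freq n \<bullet> v))" for c :: "int^2 \<Rightarrow> complex" and v n
  have der: "((\<lambda>x. Re (tp F c x)) has_derivative (\<lambda>v. Re (tp F (d c v) x))) (at x)" for c x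
  proof -
    have "(tp F c has_derivative (\<lambda>v. \<Sum>n\<in>F. c n * (\<i> * of_real (freq n \<bullet> v) * ev n x))) (at x)"
      unfolding tp_def[abs_def] by (intro has_derivative_sum has_derivative_mult_right ev_has_derivative)
    hence "(tp F c has_derivative (\<lambda>v. tp F (d c v) x)) (at x)"
      by (simp add: tp_def[abs_def] d_def mult.assoc)
    thus ?thesis by (rule has_derivative_Re)
  qed
  have "smooth (\<lambda>x. Re (tp F c x))"
  proof (rule smooth_of_derivs[where F = "range (\<lambda>c x. Re (tp F c x))"], goal_cases)
    case (2 g v)
    then obtain c where g: "g = (\<lambda>x. Re (tp F c x))" by blast
    have "dir_deriv v g = (\<lambda>x. Re (tp F (d c v) x))"
      unfolding g by (rule dir_deriv_eq[OF der])
    thus ?case using der[of c] by (auto simp: g differentiable_def)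
  qed blast
  moreover have "periodic (\<lambda>x. Re (tp F c x))"
    using periodic_tp[of F c] by (simp add: periodic_def)
  ultimately show ?thesis by (simp add: smooth_torus_def)
qed

lemma dir_deriv_Re_ev: "dir_deriv v (\<lambda>x. Re (c * ev n x)) = (\<lambda>x. (freq n \<bullet> v) * Re (\<i> * c * ev n x))"
proof -
  have "((\<lambda>x. Re (c * ev n x)) has_derivative (\<lambda>v. Re (c * (\<i> * of_real (freq n \<bullet> v) * ev n x)))) (at x)" for x
    by (intro has_derivative_Re has_derivative_mult_right ev_has_derivative)
  from dir_deriv_eq[OF this] show ?thesis
    by (simp add: fun_eq_iff algebra_simps)
qed

lemma smooth_torus_Re_ev: "(\<lambda>x. Re (c * ev n x)) \<in> smooth_torus"
  using smooth_torus_Re_tp[of "{n}" "\<lambda>_. c"] by (simp add: tp_def)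

text \<open>A coefficient in terms of inner products with real test functions, the only ones that
  occur in \<open>is_weak_partial\<close>.\<close>

lemma fourier_coeff_L2_inner:
  assumes f: "f \<in> L2_torus"
  shows "(2 * pi)\<^sup>2 * fourier_coeff f n
    = complex_of_real (L2_inner f (\<lambda>x. Re (1 * ev n x))) + \<i> * complex_of_real (L2_inner f (\<lambda>x. Re (\<i> * ev n x)))"
proof -
  have e: "(\<lambda>x. Re (c * ev n x)) \<in> L2_torus" for c
    by (rule smooth_torus_L2[OF smooth_torus_Re_ev])
  have I: "integrable torus_measure (\<lambda>x. complex_of_real (f x * Re (c * ev n x)))" for c
    by (simp only: complex_of_real_integrable_eq L2_torus_integrable_mult f e)
  have "(2 * pi)\<^sup>2 * fourier_coeff f n = (LINT x|torus_measure. ev (- n) x * complex_of_real (f x))"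
    by (simp add: fourier_coeff_eq_fc fc_def)
  also have "\<dots> = (LINT x|torus_measure. complex_of_real (f x * Re (1 * ev n x)) + \<i> * complex_of_real (f x * Re (\<i> * ev n x)))"
    by (intro Bochner_Integration.integral_cong refl) (simp add: ev_minus complex_eq_iff)
  also have "\<dots> = complex_of_real (L2_inner f (\<lambda>x. Re (1 * ev n x))) + \<i> * complex_of_real (L2_inner f (\<lambda>x. Re (\<i> * ev n x)))"
    unfolding L2_inner_def integral_complex_of_real[symmetric] integral_mult_right_zero[symmetric]
    by (intro Bochner_Integration.integral_add integrable_mult_right I)
  finally show ?thesis .
qed

lemma L2_inner_cmult: "L2_inner f (\<lambda>x. a * h x) = a * L2_inner f h"
  unfolding L2_inner_def mult.left_commute[of _ a] by (rule integral_mult_right_zero)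

text \<open>Testing with the real functions \<open>Re (c * ev n x)\<close> for \<open>c = 1\<close>
  and \<open>c = \<i>\<close> determines the coefficients; the converse is Parseval's identity. The
  chosen representative is thereby known as far as its coefficients are.\<close>

lemma weak_partial_iff:
  assumes f: "f \<in> L2_torus"
  shows "is_weak_partial i f g \<longleftrightarrow> g \<in> L2_torus \<and> (\<forall>n. fourier_coeff g n = \<i> * of_int (n $ i) * fourier_coeff f n)"
proof (intro iffI conjI allI)
  assume w: "is_weak_partial i f g"
  thus g: "g \<in> L2_torus" by (simp add: is_weak_partial_def)
  fix n
  have key: "L2_inner g (\<lambda>x. Re (c * ev n x)) = - of_int (n $ i) * L2_inner f (\<lambda>x. Re (\<i> * c * ev n x))" for c
  proof -
    have "L2_inner g (\<lambda>x. Re (c * ev n x)) = - L2_inner f (dir_deriv (axis i 1) (\<lambda>x. Re (c * ev n x)))"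
      using w smooth_torus_Re_ev by (simp add: is_weak_partial_def)
    also have "\<dots> = - L2_inner f (\<lambda>x. of_int (n $ i) * Re (\<i> * c * ev n x))"
      unfolding dir_deriv_Re_ev by (simp add: inner_axis)
    also have "\<dots> = - of_int (n $ i) * L2_inner f (\<lambda>x. Re (\<i> * c * ev n x))"
      by (simp only: L2_inner_cmult mult_minus_left)
    finally show ?thesis .
  qed
  define A B where "A = L2_inner f (\<lambda>x. Re (1 * ev n x))" and "B = L2_inner f (\<lambda>x. Re (\<i> * ev n x))"
  have "L2_inner f (\<lambda>x. Re (\<i> * \<i> * ev n x)) = - A"
    by (simp add: A_def L2_inner_def)
  hence k: "L2_inner g (\<lambda>x. Re (1 * ev n x)) = - of_int (n $ i) * B"
    "L2_inner g (\<lambda>x. Re (\<i> * ev n x)) = of_int (n $ i) * A"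
    using key[of 1] key[of \<i>] by (simp_all only: mult_1_right B_def minus_mult_minus)
  have "(2 * pi)\<^sup>2 * fourier_coeff g n = \<i> * of_int (n $ i) * ((2 * pi)\<^sup>2 * fourier_coeff f n)"
    unfolding fourier_coeff_L2_inner[OF g] fourier_coeff_L2_inner[OF f] k A_def[symmetric] B_def[symmetric]
    by (simp add: algebra_simps)
  thus "fourier_coeff g n = \<i> * of_int (n $ i) * fourier_coeff f n" by simp
next
  assume g: "g \<in> L2_torus \<and> (\<forall>n. fourier_coeff g n = \<i> * of_int (n $ i) * fourier_coeff f n)"
  show "is_weak_partial i f g"
    unfolding is_weak_partial_def
  proof (intro conjI ballI)
    fix \<phi> assume \<phi>: "\<phi> \<in> smooth_torus"
    have d: "dir_deriv (axis i 1) \<phi> \<in> L2_torus"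
      by (rule smooth_torus_L2[OF dir_deriv_smooth_torus[OF \<phi>]])
    have "ip (fourier_coeff g) (fourier_coeff \<phi>) = - ip (fourier_coeff f) (fourier_coeff (dir_deriv (axis i 1) \<phi>))"
      unfolding ip_def infsum_uminus[symmetric] using g
      by (intro infsum_cong) (simp add: fourier_coeff_partial[OF \<phi>])
    thus "L2_inner g \<phi> = - L2_inner f (dir_deriv (axis i 1) \<phi>)"
      using parseval[OF _ smooth_torus_L2[OF \<phi>], of g] parseval[OF f d] g by simp
  qed (use g in simp)
qed

text \<open>One order of decay makes the differentiated coefficients square summable, so the
  Riesz-Fischer theorem shows that the choice in \<open>weak_partial\<close> is made from a nonempty
  set.\<close>

lemma weak_partial:
  assumes f: "f \<in> L2_torus" and h: "hs 1 (fourier_coeff f)"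
  shows "weak_partial i f \<in> L2_torus"
    and "fourier_coeff (weak_partial i f) n = \<i> * of_int (n $ i) * fourier_coeff f n"
proof -
  have "hs 0 (\<lambda>n. \<i> * of_int (n $ i) * fourier_coeff f n)"
    by (rule hs_le(1)[OF h, of _ _ 1]) (simp add: norm_mult mult_right_mono cmod_int_le_wt[simplified])
  then obtain g where "g \<in> L2_torus" "\<And>n. fourier_coeff g n = \<i> * of_int (n $ i) * fourier_coeff f n"
    using riesz_fischer[of "\<lambda>n. \<i> * of_int (n $ i) * fourier_coeff f n"]
    by (auto simp: fourier_coeff_minus)
  hence "is_weak_partial i f g" by (simp add: weak_partial_iff[OF f])
  hence "is_weak_partial i f (weak_partial i f)"
    unfolding weak_partial_def by (rule someI[of "is_weak_partial i f"])
  thus "weak_partial i f \<in> L2_torus"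
    "fourier_coeff (weak_partial i f) n = \<i> * of_int (n $ i) * fourier_coeff f n"
    by (simp_all add: weak_partial_iff[OF f])
qed

lemma first_order_fourier:
  assumes b: "\<And>i. b i \<in> smooth_torus" and c: "c \<in> smooth_torus"
    and Q: "\<And>f x. Q f x = (\<Sum>i\<in>UNIV. b i x * weak_partial i f x) + c x * f x"
    and f: "f \<in> L2_torus" and h: "hs 1 (fourier_coeff f)"
  shows "Q f \<in> L2_torus"
    and "fourier_coeff (Q f) = act (dmat (\<lambda>i. fourier_coeff (b i)) (fourier_coeff c)) (fourier_coeff f)"
proof -
  note w = weak_partial[OF f h]
  let ?t = "\<lambda>i x. b i x * weak_partial i f x"
  have t: "?t i \<in> L2_torus" for i by (rule L2_torus_mult[OF b w(1)])
  have cf: "(\<lambda>x. c x * f x) \<in> L2_torus" by (rule L2_torus_mult[OF c f])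
  have t12: "(\<lambda>x. ?t 1 x + ?t 2 x) \<in> L2_torus" by (rule L2_torus_add[OF t t])
  have Qf: "Q f = (\<lambda>x. (?t 1 x + ?t 2 x) + c x * f x)"
    by (simp add: fun_eq_iff Q sum_2)
  show "Q f \<in> L2_torus" unfolding Qf by (rule L2_torus_add[OF t12 cf])
  show "fourier_coeff (Q f) = act (dmat (\<lambda>i. fourier_coeff (b i)) (fourier_coeff c)) (fourier_coeff f)"
  proof
    fix l
    have s: "(\<lambda>n. fourier_coeff (b i) (l - n) * (\<i> * of_int (n $ i) * fourier_coeff f n)) summable_on UNIV" for i
      using act_summable[OF ordm_tmat[OF rapid_fourier_coeff[OF b]], of 0 "fourier_coeff (weak_partial i f)" i l]
        hs_fourier_coeff[OF w(1)] by (simp add: tmat_def w(2))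
    have sc: "(\<lambda>n. fourier_coeff c (l - n) * fourier_coeff f n) summable_on UNIV"
      using act_summable[OF ordm_tmat[OF rapid_fourier_coeff[OF c]], of 0 "fourier_coeff f" l]
        hs_fourier_coeff[OF f] by (simp add: tmat_def)
    have "fourier_coeff (Q f) l = (\<Sum>\<^sub>\<infinity>n. fourier_coeff (b 1) (l - n) * (\<i> * of_int (n $ 1) * fourier_coeff f n))
        + (\<Sum>\<^sub>\<infinity>n. fourier_coeff (b 2) (l - n) * (\<i> * of_int (n $ 2) * fourier_coeff f n))
        + (\<Sum>\<^sub>\<infinity>n. fourier_coeff c (l - n) * fourier_coeff f n)"
      unfolding Qf fourier_coeff_add[OF t12 cf] fourier_coeff_add[OF t t]
        fourier_coeff_mult[OF b w(1)] fourier_coeff_mult[OF c f]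
      by (simp add: act_def tmat_def w(2))
    also have "\<dots> = (\<Sum>\<^sub>\<infinity>n. fourier_coeff (b 1) (l - n) * (\<i> * of_int (n $ 1) * fourier_coeff f n)
        + fourier_coeff (b 2) (l - n) * (\<i> * of_int (n $ 2) * fourier_coeff f n)
        + fourier_coeff c (l - n) * fourier_coeff f n)"
      by (simp only: infsum_add[OF summable_on_add[OF s s] sc] infsum_add[OF s s])
    also have "\<dots> = act (dmat (\<lambda>i. fourier_coeff (b i)) (fourier_coeff c)) (fourier_coeff f) l"
      unfolding act_def dmat_def by (intro infsum_cong) (simp add: sum_2 algebra_simps)
    finally show "fourier_coeff (Q f) l = act (dmat (\<lambda>i. fourier_coeff (b i)) (fourier_coeff c)) (fourier_coeff f) l" .
  qed
qed


subsection \<open>Sobolev norms\<close>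

definition jb :: "real \<Rightarrow> int^2 \<Rightarrow> real" where
  "jb s n = (1 + (norm (freq n))\<^sup>2) powr (s / 2)"

lemma jb_nonneg: "0 \<le> jb s n"
  by (simp add: jb_def)

lemma jb_le_wt:
  assumes "0 \<le> s"
  shows "jb s n \<le> wt n powr s"
proof -
  have "1 + (norm (freq n))\<^sup>2 \<le> (wt n)\<^sup>2"
    by (simp add: wt_def power2_sum)
  hence "jb s n \<le> ((wt n)\<^sup>2) powr (s / 2)"
    unfolding jb_def using assms by (intro powr_mono2) auto
  also have "\<dots> = wt n powr s"
    by (simp add: powr_powr flip: powr_numeral)
  finally show ?thesis .
qed

lemma wt_le_jb:
  assumes "0 \<le> s"
  shows "wt n powr s \<le> 2 powr s * jb s n"
proof -
  have "(wt n)\<^sup>2 \<le> 2\<^sup>2 * (1 + (norm (freq n))\<^sup>2)"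
  proof -
    define x where "x = norm (freq n)"
    have "2 * x \<le> 1 + x\<^sup>2" "0 \<le> x\<^sup>2"
      using sum_squares_bound[of 1 x] by simp_all
    moreover have "(wt n)\<^sup>2 = 1 + x\<^sup>2 + 2 * x" "2\<^sup>2 * (1 + (norm (freq n))\<^sup>2) = 4 + 4 * x\<^sup>2"
      by (simp_all add: wt_def x_def power2_sum)
    ultimately show ?thesis by linarith
  qed
  hence "((wt n)\<^sup>2) powr (s / 2) \<le> (2\<^sup>2 * (1 + (norm (freq n))\<^sup>2)) powr (s / 2)"
    using assms by (intro powr_mono2) auto
  moreover have "((wt n)\<^sup>2) powr (s / 2) = wt n powr s"
    by (simp add: powr_powr flip: powr_numeral)
  moreover have "(2\<^sup>2 * (1 + (norm (freq n))\<^sup>2)) powr (s / 2) = 2 powr s * jb s n"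
  proof -
    have "((2::real)\<^sup>2) powr (s / 2) = 2 powr s"
      by (subst powr_numeral[symmetric]) (simp_all only: powr_powr, simp_all)
    thus ?thesis by (simp only: powr_mult jb_def)
  qed
  ultimately show ?thesis by (simp only:)
qed

lemma is_bessel_iff:
  "is_bessel s f g \<longleftrightarrow> g \<in> L2_torus \<and> (\<forall>n. fourier_coeff g n = complex_of_real (jb s n) * fourier_coeff f n)"
  by (simp add: is_bessel_def jb_def)

lemma sobolev_hs:
  assumes s: "0 \<le> s" and f: "f \<in> sobolev s"
  shows "f \<in> L2_torus" "hs s (fourier_coeff f)"
proof -
  obtain g where g: "is_bessel s f g" and fL: "f \<in> L2_torus" using f by (auto simp: sobolev_def)
  show "f \<in> L2_torus" by (rule fL)
  show "hs s (fourier_coeff f)"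
  proof (rule hs_le(1)[OF hs_fourier_coeff])
    show "g \<in> L2_torus" using g by (simp add: is_bessel_iff)
    fix n
    have "wt n powr s * cmod (fourier_coeff f n) \<le> 2 powr s * jb s n * cmod (fourier_coeff f n)"
      by (intro mult_right_mono wt_le_jb s) simp
    thus "wt n powr s * cmod (fourier_coeff f n) \<le> 2 powr s * (wt n powr 0 * cmod (fourier_coeff g n))"
      using g by (simp add: is_bessel_iff norm_mult jb_nonneg mult.assoc)
  qed
qed

text \<open>The Riesz-Fischer theorem first ensures that \<open>bessel s f\<close> is a genuine
  choice; then the two weights are compared, which is where \<open>2 powr s\<close> comes
  from.\<close>

lemma sobolev_norm_bounds:
  assumes s: "0 \<le> s" and f: "f \<in> L2_torus" and h: "hs s (fourier_coeff f)"
  shows "(2 * pi)\<^sup>2 * nrm2 s (fourier_coeff f) \<le> (2 powr s)\<^sup>2 * (sobolev_norm s f)\<^sup>2"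
    and "(sobolev_norm s f)\<^sup>2 \<le> (2 * pi)\<^sup>2 * nrm2 s (fourier_coeff f)"
proof -
  have le: "jb s n * cmod (fourier_coeff f n) \<le> wt n powr s * cmod (fourier_coeff f n)" for n
    by (intro mult_right_mono jb_le_wt s) simp
  have "hs 0 (\<lambda>n. complex_of_real (jb s n) * fourier_coeff f n)"
    by (rule hs_le(1)[OF h, of _ _ 1]) (use le in \<open>simp add: norm_mult jb_nonneg\<close>)
  moreover have "complex_of_real (jb s (- n)) * fourier_coeff f (- n) = cnj (complex_of_real (jb s n) * fourier_coeff f n)" for n
    by (simp add: fourier_coeff_minus jb_def freq_minus)
  ultimately obtain g where "g \<in> L2_torus" "\<And>n. fourier_coeff g n = complex_of_real (jb s n) * fourier_coeff f n"
    using riesz_fischer[of "\<lambda>n. complex_of_real (jb s n) * fourier_coeff f n"] by blast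
  hence "is_bessel s f g" by (simp add: is_bessel_iff)
  hence "is_bessel s f (bessel s f)" unfolding bessel_def by (rule someI[of "is_bessel s f"])
  hence B: "bessel s f \<in> L2_torus" "\<And>n. fourier_coeff (bessel s f) n = complex_of_real (jb s n) * fourier_coeff f n"
    by (auto simp: is_bessel_iff)
  have "(sobolev_norm s f)\<^sup>2 = L2_inner (bessel s f) (bessel s f)"
    unfolding sobolev_norm_def L2_norm_def
    by (rule real_sqrt_pow2) (simp add: L2_inner_def Bochner_Integration.integral_nonneg)
  hence S: "(sobolev_norm s f)\<^sup>2 = (2 * pi)\<^sup>2 * nrm2 0 (fourier_coeff (bessel s f))"
    using parseval_norm[OF B(1)] by simp
  have "nrm2 s (fourier_coeff f) \<le> (2 powr s)\<^sup>2 * nrm2 0 (fourier_coeff (bessel s f))"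
  proof (rule hs_le(2)[OF hs_fourier_coeff[OF B(1)]])
    fix n
    have "wt n powr s * cmod (fourier_coeff f n) \<le> 2 powr s * jb s n * cmod (fourier_coeff f n)"
      by (intro mult_right_mono wt_le_jb s) simp
    thus "wt n powr s * cmod (fourier_coeff f n) \<le> 2 powr s * (wt n powr 0 * cmod (fourier_coeff (bessel s f) n))"
      by (simp add: B(2) norm_mult jb_nonneg mult.assoc)
  qed
  from mult_left_mono[OF this, of "(2 * pi)\<^sup>2"]
  show "(2 * pi)\<^sup>2 * nrm2 s (fourier_coeff f) \<le> (2 powr s)\<^sup>2 * (sobolev_norm s f)\<^sup>2"
    unfolding S by (simp only: mult.left_commute[of "(2 powr s)\<^sup>2"]) simp
  have "nrm2 0 (fourier_coeff (bessel s f)) \<le> 1\<^sup>2 * nrm2 s (fourier_coeff f)"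
    by (rule hs_le(2)[OF h]) (use le in \<open>simp add: B(2) norm_mult jb_nonneg\<close>)
  thus "(sobolev_norm s f)\<^sup>2 \<le> (2 * pi)\<^sup>2 * nrm2 s (fourier_coeff f)"
    unfolding S by (intro mult_left_mono) auto
qed

lemma L2_norm_sq: "f \<in> L2_torus \<Longrightarrow> (L2_norm f)\<^sup>2 = (2 * pi)\<^sup>2 * nrm2 0 (fourier_coeff f)"
  unfolding parseval_norm[symmetric] L2_norm_def
  by (rule real_sqrt_pow2) (simp add: L2_inner_def Bochner_Integration.integral_nonneg)

subsection \<open>The action of pseudodifferential operators on Fourier coefficients\<close>

text \<open>Coefficients of smooth functions decay rapidly and symbols grow polynomially, so the
  defining series has a summable majorant independent of \<open>x\<close>. It bounds
  \<open>P u\<close> and justifies integrating term by term against \<open>ev (- l)\<close>.\<close>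

lemma pseudodiff_fourier:
  assumes a: "a \<in> symbol_class k"
    and P: "\<And>u x. u \<in> smooth_torus \<Longrightarrow>
      ((\<lambda>n. a (x, freq n) * fourier_coeff u n * cis (freq n \<bullet> x)) has_sum complex_of_real (P u x)) UNIV"
    and u: "u \<in> smooth_torus"
  shows "P u \<in> L2_torus" and "fourier_coeff (P u) = act (symbol_matrix a) (fourier_coeff u)"
proof -
  define F where "F n x = a (x, freq n) * fourier_coeff u n * ev n x" for n x
  have F_sum: "((\<lambda>n. F n x) has_sum complex_of_real (P u x)) UNIV" for x
    unfolding F_def ev_def by (rule P[OF u])
  obtain C0 where C0: "\<And>x \<xi>. cmod (a (x, \<xi>)) \<le> C0 * (1 + norm \<xi>) powr k"
  proof -
    have "\<exists>C. \<forall>x \<xi>. norm (foldr (\<lambda>i. dir_deriv (axis i 1, 0)) []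
        (foldr (\<lambda>j. dir_deriv (0, axis j 1)) [] a) (x, \<xi>)) \<le> C * (1 + norm \<xi>) powr (k - real (length ([] :: 2 list)))"
      using a unfolding symbol_class_def by blast
    thus ?thesis using that by auto
  qed
  define c where "c n = C0 * (wt n powr k * cmod (fourier_coeff u n))" for n
  have F_le: "cmod (F n x) \<le> c n * 1" for n x
    using mult_right_mono[OF C0[of x "freq n"], of "cmod (fourier_coeff u n)"]
    by (simp add: F_def c_def norm_mult wt_def mult.assoc)
  have c: "c summable_on UNIV"
    unfolding c_def[abs_def] by (intro summable_on_cmult_right rapid_summable rapid_fourier_coeff u)
  have ca: "continuous_on UNIV (\<lambda>x. a (x, \<xi>))" for \<xi>
    by (rule smooth_continuous[OF smooth_slice(1)]) (use a in \<open>simp add: symbol_class_def\<close>)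
  have F_cont: "continuous_on UNIV (F n)" for n
    unfolding F_def[abs_def] by (intro continuous_intros ca)
  have F_per: "F n (x + axis i (2 * pi)) = F n x" for n x i
    using periodicD[OF periodic_symbol[OF a, of "[]" "freq n"], of x i] periodicD[OF periodic_ev[of n], of x i]
    by (simp add: F_def)
  have per: "periodic (P u)"
    unfolding periodic_def
  proof (intro allI)
    fix x i
    have "complex_of_real (P u (x + axis i (2 * pi))) = complex_of_real (P u x)"
      by (rule has_sum_unique[OF F_sum[of "x + axis i (2 * pi)", unfolded F_per] F_sum])
    thus "P u (x + axis i (2 * pi)) = P u x" by simp
  qed
  have meas: "P u \<in> borel_measurable lebesgue"
  proof (rule borel_measurable_LIMSEQ_metric)
    fix j
    have "continuous_on UNIV (\<lambda>x. Re (\<Sum>n\<in>freq_box j. F n x))"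
      by (intro continuous_intros F_cont)
    thus "(\<lambda>x. Re (\<Sum>n\<in>freq_box j. F n x)) \<in> borel_measurable lebesgue"
      by (rule borel_measurable_continuous_lebesgue)
  next
    fix x
    show "(\<lambda>j. Re (\<Sum>n\<in>freq_box j. F n x)) \<longlonglongrightarrow> P u x"
      using tendsto_Re[OF has_sum_freq_box[OF F_sum]] by simp
  qed
  have bnd: "\<bar>P u x\<bar> \<le> infsum c UNIV" for x
  proof -
    have "norm (complex_of_real (P u x)) \<le> infsum c UNIV"
      using F_le by (intro norm_infsum_le[OF F_sum has_sum_infsum[OF c]]) simp
    thus ?thesis by simp
  qed
  show L2: "P u \<in> L2_torus"
  proof -
    have "integrable torus_measure (\<lambda>x. (P u x)\<^sup>2)"
    proof (rule Bochner_Integration.integrable_bound)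
      show "integrable torus_measure (\<lambda>x. (infsum c UNIV)\<^sup>2)" by simp
      show "(\<lambda>x. (P u x)\<^sup>2) \<in> borel_measurable torus_measure"
        using measurable_torus[OF meas] by simp
      have "(P u x)\<^sup>2 \<le> (infsum c UNIV)\<^sup>2" for x
        using power_mono[OF bnd[of x], of 2] by simp
      thus "AE x in torus_measure. norm ((P u x)\<^sup>2) \<le> norm ((infsum c UNIV)\<^sup>2)" by simp
    qed
    thus ?thesis using per meas by (simp add: L2_torus_def)
  qed
  show "fourier_coeff (P u) = act (symbol_matrix a) (fourier_coeff u)"
  proof
    fix l
    have "((\<lambda>n. LINT x|torus_measure. ev (- l) x * F n x)
        has_sum (LINT x|torus_measure. ev (- l) x * complex_of_real (P u x))) UNIV"
    proof (rule has_sum_integral(2)[OF _ c])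
      show "integrable torus_measure (\<lambda>x. ev (- l) x * F n x)" for n
        by (intro integrable_torus continuous_intros F_cont)
      show "integrable torus_measure (\<lambda>x. 1 :: real)" by simp
      show "cmod (ev (- l) x * F n x) \<le> c n * 1" for n x
        using F_le[of n x] by (simp add: norm_mult)
      show "((\<lambda>n. ev (- l) x * F n x) has_sum ev (- l) x * complex_of_real (P u x)) UNIV" for x
        by (rule has_sum_cmult_right[OF F_sum])
    qed
    moreover have "(LINT x|torus_measure. ev (- l) x * F n x)
        = (2 * pi)\<^sup>2 * (symbol_matrix a l n * fourier_coeff u n)" for n
    proof -
      have "ev (- l) x * F n x = fourier_coeff u n * (ev (- (l - n)) x * a (x, freq n))" for x
        unfolding F_def using ev_add[of "- l" n x] by simp
      thus ?thesis by (simp add: symbol_matrix_def sig_def fc_def)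
    qed
    ultimately have "((\<lambda>n. (2 * pi)\<^sup>2 * (symbol_matrix a l n * fourier_coeff u n))
        has_sum ((2 * pi)\<^sup>2 * fourier_coeff (P u) l)) UNIV"
      by (simp add: fourier_coeff_eq_fc fc_def)
    hence "((\<lambda>n. symbol_matrix a l n * fourier_coeff u n) has_sum fourier_coeff (P u) l) UNIV"
      by (subst (asm) has_sum_cmult_right_iff) auto
    thus "fourier_coeff (P u) l = act (symbol_matrix a) (fourier_coeff u) l"
      unfolding act_def by (rule infsumI[symmetric])
  qed
qed

lemma tendsto_of_nrm2:
  fixes x :: "nat \<Rightarrow> int^2 \<Rightarrow> complex"
  assumes h: "\<And>j. hs 0 (\<lambda>n. x j n - y n)" and lim: "(\<lambda>j. nrm2 0 (\<lambda>n. x j n - y n)) \<longlonglongrightarrow> 0"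
  shows "(\<lambda>j. x j n) \<longlonglongrightarrow> y n"
proof -
  have "(\<lambda>j. (cmod (x j n - y n))\<^sup>2) \<longlonglongrightarrow> 0"
  proof (rule tendsto_sandwich[OF _ _ tendsto_const lim])
    show "\<forall>\<^sub>F j in sequentially. (cmod (x j n - y n))\<^sup>2 \<le> nrm2 0 (\<lambda>n. x j n - y n)"
      using le_nrm2[OF h] by simp
  qed simp
  hence "(\<lambda>j. sqrt ((cmod (x j n - y n))\<^sup>2)) \<longlonglongrightarrow> sqrt 0" by (rule tendsto_real_sqrt)
  hence "(\<lambda>j. x j n - y n) \<longlonglongrightarrow> 0" by (simp add: tendsto_norm_zero_iff)
  thus ?thesis by (rule LIM_zero_cancel)
qed

lemma nrm2_truncation:
  assumes h: "hs s x"
  shows "hs s (\<lambda>n. (if n \<in> freq_box j then x n else 0) - x n)"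
    and "(\<lambda>j. nrm2 s (\<lambda>n. (if n \<in> freq_box j then x n else 0) - x n)) \<longlonglongrightarrow> 0"
proof -
  have eq: "(wt n powr s * cmod ((if n \<in> freq_box j then x n else 0) - x n))\<^sup>2
      = (wt n powr s * cmod (x n))\<^sup>2 - (if n \<in> freq_box j then (wt n powr s * cmod (x n))\<^sup>2 else 0)" for n j
    by simp
  have "((\<lambda>n. (wt n powr s * cmod ((if n \<in> freq_box j then x n else 0) - x n))\<^sup>2)
      has_sum (nrm2 s x - (\<Sum>n\<in>freq_box j. (wt n powr s * cmod (x n))\<^sup>2))) UNIV" for j
  proof -
    have "((\<lambda>n. if n \<in> freq_box j then (wt n powr s * cmod (x n))\<^sup>2 else 0)
        has_sum (\<Sum>n\<in>freq_box j. (wt n powr s * cmod (x n))\<^sup>2)) UNIV"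
      by (rule has_sum_finite_neutralI[of "freq_box j"]) auto
    from has_sum_add[OF has_sum_nrm2[OF h] has_sum_uminusI[OF this]]
    show ?thesis unfolding eq by (simp only: diff_conv_add_uminus)
  qed
  note S = this
  show "hs s (\<lambda>n. (if n \<in> freq_box j then x n else 0) - x n)" for j
    unfolding hs_def by (rule has_sum_imp_summable[OF S])
  have "nrm2 s (\<lambda>n. (if n \<in> freq_box j then x n else 0) - x n)
      = nrm2 s x - (\<Sum>n\<in>freq_box j. (wt n powr s * cmod (x n))\<^sup>2)" for j
    unfolding nrm2_def[of s "\<lambda>n. (if n \<in> freq_box j then x n else 0) - x n"] by (rule infsumI[OF S])
  moreover have "(\<lambda>j. nrm2 s x - (\<Sum>n\<in>freq_box j. (wt n powr s * cmod (x n))\<^sup>2)) \<longlonglongrightarrow> nrm2 s x - nrm2 s x"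
    by (intro tendsto_diff tendsto_const has_sum_freq_box has_sum_nrm2 h)
  ultimately show "(\<lambda>j. nrm2 s (\<lambda>n. (if n \<in> freq_box j then x n else 0) - x n)) \<longlonglongrightarrow> 0"
    by simp
qed

text \<open>Existence of an extension value comes from the truncated Fourier series of
  \<open>g\<close> and the boundedness of \<open>K\<close> from order \<open>k\<close> to order 0.
  Uniqueness at the level of coefficients holds for any approximating sequence, since both limits
  can be read off coefficient by coefficient.\<close>

lemma sobolev_ext_fourier:
  assumes k: "0 \<le> k" and K: "ordm k K"
    and P: "\<And>u. u \<in> smooth_torus \<Longrightarrow> P u \<in> L2_torus"
      "\<And>u. u \<in> smooth_torus \<Longrightarrow> fourier_coeff (P u) = act K (fourier_coeff u)"
    and g: "g \<in> L2_torus" and h: "hs k (fourier_coeff g)"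
  shows "sobolev_ext k P g \<in> L2_torus" and "fourier_coeff (sobolev_ext k P g) = act K (fourier_coeff g)"
proof -
  have h': "hs (0 + k) (fourier_coeff g)" using h by simp
  obtain C where C: "0 \<le> C" "\<And>x. hs (0 + k) x \<Longrightarrow> nrm2 0 (act K x) \<le> C * nrm2 (0 + k) x"
    using nrm2_act[OF K, of 0] by metis
  have hu: "hs (0 + k) (fourier_coeff u)" if "u \<in> smooth_torus" for u
    by (rule rapid_hs[OF rapid_fourier_coeff[OF that]])
  have act_lim: "(\<lambda>j. nrm2 0 (\<lambda>l. act K (fourier_coeff (u j)) l - act K (fourier_coeff g) l)) \<longlonglongrightarrow> 0"
    and act_hs: "\<And>j. hs 0 (\<lambda>l. act K (fourier_coeff (u j)) l - act K (fourier_coeff g) l)"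
    if u: "\<And>j. u j \<in> smooth_torus"
      and lim: "(\<lambda>j. nrm2 k (\<lambda>n. fourier_coeff (u j) n - fourier_coeff g n)) \<longlonglongrightarrow> 0" for u :: "nat \<Rightarrow> _"
  proof -
    have d: "hs (0 + k) (\<lambda>n. fourier_coeff (u j) n - fourier_coeff g n)" for j
      by (rule hs_diff[OF hu[OF u] h'])
    have eq: "(\<lambda>l. act K (fourier_coeff (u j)) l - act K (fourier_coeff g) l)
        = act K (\<lambda>n. fourier_coeff (u j) n - fourier_coeff g n)" for j
      by (rule ext) (rule act_diff[OF K hu[OF u] h', symmetric])
    show "hs 0 (\<lambda>l. act K (fourier_coeff (u j)) l - act K (fourier_coeff g) l)" for j
      unfolding eq by (rule hs_act[OF K d])
    show "(\<lambda>j. nrm2 0 (\<lambda>l. act K (fourier_coeff (u j)) l - act K (fourier_coeff g) l)) \<longlonglongrightarrow> 0"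
      unfolding eq
    proof (rule tendsto_sandwich[OF _ _ tendsto_const])
      show "(\<lambda>j. C * nrm2 k (\<lambda>n. fourier_coeff (u j) n - fourier_coeff g n)) \<longlonglongrightarrow> 0"
        using tendsto_mult_right_zero[OF lim] by simp
      show "\<forall>\<^sub>F j in sequentially. nrm2 0 (act K (\<lambda>n. fourier_coeff (u j) n - fourier_coeff g n))
          \<le> C * nrm2 k (\<lambda>n. fourier_coeff (u j) n - fourier_coeff g n)"
        using C(2)[OF d] by simp
    qed (simp add: nrm2_nonneg)
  qed
  have diff_coeff: "fourier_coeff (\<lambda>x. f1 x - f2 x) = (\<lambda>n. fourier_coeff f1 n - fourier_coeff f2 n)"
    if "f1 \<in> L2_torus" "f2 \<in> L2_torus" for f1 f2
    by (rule ext) (rule fourier_coeff_diff[OF that])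
  have ex: "\<exists>e. is_extension_value k P g e"
  proof -
    define u where "u j x = Re (tp (freq_box j) (fourier_coeff g) x)" for j :: nat and x
    have u: "u j \<in> smooth_torus" for j unfolding u_def by (rule smooth_torus_Re_tp)
    have uc: "fourier_coeff (u j) = (\<lambda>n. if n \<in> freq_box j then fourier_coeff g n else 0)" for j
    proof -
      have "(\<lambda>x. complex_of_real (u j x)) = tp (freq_box j) (fourier_coeff g)"
        unfolding u_def by (rule ext, rule of_real_Re_tp) (rule freq_box_minus, rule fourier_coeff_minus)
      thus ?thesis by (simp add: fun_eq_iff fourier_coeff_eq_fc fc_tp)
    qed
    have ulim: "(\<lambda>j. nrm2 k (\<lambda>n. fourier_coeff (u j) n - fourier_coeff g n)) \<longlonglongrightarrow> 0"
      unfolding uc by (rule nrm2_truncation(2)[OF h])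
    note lims = act_lim[of u, OF u ulim] act_hs[of u, OF u ulim]
    \<comment> \<open>The hypotheses say that \<open>P\<close> is real only on smooth functions, so
      hermitian symmetry is inherited in the limit from the coefficients of \<open>P (u j)\<close>;
      the Riesz-Fischer theorem needs it.\<close>
    have "act K (fourier_coeff g) (- l) = cnj (act K (fourier_coeff g) l)" for l
    proof (rule LIMSEQ_unique)
      show "(\<lambda>j. act K (fourier_coeff (u j)) (- l)) \<longlonglongrightarrow> act K (fourier_coeff g) (- l)"
        by (rule tendsto_of_nrm2[OF lims(2,1)])
      have "act K (fourier_coeff (u j)) (- l) = cnj (act K (fourier_coeff (u j)) l)" for j
        unfolding P(2)[OF u, symmetric] by (rule fourier_coeff_minus)
      thus "(\<lambda>j. act K (fourier_coeff (u j)) (- l)) \<longlonglongrightarrow> cnj (act K (fourier_coeff g) l)"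
        using tendsto_cnj[OF tendsto_of_nrm2[OF lims(2,1)]] by simp
    qed
    then obtain e where e: "e \<in> L2_torus" "\<And>n. fourier_coeff e n = act K (fourier_coeff g) n"
      using riesz_fischer[of "act K (fourier_coeff g)"] hs_act[OF K h'] by blast
    have "is_extension_value k P g e"
      unfolding is_extension_value_def
    proof (intro conjI exI[of _ u] allI)
      show "(\<lambda>j. sobolev_norm k (\<lambda>x. u j x - g x)) \<longlonglongrightarrow> 0"
      proof -
        have d: "(\<lambda>x. u j x - g x) \<in> L2_torus" for j
          by (rule L2_torus_diff[OF smooth_torus_L2[OF u] g])
        have hd: "hs k (fourier_coeff (\<lambda>x. u j x - g x))" for j
          unfolding diff_coeff[OF smooth_torus_L2[OF u] g] using hs_diff[OF hu[OF u] h'] by simp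
        have "(\<lambda>j. (sobolev_norm k (\<lambda>x. u j x - g x))\<^sup>2) \<longlonglongrightarrow> 0"
        proof (rule tendsto_sandwich[OF _ _ tendsto_const])
          show "(\<lambda>j. (2 * pi)\<^sup>2 * nrm2 k (\<lambda>n. fourier_coeff (u j) n - fourier_coeff g n)) \<longlonglongrightarrow> 0"
            using tendsto_mult_right_zero[OF ulim] by simp
          show "\<forall>\<^sub>F j in sequentially. (sobolev_norm k (\<lambda>x. u j x - g x))\<^sup>2
              \<le> (2 * pi)\<^sup>2 * nrm2 k (\<lambda>n. fourier_coeff (u j) n - fourier_coeff g n)"
            using sobolev_norm_bounds(2)[OF k d hd] unfolding diff_coeff[OF smooth_torus_L2[OF u] g] by simp
        qed simp
        thus ?thesis by simp
      qed
      show "(\<lambda>j. L2_norm (\<lambda>x. P (u j) x - e x)) \<longlonglongrightarrow> 0"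
      proof -
        have "(L2_norm (\<lambda>x. P (u j) x - e x))\<^sup>2
            = (2 * pi)\<^sup>2 * nrm2 0 (\<lambda>l. act K (fourier_coeff (u j)) l - act K (fourier_coeff g) l)" for j
          unfolding L2_norm_sq[OF L2_torus_diff[OF P(1)[OF u] e(1)]] diff_coeff[OF P(1)[OF u] e(1)] e(2) P(2)[OF u] ..
        hence "(\<lambda>j. (L2_norm (\<lambda>x. P (u j) x - e x))\<^sup>2) \<longlonglongrightarrow> 0"
          using tendsto_mult_right_zero[OF lims(1)] by simp
        thus ?thesis by simp
      qed
    qed (use u e in auto)
    thus ?thesis by blast
  qed
  hence E: "is_extension_value k P g (sobolev_ext k P g)"
    unfolding sobolev_ext_def by (rule someI_ex)
  \<comment> \<open>This is the unknown sequence behind the choice in \<open>sobolev_ext\<close>,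
    unrelated to the truncations used for existence.\<close>
  then obtain u :: "nat \<Rightarrow> plane \<Rightarrow> real" where eL: "sobolev_ext k P g \<in> L2_torus" and u: "\<And>j. u j \<in> smooth_torus"
    and l1: "(\<lambda>j. sobolev_norm k (\<lambda>x. u j x - g x)) \<longlonglongrightarrow> 0"
    and l2: "(\<lambda>j. L2_norm (\<lambda>x. P (u j) x - sobolev_ext k P g x)) \<longlonglongrightarrow> 0"
    unfolding is_extension_value_def by blast
  show "sobolev_ext k P g \<in> L2_torus" by (rule eL)
  have d: "(\<lambda>x. u j x - g x) \<in> L2_torus" for j
    by (rule L2_torus_diff[OF smooth_torus_L2[OF u] g])
  have hd: "hs k (fourier_coeff (\<lambda>x. u j x - g x))" for j
    unfolding diff_coeff[OF smooth_torus_L2[OF u] g] using hs_diff[OF hu[OF u] h'] by simp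
  have "(\<lambda>j. nrm2 k (\<lambda>n. fourier_coeff (u j) n - fourier_coeff g n)) \<longlonglongrightarrow> 0"
  proof (rule tendsto_sandwich[OF _ _ tendsto_const])
    show "(\<lambda>j. ((2 powr k)\<^sup>2 * (sobolev_norm k (\<lambda>x. u j x - g x))\<^sup>2) / (2 * pi)\<^sup>2) \<longlonglongrightarrow> 0"
      using l1 by (auto intro!: tendsto_eq_intros)
    show "\<forall>\<^sub>F j in sequentially. nrm2 k (\<lambda>n. fourier_coeff (u j) n - fourier_coeff g n)
        \<le> ((2 powr k)\<^sup>2 * (sobolev_norm k (\<lambda>x. u j x - g x))\<^sup>2) / (2 * pi)\<^sup>2"
      using sobolev_norm_bounds(1)[OF k d hd] unfolding diff_coeff[OF smooth_torus_L2[OF u] g]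
      by (simp add: pos_le_divide_eq mult.commute)
  qed (simp add: nrm2_nonneg)
  note lims = act_lim[of u, OF u this] act_hs[of u, OF u this]
  show "fourier_coeff (sobolev_ext k P g) = act K (fourier_coeff g)"
  proof
    fix l
    have "(\<lambda>j. act K (fourier_coeff (u j)) l) \<longlonglongrightarrow> fourier_coeff (sobolev_ext k P g) l"
    proof (rule tendsto_of_nrm2)
      note dc = diff_coeff[OF P(1)[OF u] eL, unfolded P(2)[OF u], symmetric]
      note dL = L2_torus_diff[OF P(1)[OF u] eL]
      show "hs 0 (\<lambda>n. act K (fourier_coeff (u j)) n - fourier_coeff (sobolev_ext k P g) n)" for j
        unfolding dc by (rule hs_fourier_coeff[OF dL])
      have "nrm2 0 (\<lambda>n. act K (fourier_coeff (u j)) n - fourier_coeff (sobolev_ext k P g) n)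
          = (L2_norm (\<lambda>x. P (u j) x - sobolev_ext k P g x))\<^sup>2 / (2 * pi)\<^sup>2" for j
        unfolding L2_norm_sq[OF dL] dc by simp
      thus "(\<lambda>j. nrm2 0 (\<lambda>n. act K (fourier_coeff (u j)) n - fourier_coeff (sobolev_ext k P g) n)) \<longlonglongrightarrow> 0"
        using l2 by (auto intro!: tendsto_eq_intros)
    qed
    thus "fourier_coeff (sobolev_ext k P g) l = act K (fourier_coeff g) l"
      by (rule LIMSEQ_unique[OF _ tendsto_of_nrm2[OF lims(2,1)]])
  qed
qed


subsection \<open>The estimate\<close>

definition idm :: matrix where
  "idm = (\<lambda>l n. if l = n then 1 else 0)"

lemma act_idm: "act idm x = x"
proof
  fix l
  have "(\<Sum>\<^sub>\<infinity>n. idm l n * x n) = (\<Sum>\<^sub>\<infinity>n\<in>{l}. idm l n * x n)"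
    by (rule infsum_cong_neutral) (auto simp: idm_def)
  thus "act idm x l = x l" by (simp add: act_def idm_def)
qed

lemma symbolic_idm: "symbolic 0 idm"
proof -
  have "ordm 0 idm"
    unfolding ordm_def bnd_def idm_def by (intro allI exI[of _ 1]) auto
  moreover have "dif p idm = (\<lambda>l n. 0)" for p
    by (simp add: dif_def idm_def)
  moreover have "dif q (\<lambda>l n. 0) = (\<lambda>l n. 0)" for q
    by (simp add: dif_def)
  ultimately show ?thesis
    unfolding symbolic_def ordf_def bnd_def by (auto intro!: exI[of _ 0])
qed

theorem theorem1p3:
  fixes Q :: "(plane \<Rightarrow> real) \<Rightarrow> plane \<Rightarrow> real"
  assumes "first_order_diff_op Q"
  shows "(\<exists>C::real. \<forall>f\<in>sobolev 2.
            L2_inner (Q (Q f)) f + L2_inner (Q f) (Q f) \<le> C * (L2_norm f)\<^sup>2)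
       \<and> (\<forall>(k::real) P. k \<ge> 1 \<longrightarrow> pseudodiff_op k P \<longrightarrow>
            (\<exists>C::real. \<forall>f\<in>sobolev (2 + k).
               L2_inner (sobolev_ext k P (Q (Q f))) (sobolev_ext k P f)
               + L2_inner (sobolev_ext k P (Q f)) (sobolev_ext k P (Q f))
               \<le> C * (sobolev_norm k f)\<^sup>2))"
proof -
  obtain b c where b: "\<And>i. b i \<in> smooth_torus" and c: "c \<in> smooth_torus"
    and Q: "\<And>f x. Q f x = (\<Sum>i\<in>UNIV. b i x * weak_partial i f x) + c x * f x"
    using assms unfolding first_order_diff_op_def by blast
  define D where "D = act (dmat (\<lambda>i. fourier_coeff (b i)) (fourier_coeff c))"
  \<comment> \<open>One application of \<open>Q\<close> costs one order. The order \<open>s\<close>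
    that remains is kept explicit so that \<open>Q\<close> can be applied twice.\<close>
  have Q_op: "Q f \<in> L2_torus" "fourier_coeff (Q f) = D (fourier_coeff f)" "hs s (fourier_coeff (Q f))"
    if "f \<in> L2_torus" "hs (1 + s) (fourier_coeff f)" "0 \<le> s" for f s
  proof -
    have "hs 1 (fourier_coeff f)" by (rule hs_mono_bound(1)[OF that(2)]) (use that(3) in auto)
    note F = first_order_fourier[OF b c Q that(1) this]
    show "Q f \<in> L2_torus" "fourier_coeff (Q f) = D (fourier_coeff f)"
      using F by (simp_all add: D_def)
    show "hs s (fourier_coeff (Q f))"
      unfolding F(2)
      by (rule hs_act[OF ordm_dmat[OF rapid_fourier_coeff[OF b] rapid_fourier_coeff[OF c]]])
        (use that(2) in \<open>simp add: add.commute\<close>)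
  qed
  have main: "\<exists>C. \<forall>x. hs (2 + k) x \<longrightarrow>
      Re (ip (act K (D (D x))) (act K x)) + Re (ip (act K (D x)) (act K (D x))) \<le> C * nrm2 k x"
    if "symbolic k K" for k K
    unfolding D_def
    by (rule frequency_estimate[OF that])
      (simp_all add: rapid_fourier_coeff b c fourier_coeff_minus)
  show ?thesis
  proof (intro conjI allI impI)
    \<comment> \<open>The identity matrix has vanishing differences, so it is symbolic of order 0
      and the same estimate covers the case without a pseudodifferential operator.\<close>
    obtain C where C: "\<And>x. hs (2 + 0) x \<Longrightarrow>
        Re (ip (D (D x)) x) + Re (ip (D x) (D x)) \<le> C * nrm2 0 x"
      using main[OF symbolic_idm] unfolding act_idm by blast
    show "\<exists>C. \<forall>f\<in>sobolev 2. L2_inner (Q (Q f)) f + L2_inner (Q f) (Q f) \<le> C * (L2_norm f)\<^sup>2"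
    proof (intro exI[of _ C] ballI)
      fix f assume "f \<in> sobolev 2"
      hence f: "f \<in> L2_torus" "hs 2 (fourier_coeff f)" by (auto dest: sobolev_hs[rotated])
      have Qf: "Q f \<in> L2_torus" "fourier_coeff (Q f) = D (fourier_coeff f)" "hs 1 (fourier_coeff (Q f))"
        using Q_op[of f 1] f by simp_all
      have QQf: "Q (Q f) \<in> L2_torus" "fourier_coeff (Q (Q f)) = D (D (fourier_coeff f))"
        using Q_op[of "Q f" 0] Qf by simp_all
      show "L2_inner (Q (Q f)) f + L2_inner (Q f) (Q f) \<le> C * (L2_norm f)\<^sup>2"
        using mult_left_mono[OF C[of "fourier_coeff f"], of "(2 * pi)\<^sup>2"] f(2)
        unfolding parseval[OF QQf(1) f(1)] parseval[OF Qf(1) Qf(1)] L2_norm_sq[OF f(1)] QQf(2) Qf(2)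
        by (simp add: distrib_left mult.left_commute[of C])
    qed
  next
    fix k :: real and P :: "(plane \<Rightarrow> real) \<Rightarrow> plane \<Rightarrow> real"
    assume k: "1 \<le> k" and "pseudodiff_op k P"
    then obtain a where a: "a \<in> symbol_class k" and P: "\<And>u x. u \<in> smooth_torus \<Longrightarrow>
        ((\<lambda>n. a (x, freq n) * fourier_coeff u n * cis (freq n \<bullet> x)) has_sum complex_of_real (P u x)) UNIV"
      unfolding pseudodiff_op_def by blast
    define K where "K = symbol_matrix a"
    have K: "symbolic k K" unfolding K_def by (rule symbolic_symbol_matrix[OF a])
    hence K0: "ordm k K" by (simp add: symbolic_def)
    have k0: "0 \<le> k" using k by simp
    have PK: "P u \<in> L2_torus" "fourier_coeff (P u) = act K (fourier_coeff u)" if "u \<in> smooth_torus" for u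
      using pseudodiff_fourier[OF a P that] by (simp_all add: K_def)
    have ext: "sobolev_ext k P g \<in> L2_torus" "fourier_coeff (sobolev_ext k P g) = act K (fourier_coeff g)"
      if "g \<in> L2_torus" "hs k (fourier_coeff g)" for g
      using sobolev_ext_fourier[of k K P g] k0 K0 PK that by blast+
    obtain C where C: "\<And>x. hs (2 + k) x \<Longrightarrow>
        Re (ip (act K (D (D x))) (act K x)) + Re (ip (act K (D x)) (act K (D x))) \<le> C * nrm2 k x"
      using main[OF K] by blast
    show "\<exists>C. \<forall>f\<in>sobolev (2 + k). L2_inner (sobolev_ext k P (Q (Q f))) (sobolev_ext k P f)
        + L2_inner (sobolev_ext k P (Q f)) (sobolev_ext k P (Q f)) \<le> C * (sobolev_norm k f)\<^sup>2"
    \<comment> \<open>The sign of \<open>C\<close> is unknown, and passing to the Sobolev norm is an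
      inequality, hence the absolute value; the factor \<open>(2 powr k)\<^sup>2\<close> compares
      the two weights.\<close>
    proof (intro exI[of _ "\<bar>C\<bar> * (2 powr k)\<^sup>2"] ballI)
      fix f assume "f \<in> sobolev (2 + k)"
      hence f: "f \<in> L2_torus" "hs (2 + k) (fourier_coeff f)" using k by (auto dest: sobolev_hs[rotated])
      have fk: "hs k (fourier_coeff f)" by (rule hs_mono_bound(1)[OF f(2)]) auto
      have Qf: "Q f \<in> L2_torus" "fourier_coeff (Q f) = D (fourier_coeff f)" "hs (1 + k) (fourier_coeff (Q f))"
        using Q_op[of f "1 + k"] f k by simp_all
      have Qfk: "hs k (fourier_coeff (Q f))" by (rule hs_mono_bound(1)[OF Qf(3)]) auto
      have QQf: "Q (Q f) \<in> L2_torus" "fourier_coeff (Q (Q f)) = D (D (fourier_coeff f))" "hs k (fourier_coeff (Q (Q f)))"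
        using Q_op[of "Q f" k] Qf k by simp_all
      let ?x = "fourier_coeff f"
      have "L2_inner (sobolev_ext k P (Q (Q f))) (sobolev_ext k P f)
          + L2_inner (sobolev_ext k P (Q f)) (sobolev_ext k P (Q f))
          = (2 * pi)\<^sup>2 * (Re (ip (act K (D (D ?x))) (act K ?x)) + Re (ip (act K (D ?x)) (act K (D ?x))))"
        using parseval[OF ext(1)[OF QQf(1,3)] ext(1)[OF f(1) fk]] parseval[OF ext(1)[OF Qf(1) Qfk] ext(1)[OF Qf(1) Qfk]]
        unfolding ext(2)[OF QQf(1,3)] ext(2)[OF f(1) fk] ext(2)[OF Qf(1) Qfk] QQf(2) Qf(2)
        by (simp only: distrib_left)
      also have "\<dots> \<le> (2 * pi)\<^sup>2 * (\<bar>C\<bar> * nrm2 k ?x)"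
        using C[OF f(2)] mult_right_mono[OF abs_ge_self nrm2_nonneg, of C k ?x] by (intro mult_left_mono) auto
      also have "\<dots> = \<bar>C\<bar> * ((2 * pi)\<^sup>2 * nrm2 k ?x)" by (rule mult.left_commute)
      also have "\<dots> \<le> \<bar>C\<bar> * ((2 powr k)\<^sup>2 * (sobolev_norm k f)\<^sup>2)"
        by (intro mult_left_mono sobolev_norm_bounds(1)[OF k0 f(1) fk]) simp
      finally show "L2_inner (sobolev_ext k P (Q (Q f))) (sobolev_ext k P f)
          + L2_inner (sobolev_ext k P (Q f)) (sobolev_ext k P (Q f)) \<le> \<bar>C\<bar> * (2 powr k)\<^sup>2 * (sobolev_norm k f)\<^sup>2"
        by (simp only: mult.assoc)
    qed
  qed
qed

end
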